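(* Let $\mathbf{k}$ be a non-Archimedean local field which is not of characteristic $2$ and is not an extension of $\mathbb{Q}_2$, and let $n\ge 1$ be an integer. Then the operator $$F= q^{2n}\int_{X_n\times X_n}\Psi\big(\phi(a_1)t_2-\phi(a_2)t_1\big)\,\lambda_{[g_1]^{-1}}\otimes\lambda_{[g_2]^{-1}}\,d[g_1]\,d[g_2],\qquad [g_j]=(a_j,[t_j]),$$ initially defined on $\mathcal{D}(X_n\times X_n)$, is a unitary operator on $L^2(X_n\times X_n)$ (i.e. it extends to a unitary operator on $L^2(X_n\times X_n)$).
   Context: Notation: $\mathcal{O}_{\mathbf{k}}$ is the ring of integers of $\mathbf{k}$, $\varpi$ is a generator of its maximal ideal, $q$ is the cardinality of the residue field $\mathcal{O}_{\mathbf{k}}/\varpi\mathcal{O}_{\mathbf{k}}$, and $|\cdot|_{\mathbf{k}}$ is the absolute value normalized by $|\varpi|_{\mathbf{k}}=q^{-1}$. The Haar measure $dt$ on $\mathbf{k}$ is normalized by $\mathrm{Vol}(\mathcal{O}_{\mathbf{k}})=1$. $\Psi$ is a fixed unitary character of the additive group $\mathbf{k}$ that is trivial on $\mathcal{O}_{\mathbf{k}}$ but not on $\varpi^{-1}\mathcal{O}_{\mathbf{k}}$. $U_n:=1+\varpi^n\mathcal{O}_{\mathbf{k}}$ is the multiplicative group of higher principal units, with Haar measure the restriction of $dt$. $\Gamma_n:=\mathbf{k}/\varpi^{-n}\mathcal{O}_{\mathbf{k}}$ is a discrete abelian group; $[t]$ denotes the class of $t\in\mathbf{k}$. $X_n:=U_n\ltimes\Gamma_n$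 is the group with underlying set $U_n\times\Gamma_n$ and law $$(a,[t])\cdot(a',[t'])=(aa',[a'^{-1}t+t']).$$ Its Haar measure $d[g]$ (with $[g]=(a,[t])$) is the product of the Haar measure of $U_n$ and the counting measure of $\Gamma_n$; $X_n$ is unimodular. $\phi:U_n\to\varpi^n\mathcal{O}_{\mathbf{k}}$ is $\phi(a)=a-a^{-1}$; note that $\Psi(\phi(a)t)$ depends only on $a$ and $[t]$. $\lambda$ is the left regular representation of $X_n$: $\lambda_{[g]}f([g'])=f([g]^{-1}[g'])$. $\mathcal{D}(X_n\times X_n)$ is the space of locally constant compactly supported complex functions on $X_n\times X_n$. The formula for $F$ means: for $f\in\mathcal{D}(X_n\times X_n)$, $$Ff([g_1'],[g_2'])=q^{2n}\int_{X_n\times X_n}\Psi\big(\phi(a_1)t_2-\phi(a_2)t_1\big)\,f\big([g_1][g_1'],[g_2][g_2']\big)\,d[g_1]\,d[g_2],$$ an absolutely convergent integral for each $([g_1'],[g_2'])$. *)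

theory Defs
  imports "HOL-Analysis.Analysis" "HOL-Algebra.QuotRing"
    "HOL-Computational_Algebra.Computational_Algebra"
begin

definition padic_abs :: "nat \<Rightarrow> rat \<Rightarrow> real" where
  "padic_abs p x = (if x = 0 then 0 else
     (let (a, b) = quotient_of x
      in real p powi (int (multiplicity (int p) b) - int (multiplicity (int p) a))))"

definition padic_Cauchy :: "nat \<Rightarrow> (nat \<Rightarrow> rat) \<Rightarrow> bool" where
  "padic_Cauchy p x \<longleftrightarrow> (\<forall>e>0. \<exists>N. \<forall>i\<ge>N. \<forall>j\<ge>N. padic_abs p (x i - x j) < e)"

definition padic_null :: "nat \<Rightarrow> (nat \<Rightarrow> rat) \<Rightarrow> bool" where
  "padic_null p x \<longleftrightarrow> (\<lambda>i. padic_abs p (x i)) \<longlonglongrightarrow> 0"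

definition padic_Cauchy_ring :: "nat \<Rightarrow> (nat \<Rightarrow> rat) ring" where
  "padic_Cauchy_ring p =
     \<lparr>carrier = {x. padic_Cauchy p x},
      mult = (\<lambda>x y i. x i * y i), one = (\<lambda>i. 1),
      zero = (\<lambda>i. 0), add = (\<lambda>x y i. x i + y i)\<rparr>"

definition Qp :: "nat \<Rightarrow> (nat \<Rightarrow> rat) set ring" where
  "Qp p = padic_Cauchy_ring p Quot {x. padic_Cauchy p x \<and> padic_null p x}"

definition type_ring :: "'k::field ring" where
  "type_ring = \<lparr>carrier = UNIV, mult = (*), one = 1, zero = 0, add = (+)\<rparr>"

text \<open>"Extension" is meant as a field extension; no topology is involved. A unital ring homomorphism between fields is automatically injective.\<close>

definition is_extension_of_Qp :: "nat \<Rightarrow> 'k::field itself \<Rightarrow> bool" where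
  "is_extension_of_Qp p _ \<longleftrightarrow> ring_hom (Qp p) (type_ring :: 'k ring) \<noteq> {}"

definition ring_of_integers :: "('k::field \<Rightarrow> real) \<Rightarrow> 'k set" where
  "ring_of_integers av = {x. av x \<le> 1}"

definition frac_ideal :: "('k::field \<Rightarrow> real) \<Rightarrow> 'k \<Rightarrow> int \<Rightarrow> 'k set" where
  "frac_ideal av \<pi> m = (\<lambda>x. \<pi> powi m * x) ` ring_of_integers av"

definition residue_field :: "('k::field \<Rightarrow> real) \<Rightarrow> 'k \<Rightarrow> 'k set set" where
  "residue_field av \<pi> =
     ring_of_integers av //
       {(x, y). x \<in> ring_of_integers av \<and> y \<in> ring_of_integers av \<and> x - y \<in> frac_ideal av \<pi> 1}"

definition residue_card :: "('k::field \<Rightarrow> real) \<Rightarrow> 'k \<Rightarrow> nat" where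
  "residue_card av \<pi> = card (residue_field av \<pi>)"

text \<open>
  The type class only supplies the topology (hence the Borel sets); the metric is the one given by
  the normalized absolute value \<open>av\<close>. Discreteness and nontriviality of \<open>av\<close> are contained in
  \<open>uniformizer\<close>: the set of all \<open>x\<close> with \<open>av x < 1\<close> is the maximal ideal of the ring of integers.
\<close>

locale nonarch_local_field =
  fixes av :: "'k::{field, metric_space} \<Rightarrow> real" and \<pi> :: 'k
  assumes av_nonneg: "av x \<ge> 0"
    and av_eq_0_iff: "av x = 0 \<longleftrightarrow> x = 0"
    and av_mult: "av (x * y) = av x * av y"
    and av_ultrametric: "av (x + y) \<le> max (av x) (av y)"
    and dist_av: "dist x y = av (x - y)"
    and complete: "complete (UNIV :: 'k set)"
    and uniformizer: "\<pi> \<noteq> 0" "{x. av x < 1} = frac_ideal av \<pi> 1"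
    and finite_residue_field: "finite (residue_field av \<pi>)"
    and normalized: "av \<pi> = 1 / real (residue_card av \<pi>)"

definition normalized_Haar ::
    "('k::{field, metric_space} \<Rightarrow> real) \<Rightarrow> 'k measure \<Rightarrow> bool" where
  "normalized_Haar av \<mu> \<longleftrightarrow>
     sets \<mu> = sets borel \<and>
     (\<forall>A\<in>sets borel. \<forall>x. emeasure \<mu> ((+) x ` A) = emeasure \<mu> A) \<and>
     emeasure \<mu> (ring_of_integers av) = 1"

definition unramified_character ::
    "('k::{field, metric_space} \<Rightarrow> real) \<Rightarrow> 'k \<Rightarrow> ('k \<Rightarrow> complex) \<Rightarrow> bool" where
  "unramified_character av \<pi> \<Psi> \<longleftrightarrow>
     continuous_on UNIV \<Psi> \<and>
     (\<forall>x. cmod (\<Psi> x) = 1) \<and>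
     (\<forall>x y. \<Psi> (x + y) = \<Psi> x * \<Psi> y) \<and>
     (\<forall>x\<in>ring_of_integers av. \<Psi> x = 1) \<and>
     (\<exists>x\<in>frac_ideal av \<pi> (- 1). \<Psi> x \<noteq> 1)"

definition principal_units :: "('k::field \<Rightarrow> real) \<Rightarrow> 'k \<Rightarrow> nat \<Rightarrow> 'k set" where
  "principal_units av \<pi> n = (+) 1 ` frac_ideal av \<pi> (int n)"

definition Gam_rel :: "('k::field \<Rightarrow> real) \<Rightarrow> 'k \<Rightarrow> nat \<Rightarrow> ('k \<times> 'k) set" where
  "Gam_rel av \<pi> n = {(s, t). s - t \<in> frac_ideal av \<pi> (- int n)}"

definition Gam :: "('k::field \<Rightarrow> real) \<Rightarrow> 'k \<Rightarrow> nat \<Rightarrow> 'k set set" where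
  "Gam av \<pi> n = UNIV // Gam_rel av \<pi> n"

text \<open>An arbitrary representative of a class; all uses below are independent of the choice.\<close>

definition rep :: "'a set \<Rightarrow> 'a" where
  "rep C = (SOME t. t \<in> C)"

definition X_group :: "('k::field \<Rightarrow> real) \<Rightarrow> 'k \<Rightarrow> nat \<Rightarrow> ('k \<times> 'k set) monoid" where
  "X_group av \<pi> n =
     \<lparr>carrier = principal_units av \<pi> n \<times> Gam av \<pi> n,
      mult = (\<lambda>(a, C) (a', C'). (a * a', Gam_rel av \<pi> n `` {inverse a' * rep C + rep C'})),
      one = (1, Gam_rel av \<pi> n `` {0})\<rparr>"

definition X_measure ::
    "('k::{field, metric_space} \<Rightarrow> real) \<Rightarrow> 'k \<Rightarrow> 'k measure \<Rightarrow> nat \<Rightarrow> ('k \<times> 'k set) measure" where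
  "X_measure av \<pi> \<mu> n =
     restrict_space \<mu> (principal_units av \<pi> n) \<Otimes>\<^sub>M count_space (Gam av \<pi> n)"

definition XX_measure ::
    "('k::{field, metric_space} \<Rightarrow> real) \<Rightarrow> 'k \<Rightarrow> 'k measure \<Rightarrow> nat
      \<Rightarrow> (('k \<times> 'k set) \<times> ('k \<times> 'k set)) measure" where
  "XX_measure av \<pi> \<mu> n = X_measure av \<pi> \<mu> n \<Otimes>\<^sub>M X_measure av \<pi> \<mu> n"

definition X_topology ::
    "('k::{field, metric_space} \<Rightarrow> real) \<Rightarrow> 'k \<Rightarrow> nat \<Rightarrow> ('k \<times> 'k set) topology" where
  "X_topology av \<pi> n =
     prod_topology (top_of_set (principal_units av \<pi> n)) (discrete_topology (Gam av \<pi> n))"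

definition XX_topology ::
    "('k::{field, metric_space} \<Rightarrow> real) \<Rightarrow> 'k \<Rightarrow> nat
      \<Rightarrow> (('k \<times> 'k set) \<times> ('k \<times> 'k set)) topology" where
  "XX_topology av \<pi> n = prod_topology (X_topology av \<pi> n) (X_topology av \<pi> n)"

text \<open>Functions on a space are total functions of which only the values on the space matter.\<close>

definition locally_constant_on :: "'a topology \<Rightarrow> ('a \<Rightarrow> 'b) \<Rightarrow> bool" where
  "locally_constant_on T f \<longleftrightarrow>
     (\<forall>x\<in>topspace T. \<exists>V. openin T V \<and> x \<in> V \<and> (\<forall>y\<in>V. f y = f x))"

definition test_functions :: "'a topology \<Rightarrow> ('a \<Rightarrow> complex) set" where
  "test_functions T =
     {f. locally_constant_on T f \<and> compactin T (T closure_of {x \<in> topspace T. f x \<noteq> 0})}"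

definition L2_fun :: "'a measure \<Rightarrow> ('a \<Rightarrow> complex) set" where
  "L2_fun M = {f \<in> borel_measurable M. integrable M (\<lambda>x. (cmod (f x))\<^sup>2)}"

text \<open>For a function \<open>f\<close> that is not almost everywhere equal to a square-integrable one,
  \<open>L2_class M f\<close> is empty, hence not an element of \<open>L2 M\<close>.\<close>

definition L2_class :: "'a measure \<Rightarrow> ('a \<Rightarrow> complex) \<Rightarrow> ('a \<Rightarrow> complex) set" where
  "L2_class M f = {g \<in> L2_fun M. AE x in M. g x = f x}"

definition L2 :: "'a measure \<Rightarrow> ('a \<Rightarrow> complex) set set" where
  "L2 M = L2_class M ` L2_fun M"

definition L2_add ::
    "'a measure \<Rightarrow> ('a \<Rightarrow> complex) set \<Rightarrow> ('a \<Rightarrow> complex) set \<Rightarrow> ('a \<Rightarrow> complex) set" where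
  "L2_add M A B = L2_class M (\<lambda>x. rep A x + rep B x)"

definition L2_scale ::
    "'a measure \<Rightarrow> complex \<Rightarrow> ('a \<Rightarrow> complex) set \<Rightarrow> ('a \<Rightarrow> complex) set" where
  "L2_scale M c A = L2_class M (\<lambda>x. c * rep A x)"

definition L2_inner ::
    "'a measure \<Rightarrow> ('a \<Rightarrow> complex) set \<Rightarrow> ('a \<Rightarrow> complex) set \<Rightarrow> complex" where
  "L2_inner M A B = (LINT x|M. rep A x * cnj (rep B x))"

definition L2_unitary ::
    "'a measure \<Rightarrow> (('a \<Rightarrow> complex) set \<Rightarrow> ('a \<Rightarrow> complex) set) \<Rightarrow> bool" where
  "L2_unitary M T \<longleftrightarrow>
     bij_betw T (L2 M) (L2 M) \<and>
     (\<forall>A\<in>L2 M. \<forall>B\<in>L2 M. T (L2_add M A B) = L2_add M (T A) (T B)) \<and>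
     (\<forall>c. \<forall>A\<in>L2 M. T (L2_scale M c A) = L2_scale M c (T A)) \<and>
     (\<forall>A\<in>L2 M. \<forall>B\<in>L2 M. L2_inner M (T A) (T B) = L2_inner M A B)"

definition phi :: "'k::field \<Rightarrow> 'k" where
  "phi a = a - inverse a"

text \<open>The value of \<open>\<Psi>\<close> does not depend on the representatives: \<open>phi\<close> maps the principal units of
  level \<open>n\<close> into \<open>frac_ideal av \<pi> n\<close>, and \<open>\<Psi>\<close> is trivial on the ring of integers.\<close>

definition F_integrand ::
    "('k::{field, metric_space} \<Rightarrow> real) \<Rightarrow> 'k \<Rightarrow> ('k \<Rightarrow> complex) \<Rightarrow> nat
      \<Rightarrow> (('k \<times> 'k set) \<times> ('k \<times> 'k set) \<Rightarrow> complex)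
      \<Rightarrow> ('k \<times> 'k set) \<times> ('k \<times> 'k set)
      \<Rightarrow> ('k \<times> 'k set) \<times> ('k \<times> 'k set) \<Rightarrow> complex" where
  "F_integrand av \<pi> \<Psi> n f = (\<lambda>(h1, h2) (g1, g2).
     \<Psi> (phi (fst g1) * rep (snd g2) - phi (fst g2) * rep (snd g1)) *
     f (g1 \<otimes>\<^bsub>X_group av \<pi> n\<^esub> h1, g2 \<otimes>\<^bsub>X_group av \<pi> n\<^esub> h2))"

definition F_op ::
    "('k::{field, metric_space} \<Rightarrow> real) \<Rightarrow> 'k \<Rightarrow> ('k \<Rightarrow> complex) \<Rightarrow> 'k measure \<Rightarrow> nat
      \<Rightarrow> (('k \<times> 'k set) \<times> ('k \<times> 'k set) \<Rightarrow> complex)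
      \<Rightarrow> ('k \<times> 'k set) \<times> ('k \<times> 'k set) \<Rightarrow> complex" where
  "F_op av \<pi> \<Psi> \<mu> n f h =
     of_nat (residue_card av \<pi>) ^ (2 * n) *
     (LINT g|XX_measure av \<pi> \<mu> n. F_integrand av \<pi> \<Psi> n f h g)"

end

theory Submission
  imports Defs
begin

text \<open>
  The substitution \<open>g \<mapsto> g h\<^sup>-\<^sup>1\<close> turns \<open>F\<close> into an integral operator with kernel
  \<open>\<Psi> (\<phi>(a\<^sub>1/b\<^sub>1) b\<^sub>2 (t\<^sub>2 - s\<^sub>2) - \<phi>(a\<^sub>2/b\<^sub>2) b\<^sub>1 (t\<^sub>1 - s\<^sub>1))\<close>, where \<open>h\<^sub>j = (b\<^sub>j, [s\<^sub>j])\<close>.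
  The hypotheses on \<open>k\<close> mean that \<open>2\<close> is a unit, so \<open>\<phi>\<close> is an isometry of \<open>U\<^sub>n\<close> onto \<open>\<pi>\<^sup>n O\<close>, and
  \<open>b \<mapsto> (\<phi>(a\<^sub>2/b\<^sub>2) b\<^sub>1, \<phi>(a\<^sub>1/b\<^sub>1) b\<^sub>2)\<close> is an isometry for the maximum norm. For \<open>m \<ge> n\<close> the functions
  that depend on the \<open>a\<^sub>j\<close> only modulo \<open>\<pi>\<^sup>m O\<close> and are supported on \<open>t\<^sub>j \<in> \<pi>\<^sup>-\<^sup>m O\<close> form a finite-dimensional space,
  on which the kernel becomes a finite square matrix. Orthogonality of characters together with these isometries, which
  permute residue classes, shows that the rows and the columns of this matrix are orthogonal, so \<open>F\<close> is an
  isometric bijection of each of these spaces. Their union is dense in \<open>L\<^sup>2\<close>, and \<open>F\<close> extends by completeness.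
\<close>

section \<open>Extension of densely defined isometries of \<open>L\<^sup>2\<close>\<close>

text \<open>The factor q^(2n) is what makes F unitary: at level m a class has volume q^(-2m), and
  q^(2n) q^(-2m) = N^(-2) with N = \<open>N m\<close>, while the matrix has N^4 rows and columns
  with entries of modulus 1. The map in b is not a product map; its cross terms carry a factor
  phi(...) in pi^n O and are contractions because n >= 1, so they cannot upset the leading isometry.
  The obstacle is the support: the matrix formula describes F f only at points with t_j in pi^(-m)
  O, and nothing direct says that F f vanishes elsewhere. Comparing levels settles this, since the
  matrices of all levels are isometric. That 2 is a unit is proved by contradiction: if |2| < 1 and
  the characteristic is not 2, then it is 0, the absolute value restricts to a power of the 2-adic
  one on the rationals, and completeness yields a homomorphism from Q_2.\<close>

definition L2_norm :: "'a measure \<Rightarrow> ('a \<Rightarrow> complex) \<Rightarrow> real" where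
  "L2_norm M f = sqrt (LINT x|M. (cmod (f x))\<^sup>2)"

text \<open>The weight \<open>t\<close> stays free: \<open>t = 1\<close> gives closure of
  square-integrable functions under sums, and a ratio of norms gives Minkowski's inequality after
  integration.\<close>

lemma cmod_add_square_le:
  fixes a b :: complex
  assumes "t > 0"
  shows "(cmod (a + b))\<^sup>2 \<le> (1 + t) * (cmod a)\<^sup>2 + (1 + 1 / t) * (cmod b)\<^sup>2"
proof -
  have "0 \<le> (t * cmod a - cmod b)\<^sup>2 / t"
    using assms by simp
  also have "\<dots> = t * (cmod a)\<^sup>2 + (cmod b)\<^sup>2 / t - 2 * cmod a * cmod b"
    using assms by (simp add: field_simps power2_eq_square)
  finally have 1: "2 * cmod a * cmod b \<le> t * (cmod a)\<^sup>2 + (cmod b)\<^sup>2 / t" by simp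
  have "(cmod (a + b))\<^sup>2 \<le> (cmod a + cmod b)\<^sup>2"
    by (intro power_mono norm_triangle_ineq) auto
  also have "\<dots> = (cmod a)\<^sup>2 + (cmod b)\<^sup>2 + 2 * cmod a * cmod b"
    by (simp add: power2_eq_square algebra_simps)
  finally show ?thesis using 1 by (simp add: algebra_simps)
qed

lemma L2_fun_add:
  assumes "f \<in> L2_fun M" "g \<in> L2_fun M"
  shows "(\<lambda>x. f x + g x) \<in> L2_fun M"
proof -
  note [measurable] = assms[unfolded L2_fun_def, simplified, THEN conjunct1]
  have "integrable M (\<lambda>x. (cmod (f x + g x))\<^sup>2)"
  proof (rule Bochner_Integration.integrable_bound)
    show "integrable M (\<lambda>x. 2 * (cmod (f x))\<^sup>2 + 2 * (cmod (g x))\<^sup>2)"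
      using assms by (auto simp: L2_fun_def)
  qed (use cmod_add_square_le[of 1] in auto)
  then show ?thesis by (auto simp: L2_fun_def)
qed

lemma L2_fun_scale:
  assumes "f \<in> L2_fun M"
  shows "(\<lambda>x. c * f x) \<in> L2_fun M"
  using assms by (auto simp: L2_fun_def norm_mult power_mult_distrib)

lemma L2_fun_diff:
  assumes "f \<in> L2_fun M" "g \<in> L2_fun M"
  shows "(\<lambda>x. f x - g x) \<in> L2_fun M"
  using L2_fun_add[OF assms(1) L2_fun_scale[OF assms(2), of "-1"]] by simp

lemma L2_norm_nonneg [simp]: "L2_norm M f \<ge> 0"
  by (simp add: L2_norm_def)

lemma L2_norm_square: "(L2_norm M f)\<^sup>2 = (LINT x|M. (cmod (f x))\<^sup>2)"
  by (simp add: L2_norm_def)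

lemma L2_norm_scale: "L2_norm M (\<lambda>x. c * f x) = cmod c * L2_norm M f"
  by (simp add: L2_norm_def norm_mult power_mult_distrib real_sqrt_mult)

lemma L2_norm_minus_commute: "L2_norm M (\<lambda>x. f x - g x) = L2_norm M (\<lambda>x. g x - f x)"
  by (simp add: L2_norm_def norm_minus_commute)

lemma L2_norm_eq_0_iff:
  assumes "f \<in> L2_fun M"
  shows "L2_norm M f = 0 \<longleftrightarrow> (AE x in M. f x = 0)"
  using assms integral_nonneg_eq_0_iff_AE[of M "\<lambda>x. (cmod (f x))\<^sup>2"]
  by (simp add: L2_fun_def L2_norm_def)

lemma L2_norm_triangle:
  assumes f: "f \<in> L2_fun M" and g: "g \<in> L2_fun M"
  shows "L2_norm M (\<lambda>x. f x + g x) \<le> L2_norm M f + L2_norm M g"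
proof -
  let ?a = "L2_norm M f" and ?b = "L2_norm M g" and ?c = "L2_norm M (\<lambda>x. f x + g x)"
  have *: "?c\<^sup>2 \<le> (1 + t) * ?a\<^sup>2 + (1 + 1 / t) * ?b\<^sup>2" if "t > 0" for t
  proof -
    have "?c\<^sup>2 \<le> (LINT x|M. (1 + t) * (cmod (f x))\<^sup>2 + (1 + 1 / t) * (cmod (g x))\<^sup>2)"
      unfolding L2_norm_square
      by (rule integral_mono)
        (use L2_fun_add[OF f g] f g cmod_add_square_le[OF that] in \<open>auto simp: L2_fun_def\<close>)
    also have "\<dots> = (1 + t) * ?a\<^sup>2 + (1 + 1 / t) * ?b\<^sup>2"
      unfolding L2_norm_square using f g by (auto simp: L2_fun_def)
    finally show ?thesis .
  qed
  \<comment> \<open>Strict upper bounds keep \<open>\<beta> / \<alpha>\<close> meaningful when a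
    norm is zero. With this ratio as \<open>t\<close> the bound becomes the square of
    \<open>\<alpha> + \<beta>\<close>.\<close>
  have **: "?c \<le> \<alpha> + \<beta>" if \<alpha>: "\<alpha> > ?a" and \<beta>: "\<beta> > ?b" for \<alpha> \<beta>
  proof -
    have pos: "\<alpha> > 0" "\<beta> > 0"
      using \<alpha> \<beta> L2_norm_nonneg[of M f] L2_norm_nonneg[of M g] by linarith+
    have "?c\<^sup>2 \<le> (1 + \<beta> / \<alpha>) * ?a\<^sup>2 + (1 + 1 / (\<beta> / \<alpha>)) * ?b\<^sup>2"
      using pos by (intro *) auto
    also have "\<dots> \<le> (1 + \<beta> / \<alpha>) * \<alpha>\<^sup>2 + (1 + 1 / (\<beta> / \<alpha>)) * \<beta>\<^sup>2"
      using pos \<alpha> \<beta> by (intro add_mono mult_left_mono power_mono) auto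
    also have "\<dots> = (\<alpha> + \<beta>)\<^sup>2"
      using pos by (simp add: field_simps power2_eq_square)
    finally show ?thesis
      using pos by (simp add: power2_le_iff_abs_le)
  qed
  show ?thesis
  proof (rule field_le_epsilon)
    fix e :: real assume "e > 0"
    then show "?c \<le> ?a + ?b + e"
      using **[of "?a + e / 2" "?b + e / 2"] by (simp add: field_simps)
  qed
qed

lemma L2_norm_triangle_diff:
  assumes "f \<in> L2_fun M" "g \<in> L2_fun M" "h \<in> L2_fun M"
  shows "L2_norm M (\<lambda>x. f x - h x) \<le> L2_norm M (\<lambda>x. f x - g x) + L2_norm M (\<lambda>x. g x - h x)"
  using L2_norm_triangle[OF L2_fun_diff[OF assms(1,2)] L2_fun_diff[OF assms(2,3)]] by simp

lemma L2_norm_diff_bound: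
  assumes "f \<in> L2_fun M" "g \<in> L2_fun M"
  shows "\<bar>L2_norm M f - L2_norm M g\<bar> \<le> L2_norm M (\<lambda>x. f x - g x)"
  using L2_norm_triangle[OF L2_fun_diff[OF assms] assms(2)]
    L2_norm_triangle[OF L2_fun_diff[OF assms(2,1)] assms(1)]
    L2_norm_minus_commute[of M f g] by simp

text \<open>Riesz-Fischer with a prescribed rate. The squared differences have integrals at most
  4^(-k), so the weights 2^k leave a convergent series; at almost every point its finite sum bounds
  the k-th difference by a constant times 2^(-k/2), and \<open>s k x\<close> converges.\<close>

lemma L2_complete_fast:
  fixes s :: "nat \<Rightarrow> 'a \<Rightarrow> complex"
  assumes s: "\<And>k. s k \<in> L2_fun M"
    and fast: "\<And>k l. k \<le> l \<Longrightarrow> L2_norm M (\<lambda>x. s k x - s l x) \<le> (1/2) ^ k"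
  shows "\<exists>g\<in>L2_fun M. \<forall>k. L2_norm M (\<lambda>x. s k x - g x) \<le> (1/2) ^ k"
proof -
  have [measurable]: "s k \<in> borel_measurable M" for k
    using s[of k] by (auto simp: L2_fun_def)
  have nn: "(\<integral>\<^sup>+x. ennreal ((cmod (f x))\<^sup>2) \<partial>M) = ennreal ((L2_norm M f)\<^sup>2)" if "f \<in> L2_fun M" for f
    unfolding L2_norm_square using that by (intro nn_integral_eq_integral) (auto simp: L2_fun_def)
  let ?d = "\<lambda>k x. (cmod (s k x - s (Suc k) x))\<^sup>2"
  have d: "(\<integral>\<^sup>+x. ennreal (2 ^ k * ?d k x) \<partial>M) \<le> ennreal ((1/2) ^ k)" for k
  proof -
    have "(\<integral>\<^sup>+x. ennreal (2 ^ k * ?d k x) \<partial>M) = ennreal (2 ^ k) * (\<integral>\<^sup>+x. ennreal (?d k x) \<partial>M)"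
      by (subst nn_integral_cmult[symmetric]) (auto simp: ennreal_mult)
    also have "\<dots> = ennreal (2 ^ k * (L2_norm M (\<lambda>x. s k x - s (Suc k) x))\<^sup>2)"
      using nn[OF L2_fun_diff[OF s[of k] s[of "Suc k"]]] by (simp add: ennreal_mult)
    also have "\<dots> \<le> ennreal (2 ^ k * ((1/2) ^ k)\<^sup>2)"
      by (intro ennreal_leI mult_left_mono power_mono fast) auto
    also have "(2::real) ^ k * ((1/2) ^ k)\<^sup>2 = (1/2) ^ k"
      by (simp add: power2_eq_square power_one_over)
    finally show ?thesis .
  qed
  have "(\<integral>\<^sup>+x. (\<Sum>k. ennreal (2 ^ k * ?d k x)) \<partial>M) = (\<Sum>k. \<integral>\<^sup>+x. ennreal (2 ^ k * ?d k x) \<partial>M)"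
    by (intro nn_integral_suminf) auto
  also have "\<dots> \<le> (\<Sum>k. ennreal ((1/2) ^ k))"
    by (intro suminf_le d) auto
  also have "\<dots> < \<infinity>"
    by (subst suminf_ennreal2) auto
  finally have "AE x in M. (\<Sum>k. ennreal (2 ^ k * ?d k x)) \<noteq> \<infinity>"
    by (intro nn_integral_PInf_AE) auto
  then have "AE x in M. convergent (\<lambda>k. s k x)"
  proof eventually_elim
    case (elim x)
    have sm: "summable (\<lambda>k. 2 ^ k * ?d k x)"
      using elim by (intro summable_suminf_not_top) (auto simp: top_ennreal_def)
    have b: "2 ^ k * ?d k x \<le> (\<Sum>k. 2 ^ k * ?d k x)" for k
      using sum_le_suminf[OF sm, of "{k}"] by auto
    define C where "C = sqrt (\<Sum>k. 2 ^ k * ?d k x)"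
    have le: "cmod (s (Suc k) x - s k x) \<le> C * (sqrt (1/2)) ^ k" for k
    proof -
      have "?d k x \<le> (\<Sum>k. 2 ^ k * ?d k x) * (1/2) ^ k"
        using b[of k] by (simp add: field_simps power_one_over)
      then have "sqrt (?d k x) \<le> sqrt ((\<Sum>k. 2 ^ k * ?d k x) * (1/2) ^ k)"
        by (rule real_sqrt_le_mono)
      then show ?thesis
        by (simp add: C_def real_sqrt_mult real_sqrt_power norm_minus_commute)
    qed
    have "summable (\<lambda>k. C * (sqrt (1/2)) ^ k)"
      by (intro summable_mult summable_geometric) (simp add: real_sqrt_divide)
    then have "summable (\<lambda>k. s (Suc k) x - s k x)"
      by (rule summable_comparison_test'[where N = 0]) (use le in simp)
    then have "convergent (\<lambda>n. \<Sum>k<n. s (Suc k) x - s k x)"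
      by (simp add: summable_iff_convergent)
    then have "convergent (\<lambda>n. s n x - s 0 x)"
      by (simp add: sum_lessThan_telescope[where f = "\<lambda>k. s k x"])
    then have "convergent (\<lambda>n. (s n x - s 0 x) + s 0 x)"
      by (intro convergent_add convergent_const)
    then show ?case by simp
  qed
  then have lim: "AE x in M. (\<lambda>k. s k x) \<longlonglongrightarrow> lim (\<lambda>k. s k x)"
    by eventually_elim (simp add: convergent_LIMSEQ_iff)
  define g where "g x = lim (\<lambda>k. s k x)" for x
  have [measurable]: "g \<in> borel_measurable M"
    unfolding g_def by (rule borel_measurable_lim_metric) auto
  \<comment> \<open>Fatou's lemma in the second index passes the Cauchy estimate to the limit
    without loss in the rate.\<close>
  have bound: "(\<integral>\<^sup>+x. ennreal ((cmod (s k x - g x))\<^sup>2) \<partial>M) \<le> ennreal (((1/2) ^ k)\<^sup>2)" for k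
  proof -
    have "(\<integral>\<^sup>+x. ennreal ((cmod (s k x - g x))\<^sup>2) \<partial>M)
        = (\<integral>\<^sup>+x. liminf (\<lambda>l. ennreal ((cmod (s k x - s l x))\<^sup>2)) \<partial>M)"
    proof (intro nn_integral_cong_AE)
      show "AE x in M. ennreal ((cmod (s k x - g x))\<^sup>2) = liminf (\<lambda>l. ennreal ((cmod (s k x - s l x))\<^sup>2))"
        using lim
      proof eventually_elim
        case (elim x)
        have "(\<lambda>l. ennreal ((cmod (s k x - s l x))\<^sup>2)) \<longlonglongrightarrow> ennreal ((cmod (s k x - g x))\<^sup>2)"
          unfolding g_def by (intro tendsto_intros elim)
        then show ?case
          by (intro lim_imp_Liminf[symmetric]) auto
      qed
    qed
    also have "\<dots> \<le> liminf (\<lambda>l. \<integral>\<^sup>+x. ennreal ((cmod (s k x - s l x))\<^sup>2) \<partial>M)"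
      by (intro nn_integral_liminf) auto
    also have "\<dots> \<le> limsup (\<lambda>l. \<integral>\<^sup>+x. ennreal ((cmod (s k x - s l x))\<^sup>2) \<partial>M)"
      by (intro Liminf_le_Limsup) auto
    also have "\<dots> \<le> ennreal (((1/2) ^ k)\<^sup>2)"
    proof (rule Limsup_bounded)
      show "\<forall>\<^sub>F l in sequentially. (\<integral>\<^sup>+x. ennreal ((cmod (s k x - s l x))\<^sup>2) \<partial>M) \<le> ennreal (((1/2) ^ k)\<^sup>2)"
        using eventually_ge_at_top[of k]
      proof eventually_elim
        case (elim l)
        show ?case
          unfolding nn[OF L2_fun_diff[OF s s]]
          by (intro ennreal_leI power_mono fast elim) auto
      qed
    qed
    finally show ?thesis .
  qed
  have diff: "(\<lambda>x. s k x - g x) \<in> L2_fun M" for k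
  proof -
    have "integrable M (\<lambda>x. (cmod (s k x - g x))\<^sup>2)"
    proof (rule integrableI_bounded)
      show "(\<integral>\<^sup>+x. ennreal (norm ((cmod (s k x - g x))\<^sup>2)) \<partial>M) < \<infinity>"
        using bound[of k] by (simp add: ennreal_less_top le_less_trans)
    qed auto
    then show ?thesis by (auto simp: L2_fun_def)
  qed
  have "g \<in> L2_fun M"
    using L2_fun_diff[OF s[of 0] diff[of 0]] by simp
  moreover have "L2_norm M (\<lambda>x. s k x - g x) \<le> (1/2) ^ k" for k
  proof -
    have "(L2_norm M (\<lambda>x. s k x - g x))\<^sup>2 \<le> ((1/2) ^ k)\<^sup>2"
      using bound[of k] unfolding nn[OF diff] by (subst (asm) ennreal_le_iff) auto
    then show ?thesis
      by (rule power2_le_imp_le) simp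
  qed
  ultimately show ?thesis by blast
qed

section \<open>Square-integrable functions and their classes\<close>

lemma L2_class_eqI:
  assumes "AE x in M. f x = g x"
  shows "L2_class M f = L2_class M g"
proof -
  have "(AE x in M. h x = f x) \<longleftrightarrow> (AE x in M. h x = g x)" for h
  proof
    assume "AE x in M. h x = f x"
    with assms show "AE x in M. h x = g x" by eventually_elim simp
  next
    assume "AE x in M. h x = g x"
    with assms show "AE x in M. h x = f x" by eventually_elim simp
  qed
  then show ?thesis by (auto simp: L2_class_def)
qed

lemma L2_class_self: "f \<in> L2_fun M \<Longrightarrow> f \<in> L2_class M f"
  by (simp add: L2_class_def)

lemma L2_class_eq_iff:
  assumes "f \<in> L2_fun M" "g \<in> L2_fun M"
  shows "L2_class M f = L2_class M g \<longleftrightarrow> L2_norm M (\<lambda>x. f x - g x) = 0"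
proof -
  have "L2_class M f = L2_class M g \<longleftrightarrow> (AE x in M. f x = g x)"
    using L2_class_self[OF assms(1)] L2_class_eqI[of f g M] by (auto simp: L2_class_def)
  then show ?thesis
    unfolding L2_norm_eq_0_iff[OF L2_fun_diff[OF assms]] by simp
qed

lemma rep_L2_class:
  assumes "f \<in> L2_fun M"
  shows "rep (L2_class M f) \<in> L2_fun M" "AE x in M. rep (L2_class M f) x = f x"
proof -
  have "rep (L2_class M f) \<in> L2_class M f"
    unfolding rep_def by (rule someI[of "\<lambda>t. t \<in> L2_class M f"], rule L2_class_self[OF assms])
  then show "rep (L2_class M f) \<in> L2_fun M" "AE x in M. rep (L2_class M f) x = f x"
    by (auto simp: L2_class_def)
qed

lemma L2_add_class:
  assumes "f \<in> L2_fun M" "g \<in> L2_fun M"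
  shows "L2_add M (L2_class M f) (L2_class M g) = L2_class M (\<lambda>x. f x + g x)"
  unfolding L2_add_def
proof (rule L2_class_eqI)
  show "AE x in M. rep (L2_class M f) x + rep (L2_class M g) x = f x + g x"
    using rep_L2_class(2)[OF assms(1)] rep_L2_class(2)[OF assms(2)] by eventually_elim simp
qed

lemma L2_scale_class:
  assumes "f \<in> L2_fun M"
  shows "L2_scale M c (L2_class M f) = L2_class M (\<lambda>x. c * f x)"
  unfolding L2_scale_def
proof (rule L2_class_eqI)
  show "AE x in M. c * rep (L2_class M f) x = c * f x"
    using rep_L2_class(2)[OF assms] by eventually_elim simp
qed

lemma integrable_L2_mult:
  assumes "f \<in> L2_fun M" "g \<in> L2_fun M"
  shows "integrable M (\<lambda>x. f x * cnj (g x))"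
proof (rule Bochner_Integration.integrable_bound)
  note [measurable] = assms[unfolded L2_fun_def, simplified, THEN conjunct1]
  show "integrable M (\<lambda>x. (cmod (f x))\<^sup>2 + (cmod (g x))\<^sup>2)"
    using assms by (auto simp: L2_fun_def)
  have [measurable]: "cnj \<in> borel_measurable borel"
    by (intro borel_measurable_continuous_onI continuous_intros)
  show "(\<lambda>x. f x * cnj (g x)) \<in> borel_measurable M" by measurable
  show "AE x in M. norm (f x * cnj (g x)) \<le> norm ((cmod (f x))\<^sup>2 + (cmod (g x))\<^sup>2)"
  proof (rule AE_I2)
    fix x
    have "2 * (cmod (f x) * cmod (g x)) \<le> (cmod (f x))\<^sup>2 + (cmod (g x))\<^sup>2"
      using sum_squares_bound[of "cmod (f x)" "cmod (g x)"] by simp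
    moreover have "0 \<le> cmod (f x) * cmod (g x)" by simp
    ultimately show "norm (f x * cnj (g x)) \<le> norm ((cmod (f x))\<^sup>2 + (cmod (g x))\<^sup>2)"
      by (simp add: norm_mult del: mult_nonneg_nonneg zero_le_mult_iff)
  qed
qed

lemma L2_inner_class:
  assumes "f \<in> L2_fun M" "g \<in> L2_fun M"
  shows "L2_inner M (L2_class M f) (L2_class M g) = (LINT x|M. f x * cnj (g x))"
  unfolding L2_inner_def
proof (rule integral_cong_AE)
  show "AE x in M. rep (L2_class M f) x * cnj (rep (L2_class M g) x) = f x * cnj (g x)"
    using rep_L2_class(2)[OF assms(1)] rep_L2_class(2)[OF assms(2)] by eventually_elim simp
qed (use integrable_L2_mult[OF rep_L2_class(1)[OF assms(1)] rep_L2_class(1)[OF assms(2)]]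
      integrable_L2_mult[OF assms] in auto)

text \<open>Turns preservation of norms into preservation of inner products:
  \<open>inner_Rel\<close> compares the right-hand sides term by term.\<close>

lemma integral_mult_cnj_polarization:
  assumes f: "f \<in> L2_fun M" and g: "g \<in> L2_fun M"
  shows "4 * (LINT x|M. f x * cnj (g x)) =
    (\<Sum>c\<in>{1, -1, \<i>, -\<i>}. c * complex_of_real ((L2_norm M (\<lambda>x. f x + c * g x))\<^sup>2))"
proof -
  have int: "integrable M (\<lambda>x. c * complex_of_real ((cmod (f x + c * g x))\<^sup>2))" for c
    using L2_fun_add[OF f L2_fun_scale[OF g]]
    by (intro integrable_mult_right integrable_of_real) (auto simp: L2_fun_def)
  have eq: "4 * (a * cnj b) = (\<Sum>c\<in>{1, -1, \<i>, -\<i>}. c * complex_of_real ((cmod (a + c * b))\<^sup>2))" for a b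
  proof -
    have *: "(1::complex) \<noteq> -1" "(1::complex) \<noteq> \<i>" "(1::complex) \<noteq> -\<i>" "(-1::complex) \<noteq> \<i>"
      "(-1::complex) \<noteq> -\<i>" "\<i> \<noteq> -\<i>"
      by (auto simp: complex_eq_iff)
    show ?thesis
      using * by (simp add: complex_eq_iff cmod_power2) (simp add: power2_eq_square algebra_simps)
  qed
  have "4 * (LINT x|M. f x * cnj (g x)) = (LINT x|M. 4 * (f x * cnj (g x)))"
    by simp
  also have "\<dots> = (LINT x|M. (\<Sum>c\<in>{1, -1, \<i>, -\<i>}. c * complex_of_real ((cmod (f x + c * g x))\<^sup>2)))"
    by (simp only: eq)
  also have "\<dots> = (\<Sum>c\<in>{1, -1, \<i>, -\<i>}. LINT x|M. c * complex_of_real ((cmod (f x + c * g x))\<^sup>2))"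
    by (rule Bochner_Integration.integral_sum) (rule int)
  also have "\<dots> = (\<Sum>c\<in>{1, -1, \<i>, -\<i>}. c * complex_of_real ((L2_norm M (\<lambda>x. f x + c * g x))\<^sup>2))"
    unfolding L2_norm_square
    by (simp only: integral_mult_right_zero integral_complex_of_real)
  finally show ?thesis .
qed

text \<open>The closure of a graph in the product of two copies of L2, on functions instead of
  classes. A relation treats its arguments alike, so that surjectivity of the extension is totality
  for the converse graph.\<close>

definition L2_graph_closure ::
    "'a measure \<Rightarrow> (('a \<Rightarrow> complex) \<times> ('a \<Rightarrow> complex)) set \<Rightarrow> ('a \<Rightarrow> complex) \<Rightarrow> ('a \<Rightarrow> complex) \<Rightarrow> bool" where
  "L2_graph_closure M G f g \<longleftrightarrow> f \<in> L2_fun M \<and> g \<in> L2_fun M \<and>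
     (\<forall>e>0. \<exists>(d, d')\<in>G. L2_norm M (\<lambda>x. f x - d x) < e \<and> L2_norm M (\<lambda>x. g x - d' x) < e)"

locale L2_isometric_graph =
  fixes M :: "'a measure" and G :: "(('a \<Rightarrow> complex) \<times> ('a \<Rightarrow> complex)) set"
  assumes L2_funD: "\<And>d d'. (d, d') \<in> G \<Longrightarrow> d \<in> L2_fun M \<and> d' \<in> L2_fun M"
    and isometric: "\<And>d d'. (d, d') \<in> G \<Longrightarrow> L2_norm M d' = L2_norm M d"
    and add: "\<And>d d' e e'. (d, d') \<in> G \<Longrightarrow> (e, e') \<in> G \<Longrightarrow> (\<lambda>x. d x + e x, \<lambda>x. d' x + e' x) \<in> G"
    and scale: "\<And>d d' c. (d, d') \<in> G \<Longrightarrow> (\<lambda>x. c * d x, \<lambda>x. c * d' x) \<in> G"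
    and dense_fst: "\<And>f e. f \<in> L2_fun M \<Longrightarrow> e > 0 \<Longrightarrow> \<exists>(d, d')\<in>G. L2_norm M (\<lambda>x. f x - d x) < e"
    and dense_snd: "\<And>f e. f \<in> L2_fun M \<Longrightarrow> e > 0 \<Longrightarrow> \<exists>(d, d')\<in>G. L2_norm M (\<lambda>x. f x - d' x) < e"
begin

abbreviation Rel where "Rel \<equiv> L2_graph_closure M G"

lemma L2_isometric_graph_converse: "L2_isometric_graph M (G\<inverse>)"
proof
  fix f :: "'a \<Rightarrow> complex" and e :: real
  assume f: "f \<in> L2_fun M" "e > 0"
  show "\<exists>(d, d')\<in>G\<inverse>. L2_norm M (\<lambda>x. f x - d x) < e"
    using dense_snd[OF f] by auto
  show "\<exists>(d, d')\<in>G\<inverse>. L2_norm M (\<lambda>x. f x - d' x) < e"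
    using dense_fst[OF f] by auto
qed (simp_all add: L2_funD isometric add scale)

lemma diff:
  assumes "(d, d') \<in> G" "(e, e') \<in> G"
  shows "(\<lambda>x. d x - e x, \<lambda>x. d' x - e' x) \<in> G"
  using add[OF assms(1) scale[OF assms(2), of "-1"]] by simp

lemma Rel_L2_fun: "Rel f g \<Longrightarrow> f \<in> L2_fun M" "Rel f g \<Longrightarrow> g \<in> L2_fun M"
  by (auto simp: L2_graph_closure_def)

lemma Rel_graph:
  assumes "(d, d') \<in> G"
  shows "Rel d d'"
proof -
  have "L2_norm M (\<lambda>x. 0) = 0" by (simp add: L2_norm_def)
  then show ?thesis
    using assms L2_funD[OF assms] by (force simp: L2_graph_closure_def)
qed

lemma Rel_add:
  assumes "Rel f g" "Rel f' g'"
  shows "Rel (\<lambda>x. f x + f' x) (\<lambda>x. g x + g' x)"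
  unfolding L2_graph_closure_def
proof (intro conjI allI impI)
  fix e :: real assume "e > 0"
  then have e: "e / 2 > 0" by simp
  obtain d d' where d: "(d, d') \<in> G" "L2_norm M (\<lambda>x. f x - d x) < e / 2" "L2_norm M (\<lambda>x. g x - d' x) < e / 2"
    using assms(1) e unfolding L2_graph_closure_def by blast
  obtain b b' where b: "(b, b') \<in> G" "L2_norm M (\<lambda>x. f' x - b x) < e / 2" "L2_norm M (\<lambda>x. g' x - b' x) < e / 2"
    using assms(2) e unfolding L2_graph_closure_def by blast
  have "L2_norm M (\<lambda>x. f x + f' x - (d x + b x)) < e"
    using L2_norm_triangle[of "\<lambda>x. f x - d x" M "\<lambda>x. f' x - b x"] d b assms[THEN Rel_L2_fun(1)]
      L2_funD[OF d(1)] L2_funD[OF b(1)] by (simp add: L2_fun_diff algebra_simps)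
  moreover have "L2_norm M (\<lambda>x. g x + g' x - (d' x + b' x)) < e"
    using L2_norm_triangle[of "\<lambda>x. g x - d' x" M "\<lambda>x. g' x - b' x"] d b assms[THEN Rel_L2_fun(2)]
      L2_funD[OF d(1)] L2_funD[OF b(1)] by (simp add: L2_fun_diff algebra_simps)
  ultimately show "\<exists>(d, d')\<in>G. L2_norm M (\<lambda>x. f x + f' x - d x) < e \<and> L2_norm M (\<lambda>x. g x + g' x - d' x) < e"
    by (intro bexI[OF _ add[OF d(1) b(1)]]) simp
qed (use assms L2_fun_add in \<open>auto simp: L2_graph_closure_def\<close>)

lemma Rel_scale:
  assumes "Rel f g"
  shows "Rel (\<lambda>x. c * f x) (\<lambda>x. c * g x)"
  unfolding L2_graph_closure_def
proof (intro conjI allI impI)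
  fix e :: real assume "e > 0"
  then have e: "e / (cmod c + 1) > 0" by (simp add: add_nonneg_pos)
  obtain d d' where d: "(d, d') \<in> G" "L2_norm M (\<lambda>x. f x - d x) < e / (cmod c + 1)"
      "L2_norm M (\<lambda>x. g x - d' x) < e / (cmod c + 1)"
    using assms(1) e unfolding L2_graph_closure_def by blast
  have *: "cmod c * t < e" if "t < e / (cmod c + 1)" "t \<ge> 0" for t
  proof -
    have "cmod c * t \<le> (cmod c + 1) * t" using that by (simp add: algebra_simps)
    also have "\<dots> < e"
      using that(1) pos_less_divide_eq[of "cmod c + 1" t e] by (simp add: add_nonneg_pos mult.commute)
    finally show ?thesis .
  qed
  have "L2_norm M (\<lambda>x. c * f x - c * d x) < e" "L2_norm M (\<lambda>x. c * g x - c * d' x) < e"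
    using *[OF d(2)] *[OF d(3)] by (simp_all add: L2_norm_scale flip: right_diff_distrib)
  then show "\<exists>(d, d')\<in>G. L2_norm M (\<lambda>x. c * f x - d x) < e \<and> L2_norm M (\<lambda>x. c * g x - d' x) < e"
    by (intro bexI[OF _ scale[OF d(1), of c]]) simp
qed (use assms L2_fun_scale in \<open>auto simp: L2_graph_closure_def\<close>)

lemma Rel_diff:
  assumes "Rel f g" "Rel f' g'"
  shows "Rel (\<lambda>x. f x - f' x) (\<lambda>x. g x - g' x)"
  using Rel_add[OF assms(1) Rel_scale[OF assms(2), of "-1"]] by simp

lemma Rel_norm:
  assumes "Rel f g"
  shows "L2_norm M g = L2_norm M f"
proof -
  have "\<bar>L2_norm M g - L2_norm M f\<bar> \<le> 0 + e" if "e > 0" for e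
  proof -
    obtain d d' where d: "(d, d') \<in> G" "L2_norm M (\<lambda>x. f x - d x) < e / 2" "L2_norm M (\<lambda>x. g x - d' x) < e / 2"
      using assms \<open>e > 0\<close> half_gt_zero[of e] unfolding L2_graph_closure_def by blast
    have "\<bar>L2_norm M f - L2_norm M d\<bar> \<le> L2_norm M (\<lambda>x. f x - d x)"
      "\<bar>L2_norm M g - L2_norm M d'\<bar> \<le> L2_norm M (\<lambda>x. g x - d' x)"
      using assms L2_funD[OF d(1)] by (auto intro!: L2_norm_diff_bound dest: Rel_L2_fun)
    then show ?thesis using d isometric[OF d(1)] by linarith
  qed
  then have "\<bar>L2_norm M g - L2_norm M f\<bar> \<le> 0" by (rule field_le_epsilon)
  then show ?thesis by simp
qed

text \<open>Approximants of \<open>f\<close> form a Cauchy sequence, and by linearity and isometry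
  so do their partners; completeness supplies the value.\<close>

lemma Rel_total:
  assumes f: "f \<in> L2_fun M"
  shows "\<exists>g. Rel f g"
proof -
  \<comment> \<open>The exponent \<open>Suc k\<close> lets the two errors in the triangle inequality
    add up to at most \<open>(1/2) ^ k\<close>, the rate that \<open>L2_complete_fast\<close>
    expects.\<close>
  have "\<exists>p. p \<in> G \<and> L2_norm M (\<lambda>x. f x - fst p x) < (1/2) ^ Suc k" for k
    using dense_fst[OF f, of "(1/2) ^ Suc k"] by fastforce
  then obtain p where p: "\<And>k. p k \<in> G" "\<And>k. L2_norm M (\<lambda>x. f x - fst (p k) x) < (1/2) ^ Suc k"
    by metis
  define d where "d k = fst (p k)" for k
  define d' where "d' k = snd (p k)" for k
  have G: "(d k, d' k) \<in> G" for k using p(1)[of k] by (simp add: d_def d'_def)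
  note dL = L2_funD[OF G, THEN conjunct1] and d'L = L2_funD[OF G, THEN conjunct2]
  have near: "L2_norm M (\<lambda>x. f x - d k x) < (1/2) ^ Suc k" for k using p(2) by (simp add: d_def)
  have "L2_norm M (\<lambda>x. d' k x - d' l x) \<le> (1/2) ^ k" if "k \<le> l" for k l
  proof -
    have "L2_norm M (\<lambda>x. d' k x - d' l x) = L2_norm M (\<lambda>x. d k x - d l x)"
      by (rule isometric[OF diff[OF G G]])
    also have "\<dots> \<le> L2_norm M (\<lambda>x. d k x - f x) + L2_norm M (\<lambda>x. f x - d l x)"
      by (rule L2_norm_triangle_diff[OF dL f dL])
    also have "\<dots> \<le> (1/2) ^ Suc k + (1/2) ^ Suc l"
      using near[of k] near[of l] L2_norm_minus_commute[of M f "d k"] by simp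
    also have "\<dots> \<le> (1/2) ^ Suc k + (1/2) ^ Suc k"
      using that by (intro add_mono power_decreasing) auto
    finally show ?thesis by simp
  qed
  then obtain g where g: "g \<in> L2_fun M" "\<And>k. L2_norm M (\<lambda>x. d' k x - g x) \<le> (1/2) ^ k"
    using L2_complete_fast[of d' M, OF d'L] by blast
  have "\<exists>(b, b')\<in>G. L2_norm M (\<lambda>x. f x - b x) < e \<and> L2_norm M (\<lambda>x. g x - b' x) < e" if "e > 0" for e
  proof -
    obtain k where k: "(1/2) ^ k < e"
      using real_arch_pow_inv[OF \<open>e > 0\<close>, of "1/2"] by auto
    have "L2_norm M (\<lambda>x. f x - d k x) < e"
      using near[of k] k power_strict_decreasing[of k "Suc k" "1/2 :: real"] by linarith
    moreover have "L2_norm M (\<lambda>x. g x - d' k x) < e"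
      using g(2)[of k] k L2_norm_minus_commute[of M "d' k" g] by simp
    ultimately show ?thesis
      by (intro bexI[OF _ G[of k]]) simp
  qed
  then show ?thesis using f g by (auto simp: L2_graph_closure_def)
qed

lemma Rel_surj:
  assumes "g \<in> L2_fun M"
  shows "\<exists>f. Rel f g"
proof -
  interpret C: L2_isometric_graph M "G\<inverse>" by (rule L2_isometric_graph_converse)
  obtain f where f: "L2_graph_closure M (G\<inverse>) g f" using C.Rel_total[OF assms] by blast
  have "\<exists>(d, d')\<in>G. L2_norm M (\<lambda>x. f x - d x) < e \<and> L2_norm M (\<lambda>x. g x - d' x) < e" if "e > 0" for e
    using f that unfolding L2_graph_closure_def by blast
  then show ?thesis
    using f by (auto simp: L2_graph_closure_def)
qed

definition ext :: "('a \<Rightarrow> complex) set \<Rightarrow> ('a \<Rightarrow> complex) set" where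
  "ext A = L2_class M (SOME g. Rel (rep A) g)"

text \<open>The closure is single-valued up to null sets: it is linear and norm-preserving, so
  almost equal arguments have values at distance zero. Hence neither \<open>rep\<close> nor
  \<open>SOME\<close> in \<open>ext\<close> affects the class.\<close>

lemma ext_class:
  assumes "Rel f g"
  shows "ext (L2_class M f) = L2_class M g"
proof -
  let ?f = "rep (L2_class M f)"
  note fL = Rel_L2_fun(1)[OF assms]
  obtain g0 where g0: "Rel ?f g0" "ext (L2_class M f) = L2_class M g0"
    using Rel_total[OF rep_L2_class(1)[OF fL]] unfolding ext_def by (metis someI_ex)
  have "L2_norm M (\<lambda>x. ?f x - f x) = 0"
    using rep_L2_class(2)[OF fL] L2_norm_eq_0_iff[OF L2_fun_diff[OF rep_L2_class(1)[OF fL] fL]] by simp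
  then have "L2_norm M (\<lambda>x. g0 x - g x) = 0"
    using Rel_norm[OF Rel_diff[OF g0(1) assms]] by simp
  then show ?thesis
    using g0 assms by (simp add: L2_class_eq_iff Rel_L2_fun)
qed

lemma ext_obtain:
  assumes "A \<in> L2 M"
  obtains f g where "Rel f g" "A = L2_class M f" "ext A = L2_class M g"
  using assms Rel_total ext_class unfolding L2_def by (metis imageE)

lemma inner_Rel:
  assumes "Rel f g" "Rel f' g'"
  shows "(LINT x|M. g x * cnj (g' x)) = (LINT x|M. f x * cnj (f' x))"
proof -
  have "4 * (LINT x|M. g x * cnj (g' x)) = 4 * (LINT x|M. f x * cnj (f' x))"
    unfolding integral_mult_cnj_polarization[OF assms[THEN Rel_L2_fun(1)]]
      integral_mult_cnj_polarization[OF assms[THEN Rel_L2_fun(2)]]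
    using Rel_norm[OF Rel_add[OF assms(1) Rel_scale[OF assms(2)]]] by simp
  then show ?thesis by simp
qed

lemma L2_unitary_ext: "L2_unitary M ext"
  unfolding L2_unitary_def
proof (intro conjI ballI allI)
  show "bij_betw ext (L2 M) (L2 M)"
    unfolding bij_betw_def
  proof
    show "inj_on ext (L2 M)"
    proof (rule inj_onI)
      fix A B assume A: "A \<in> L2 M" and B: "B \<in> L2 M" and eq: "ext A = ext B"
      obtain f g where f: "Rel f g" "A = L2_class M f" "ext A = L2_class M g"
        using ext_obtain[OF A] .
      obtain f' g' where f': "Rel f' g'" "B = L2_class M f'" "ext B = L2_class M g'"
        using ext_obtain[OF B] .
      have "L2_norm M (\<lambda>x. g x - g' x) = 0"
        using eq f f' by (simp add: L2_class_eq_iff Rel_L2_fun)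
      then show "A = B"
        using Rel_norm[OF Rel_diff[OF f(1) f'(1)]] f f' by (simp add: L2_class_eq_iff Rel_L2_fun)
    qed
    show "ext ` L2 M = L2 M"
    proof (intro equalityI subsetI)
      fix B assume "B \<in> ext ` L2 M"
      then obtain A where A: "A \<in> L2 M" "B = ext A" by blast
      obtain f g where "Rel f g" "ext A = L2_class M g" using ext_obtain[OF A(1)] .
      then show "B \<in> L2 M"
        using A(2) Rel_L2_fun(2) by (simp add: L2_def)
    next
      fix B assume "B \<in> L2 M"
      then obtain g where g: "g \<in> L2_fun M" "B = L2_class M g" by (auto simp: L2_def)
      then obtain f where "Rel f g" using Rel_surj by blast
      then show "B \<in> ext ` L2 M"
        using ext_class g by (auto simp: L2_def image_iff intro!: bexI[OF _ Rel_L2_fun(1)])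
    qed
  qed
next
  fix A B assume "A \<in> L2 M" "B \<in> L2 M"
  then obtain f g f' g' where f: "Rel f g" "A = L2_class M f" "ext A = L2_class M g"
    and f': "Rel f' g'" "B = L2_class M f'" "ext B = L2_class M g'"
    by (metis ext_obtain)
  show "ext (L2_add M A B) = L2_add M (ext A) (ext B)"
    using ext_class[OF Rel_add[OF f(1) f'(1)]] f f' by (simp add: L2_add_class Rel_L2_fun)
  show "L2_inner M (ext A) (ext B) = L2_inner M A B"
    using inner_Rel[OF f(1) f'(1)] f f' by (simp add: L2_inner_class Rel_L2_fun)
next
  fix c A assume "A \<in> L2 M"
  then obtain f g where f: "Rel f g" "A = L2_class M f" "ext A = L2_class M g"
    using ext_obtain by blast
  show "ext (L2_scale M c A) = L2_scale M c (ext A)"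
    using ext_class[OF Rel_scale[OF f(1)]] f by (simp add: L2_scale_class Rel_L2_fun)
qed

end

section \<open>Dense subspaces of \<open>L\<^sup>2\<close>\<close>

definition L2_closure :: "'a measure \<Rightarrow> ('a \<Rightarrow> complex) set \<Rightarrow> ('a \<Rightarrow> complex) set" where
  "L2_closure M D = {f \<in> L2_fun M. \<forall>e>0. \<exists>d\<in>D. L2_norm M (\<lambda>x. f x - d x) < e}"

text \<open>Dominated convergence for the squared distance. \<open>closure_eq_L2_fun\<close> uses it
  for both of its limits, countable unions of sets and approximation by simple functions.\<close>

lemma L2_closure_dominated:
  assumes D: "D \<subseteq> L2_fun M"
    and s: "\<And>i. s i \<in> L2_closure M D"
    and f: "f \<in> borel_measurable M"
    and w: "integrable M (\<lambda>x. (w x)\<^sup>2)" "\<And>i x. x \<in> space M \<Longrightarrow> cmod (s i x) \<le> w x"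
    and lim: "\<And>x. x \<in> space M \<Longrightarrow> (\<lambda>i. s i x) \<longlonglongrightarrow> f x"
  shows "f \<in> L2_closure M D"
proof -
  have sL: "s i \<in> L2_fun M" for i using s by (auto simp: L2_closure_def)
  then have [measurable]: "s i \<in> borel_measurable M" for i by (auto simp: L2_fun_def)
  note [measurable] = f
  have fw: "cmod (f x) \<le> w x" if "x \<in> space M" for x
    using tendsto_norm[OF lim[OF that]] by (rule LIMSEQ_le_const2) (use w(2) that in auto)
  have fL: "f \<in> L2_fun M"
    unfolding L2_fun_def
  proof (intro CollectI conjI f)
    show "integrable M (\<lambda>x. (cmod (f x))\<^sup>2)"
      by (rule Bochner_Integration.integrable_bound[OF w(1)])
        (auto intro!: AE_I2 power_mono fw)
  qed
  have "(\<lambda>i. LINT x|M. (cmod (f x - s i x))\<^sup>2) \<longlonglongrightarrow> (LINT x|M. 0)"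
  proof (rule integral_dominated_convergence[where w = "\<lambda>x. 4 * (w x)\<^sup>2"])
    show "AE x in M. (\<lambda>i. (cmod (f x - s i x))\<^sup>2) \<longlonglongrightarrow> 0"
    proof (rule AE_I2)
      fix x assume "x \<in> space M"
      from tendsto_power[OF tendsto_norm[OF tendsto_diff[OF tendsto_const lim[OF this]]], of "f x" 2]
      show "(\<lambda>i. (cmod (f x - s i x))\<^sup>2) \<longlonglongrightarrow> 0" by simp
    qed
    show "AE x in M. norm ((cmod (f x - s i x))\<^sup>2) \<le> 4 * (w x)\<^sup>2" for i
    proof (rule AE_I2)
      fix x assume x: "x \<in> space M"
      have "cmod (f x - s i x) \<le> 2 * w x"
        using norm_triangle_ineq4[of "f x" "s i x"] fw[OF x] w(2)[OF x, of i] by simp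
      from power_mono[OF this, of 2] show "norm ((cmod (f x - s i x))\<^sup>2) \<le> 4 * (w x)\<^sup>2"
        by (simp add: power_mult_distrib)
    qed
  qed (use w(1) in auto)
  then have "(\<lambda>i. sqrt (LINT x|M. (cmod (f x - s i x))\<^sup>2)) \<longlonglongrightarrow> sqrt 0"
    by (intro tendsto_real_sqrt) simp
  then have to0: "(\<lambda>i. L2_norm M (\<lambda>x. f x - s i x)) \<longlonglongrightarrow> 0"
    by (simp add: L2_norm_def)
  have "\<exists>d\<in>D. L2_norm M (\<lambda>x. f x - d x) < e" if "e > 0" for e
  proof -
    have "\<forall>\<^sub>F i in sequentially. L2_norm M (\<lambda>x. f x - s i x) < e / 2"
      by (rule order_tendstoD(2)[OF to0 half_gt_zero[OF \<open>e > 0\<close>]])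
    then obtain i where i: "L2_norm M (\<lambda>x. f x - s i x) < e / 2"
      by (auto simp: eventually_sequentially)
    obtain d where d: "d \<in> D" "L2_norm M (\<lambda>x. s i x - d x) < e / 2"
      using s[of i] \<open>e > 0\<close> half_gt_zero[of e] unfolding L2_closure_def by blast
    have "L2_norm M (\<lambda>x. f x - d x) < e"
      using L2_norm_triangle_diff[OF fL sL[of i], of d] i d D by auto
    then show ?thesis using d by blast
  qed
  then show ?thesis using fL by (auto simp: L2_closure_def)
qed

locale L2_subspace =
  fixes M :: "'a measure" and D :: "('a \<Rightarrow> complex) set"
  assumes sub: "D \<subseteq> L2_fun M"
    and zero: "(\<lambda>x. 0) \<in> D"
    and add: "\<And>f g. f \<in> D \<Longrightarrow> g \<in> D \<Longrightarrow> (\<lambda>x. f x + g x) \<in> D"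
    and scale: "\<And>f c. f \<in> D \<Longrightarrow> (\<lambda>x. c * f x) \<in> D"
begin

lemma closure_of: "f \<in> D \<Longrightarrow> f \<in> L2_closure M D"
proof -
  have "L2_norm M (\<lambda>x. 0) = 0" by (simp add: L2_norm_def)
  then show "f \<in> D \<Longrightarrow> f \<in> L2_closure M D"
    using sub by (force simp: L2_closure_def)
qed

lemma closure_add:
  assumes "f \<in> L2_closure M D" "g \<in> L2_closure M D"
  shows "(\<lambda>x. f x + g x) \<in> L2_closure M D"
proof -
  have fL: "f \<in> L2_fun M" and gL: "g \<in> L2_fun M" using assms by (auto simp: L2_closure_def)
  have "\<exists>d\<in>D. L2_norm M (\<lambda>x. f x + g x - d x) < e" if "e > 0" for e
  proof -
    have e: "e / 2 > 0" using that by simp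
    obtain b d where b: "b \<in> D" "L2_norm M (\<lambda>x. f x - b x) < e / 2"
      and d: "d \<in> D" "L2_norm M (\<lambda>x. g x - d x) < e / 2"
      using assms e unfolding L2_closure_def by blast
    have "L2_norm M (\<lambda>x. f x + g x - (b x + d x)) < e"
      using L2_norm_triangle[of "\<lambda>x. f x - b x" M "\<lambda>x. g x - d x"] b d fL gL sub
      by (simp add: L2_fun_diff subset_iff algebra_simps)
    then show ?thesis by (intro bexI[OF _ add[OF b(1) d(1)]]) simp
  qed
  then show ?thesis using L2_fun_add[OF fL gL] by (auto simp: L2_closure_def)
qed

lemma closure_scale:
  assumes "f \<in> L2_closure M D"
  shows "(\<lambda>x. c * f x) \<in> L2_closure M D"
proof -
  have fL: "f \<in> L2_fun M" using assms by (auto simp: L2_closure_def)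
  have "\<exists>d\<in>D. L2_norm M (\<lambda>x. c * f x - d x) < e" if "e > 0" for e
  proof -
    have pos: "cmod c + 1 > 0" by (simp add: add_nonneg_pos)
    then obtain b where b: "b \<in> D" "L2_norm M (\<lambda>x. f x - b x) < e / (cmod c + 1)"
      using assms \<open>e > 0\<close> divide_pos_pos[OF \<open>e > 0\<close> pos] unfolding L2_closure_def by blast
    have "L2_norm M (\<lambda>x. c * f x - c * b x) = cmod c * L2_norm M (\<lambda>x. f x - b x)"
      by (simp add: L2_norm_scale flip: right_diff_distrib)
    also have "\<dots> \<le> (cmod c + 1) * L2_norm M (\<lambda>x. f x - b x)"
      by (simp add: algebra_simps)
    also have "\<dots> < e"
      using b(2) pos by (simp add: pos_less_divide_eq mult.commute)
    finally show ?thesis by (intro bexI[OF _ scale[OF b(1)]])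
  qed
  then show ?thesis using L2_fun_scale[OF fL] by (auto simp: L2_closure_def)
qed

lemma closure_sum:
  assumes "\<And>i. i \<in> I \<Longrightarrow> f i \<in> L2_closure M D"
  shows "(\<lambda>x. \<Sum>i\<in>I. f i x) \<in> L2_closure M D"
  using assms
proof (induction I rule: infinite_finite_induct)
  case (insert i I)
  then show ?case using closure_add[of "f i" "\<lambda>x. \<Sum>i\<in>I. f i x"] by simp
qed (use closure_of[OF zero] in auto)

text \<open>Measure-theoretic induction: a Dynkin argument passes from \<open>E\<close> to all
  measurable sets, then come simple functions and finally \<open>f\<close>. Everything is cut off by
  some \<open>\<Omega> N\<close>, since complements and unions may have infinite measure.\<close>

lemma closure_eq_L2_fun:
  fixes \<Omega> :: "nat \<Rightarrow> 'a set"
  assumes \<Omega>: "incseq \<Omega>" "(\<Union>N. \<Omega> N) = space M" "\<And>N. \<Omega> N \<in> sets M" "\<And>N. emeasure M (\<Omega> N) < \<infinity>"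
    and E: "Int_stable E" "E \<subseteq> Pow (space M)" "sets M = sigma_sets (space M) E"
    and ind: "\<And>N. indicator (\<Omega> N) \<in> D" "\<And>N A. A \<in> E \<Longrightarrow> indicator (A \<inter> \<Omega> N) \<in> D"
    and f: "f \<in> L2_fun M"
  shows "f \<in> L2_closure M D"
proof -
  have int\<Omega>: "integrable M (\<lambda>x. (indicator (\<Omega> N) x :: real)\<^sup>2)" for N
    using integrable_real_indicator[OF \<Omega>(3,4)] by (simp add: power2_eq_square flip: indicator_inter_arith)
  have set: "(indicator (A \<inter> \<Omega> N) :: 'a \<Rightarrow> complex) \<in> L2_closure M D" if "A \<in> sets M" for A N
    using E(1,2) that[unfolded E(3)]
  proof (induction rule: sigma_sets_induct_disjoint)
    case (basic A)
    then show ?case using closure_of ind by blast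
  next
    case empty
    then show ?case using closure_of zero by (simp add: indicator_def)
  next
    case (compl A)
    have "(indicator ((space M - A) \<inter> \<Omega> N) :: 'a \<Rightarrow> complex)
        = (\<lambda>x. indicator (\<Omega> N) x + (-1) * indicator (A \<inter> \<Omega> N) x)"
      using \<Omega>(2) by (auto simp: fun_eq_iff indicator_def)
    then show ?case
      using closure_add[OF closure_of[OF ind(1)[of N]] closure_scale[OF compl(2), of "-1"]] by simp
  next
    case (union A)
    have A: "A i \<in> sets M" for i using union(2) E(3) by auto
    show ?case
    proof (rule L2_closure_dominated[OF sub])
      show "(\<lambda>x. \<Sum>i<k. indicator (A i \<inter> \<Omega> N) x) \<in> L2_closure M D" for k
        by (rule closure_sum) (rule union)
      show "(indicator ((\<Union>i. A i) \<inter> \<Omega> N) :: 'a \<Rightarrow> complex) \<in> borel_measurable M"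
        using A \<Omega>(3) by measurable
      have fin: "(\<Sum>i<k. indicator (A i \<inter> \<Omega> N) x) = (indicator ((\<Union>i<k. A i) \<inter> \<Omega> N) x :: complex)" for k x
      proof -
        have "disjoint_family_on (\<lambda>i. A i \<inter> \<Omega> N) {..<k}"
          using union(1) unfolding disjoint_family_on_def by blast
        from indicator_UN_disjoint[OF _ this, of x]
        have "(indicator (\<Union>i<k. A i \<inter> \<Omega> N) x :: complex) = (\<Sum>i<k. indicator (A i \<inter> \<Omega> N) x)"
          by blast
        moreover have "(\<Union>i<k. A i) \<inter> \<Omega> N = (\<Union>i<k. A i \<inter> \<Omega> N)" by blast
        ultimately show ?thesis by presburger
      qed
      show "cmod (\<Sum>i<k. indicator (A i \<inter> \<Omega> N) x) \<le> indicator (\<Omega> N) x" for k x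
        unfolding fin by (auto simp: indicator_def)
      show "(\<lambda>k. \<Sum>i<k. indicator (A i \<inter> \<Omega> N) x) \<longlonglongrightarrow> (indicator ((\<Union>i. A i) \<inter> \<Omega> N) x :: complex)" for x
        unfolding fin using LIMSEQ_indicator_UN[of "\<lambda>i. A i \<inter> \<Omega> N" x]
        by (simp add: UN_simps)
    qed (rule int\<Omega>)
  qed
  have [measurable]: "f \<in> borel_measurable M" using f by (auto simp: L2_fun_def)
  \<comment> \<open>The bound by twice the modulus of \<open>f\<close> provides the
    square-integrable majorant for the last limit.\<close>
  obtain s where s: "\<And>i. simple_function M (s i)" "\<And>x. x \<in> space M \<Longrightarrow> (\<lambda>i. s i x) \<longlonglongrightarrow> f x"
      "\<And>i x. x \<in> space M \<Longrightarrow> dist (s i x) 0 \<le> 2 * dist (f x) 0"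
    using borel_measurable_implies_sequence_metric[of f M 0] by (auto; blast)
  show ?thesis
  proof (rule L2_closure_dominated[OF sub])
    \<comment> \<open>One index drives both the approximation and the cutoff, so that a single limit
      reaches \<open>f\<close>.\<close>
    show "(\<lambda>x. indicator (\<Omega> i) x * s i x) \<in> L2_closure M D" for i
    proof -
      have fin: "finite (s i ` space M)" using s(1) by (rule simple_functionD)
      have "(\<lambda>x. \<Sum>y\<in>s i ` space M. y * indicator (s i -` {y} \<inter> space M \<inter> \<Omega> i) x) \<in> L2_closure M D"
        by (intro closure_sum closure_scale set simple_functionD(2) s(1))
      moreover have "(\<Sum>y\<in>s i ` space M. y * indicator (s i -` {y} \<inter> space M \<inter> \<Omega> i) x)
          = indicator (\<Omega> i) x * s i x" for x
      proof (cases "x \<in> \<Omega> i")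
        case True
        then have x: "x \<in> space M" using \<Omega>(2) by auto
        have "(\<Sum>y\<in>s i ` space M. y * indicator (s i -` {y} \<inter> space M \<inter> \<Omega> i) x)
            = (\<Sum>y\<in>s i ` space M. if y = s i x then y else 0)"
          using True x by (intro sum.cong) (auto simp: indicator_def)
        also have "\<dots> = s i x" using fin x by simp
        finally show ?thesis using True by simp
      qed (simp add: indicator_def)
      ultimately show ?thesis by simp
    qed
    show "integrable M (\<lambda>x. (2 * cmod (f x))\<^sup>2)"
      using f by (simp add: L2_fun_def power_mult_distrib)
    show "cmod (indicator (\<Omega> i) x * s i x) \<le> 2 * cmod (f x)" if "x \<in> space M" for i x
      using s(3)[OF that, of i] by (auto simp: indicator_def)
    show "(\<lambda>i. indicator (\<Omega> i) x * s i x) \<longlonglongrightarrow> f x" if "x \<in> space M" for x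
    proof -
      have "(\<lambda>i. indicator (\<Omega> i) x :: complex) \<longlonglongrightarrow> indicator (\<Union>i. \<Omega> i) x"
        by (rule LIMSEQ_indicator_incseq[OF \<Omega>(1)])
      from tendsto_mult[OF this s(2)[OF that]] show ?thesis
        using that \<Omega>(2) by simp
    qed
  qed simp
qed

end

section \<open>Fractional ideals and their cosets\<close>

definition coset :: "('k::field \<Rightarrow> real) \<Rightarrow> 'k \<Rightarrow> int \<Rightarrow> 'k \<Rightarrow> 'k set" where
  "coset av \<pi> j x = {y. x - y \<in> frac_ideal av \<pi> j}"

context nonarch_local_field
begin

abbreviation I :: "int \<Rightarrow> 'k set" where "I \<equiv> frac_ideal av \<pi>"
abbreviation cos :: "int \<Rightarrow> 'k \<Rightarrow> 'k set" where "cos \<equiv> coset av \<pi>"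
abbreviation q :: nat where "q \<equiv> residue_card av \<pi>"

lemma av_zero [simp]: "av 0 = 0"
  by (simp add: av_eq_0_iff)

lemma av_one [simp]: "av 1 = 1"
  using av_mult[of 1 1] av_eq_0_iff[of 1] by simp

lemma av_minus [simp]: "av (- x) = av x"
proof -
  have "av (-1) * av (-1) = 1" using av_mult[of "-1" "-1"] by simp
  then have "(av (-1))\<^sup>2 = 1" by (simp add: power2_eq_square)
  then have "av (-1) = 1" using av_nonneg[of "-1"] by (simp add: power2_eq_1_iff)
  then show ?thesis using av_mult[of "-1" x] by simp
qed

lemma av_minus_commute: "av (x - y) = av (y - x)"
  using av_minus[of "x - y"] by simp

lemma av_diff: "av (x - y) \<le> max (av x) (av y)"
  using av_ultrametric[of x "-y"] by simp

lemma av_add_less: "av y < av x \<Longrightarrow> av (x + y) = av x"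
  using av_ultrametric[of x y] av_diff[of "x + y" y] by simp

lemma av_inverse: "av (inverse x) = inverse (av x)"
proof (cases "x = 0")
  case False
  then have "av x * av (inverse x) = 1" using av_mult[of x "inverse x"] by simp
  then show ?thesis by (simp add: inverse_unique)
qed simp

lemma av_of_nat_le: "av (of_nat k) \<le> 1"
proof (induction k)
  case (Suc k)
  then show ?case using av_ultrametric[of 1 "of_nat k"] by simp
qed simp

lemma av_divide: "av (x / y) = av x / av y"
  by (simp add: divide_inverse av_mult av_inverse)

lemma av_power: "av (x ^ k) = av x ^ k"
  by (induction k) (auto simp: av_mult)

lemma av_power_int: "av (x powi j) = av x powi j"
  by (auto simp: power_int_def av_power av_inverse)

lemma av_uniformizer_pos: "av \<pi> > 0"
  using av_nonneg[of \<pi>] av_eq_0_iff[of \<pi>] uniformizer(1) by linarith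

lemma frac_ideal_iff: "x \<in> I j \<longleftrightarrow> av x \<le> av \<pi> powi j"
proof -
  have pos: "av \<pi> powi j > 0" using av_uniformizer_pos by simp
  have "x \<in> I j \<longleftrightarrow> av (x / \<pi> powi j) \<le> 1"
  proof
    assume "x \<in> I j"
    then show "av (x / \<pi> powi j) \<le> 1"
      using uniformizer(1) by (auto simp: frac_ideal_def ring_of_integers_def)
  next
    assume "av (x / \<pi> powi j) \<le> 1"
    then have "\<pi> powi j * (x / \<pi> powi j) \<in> I j"
      unfolding frac_ideal_def ring_of_integers_def by blast
    then show "x \<in> I j" using uniformizer(1) by simp
  qed
  also have "\<dots> \<longleftrightarrow> av x \<le> av \<pi> powi j"
    using pos by (simp add: av_divide av_power_int)
  finally show ?thesis .
qed

lemma frac_ideal_1_iff: "x \<in> I 1 \<longleftrightarrow> av x < 1"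
  using uniformizer(2) by auto

lemma av_uniformizer_less_1: "av \<pi> < 1"
  using frac_ideal_1_iff[of \<pi>] frac_ideal_iff[of \<pi> 1] by simp

lemma ring_of_integers_eq: "ring_of_integers av = I 0"
  by (auto simp: frac_ideal_iff ring_of_integers_def)

lemma frac_ideal_mono: "i \<le> j \<Longrightarrow> x \<in> I j \<Longrightarrow> x \<in> I i"
  using power_int_decreasing[of i j "av \<pi>"] av_uniformizer_pos av_uniformizer_less_1
  by (simp add: frac_ideal_iff)

lemma frac_ideal_0 [simp]: "0 \<in> I j"
  using av_uniformizer_pos by (simp add: frac_ideal_iff)

lemma frac_ideal_add: "x \<in> I j \<Longrightarrow> y \<in> I j \<Longrightarrow> x + y \<in> I j"
  using av_ultrametric[of x y] by (simp add: frac_ideal_iff)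

lemma frac_ideal_diff: "x \<in> I j \<Longrightarrow> y \<in> I j \<Longrightarrow> x - y \<in> I j"
  using av_diff[of x y] by (simp add: frac_ideal_iff)

lemma frac_ideal_minus [simp]: "- x \<in> I j \<longleftrightarrow> x \<in> I j"
  by (simp add: frac_ideal_iff)

lemma frac_ideal_minus_commute: "x - y \<in> I j \<longleftrightarrow> y - x \<in> I j"
  by (simp add: frac_ideal_iff av_minus_commute)

lemma frac_ideal_mult: "x \<in> I i \<Longrightarrow> y \<in> I j \<Longrightarrow> x * y \<in> I (i + j)"
  using av_uniformizer_pos
  by (auto simp: frac_ideal_iff av_mult power_int_add intro!: mult_mono av_nonneg)

lemma frac_ideal_mult_0: "x \<in> I j \<Longrightarrow> y \<in> I (- j) \<Longrightarrow> x * y \<in> I 0"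
  using frac_ideal_mult[of x j y "- j"] by simp

lemma frac_ideal_unit_mult: "av u = 1 \<Longrightarrow> u * x \<in> I j \<longleftrightarrow> x \<in> I j"
  "av u = 1 \<Longrightarrow> x * u \<in> I j \<longleftrightarrow> x \<in> I j"
  by (simp_all add: frac_ideal_iff av_mult)

lemma frac_ideal_exhaust: "\<exists>k::nat. x \<in> I (- int k)"
proof -
  obtain k where "av x < (1 / av \<pi>) ^ k"
    using real_arch_pow[of "1 / av \<pi>" "av x"] av_uniformizer_pos av_uniformizer_less_1 by auto
  then show ?thesis
    by (intro exI[of _ k]) (simp add: frac_ideal_iff power_int_minus power_one_over inverse_eq_divide)
qed

lemma uniformizer_powi_mult: "\<pi> powi i * x \<in> I (i + j) \<longleftrightarrow> x \<in> I j"
  using av_uniformizer_pos by (simp add: frac_ideal_iff av_mult av_power_int power_int_add)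

text \<open>Absolute values are discrete: by \<open>uniformizer\<close>, an element of absolute
  value below 1 has absolute value at most \<open>av \<pi>\<close>. This is applied to
  \<open>\<pi> powi (- i) / x\<close>.\<close>

lemma not_frac_ideal_imp:
  assumes "x \<notin> I (- i)"
  shows "av x \<ge> av \<pi> powi (- i - 1)"
proof -
  have pos: "av \<pi> powi k > 0" for k using av_uniformizer_pos by simp
  have "av x > av \<pi> powi (- i)" using assms by (simp add: frac_ideal_iff)
  then have x: "av x > 0" and "av (\<pi> powi (- i) / x) < 1"
    using less_trans[OF pos[of "- i"]] by (simp_all add: av_divide av_power_int)
  then have "av (\<pi> powi (- i) / x) \<le> av \<pi>"
    using frac_ideal_1_iff frac_ideal_iff[of _ 1] by simp
  then have "av \<pi> powi (- i) \<le> av \<pi> * av x"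
    using x by (simp add: av_divide av_power_int pos_divide_le_eq)
  then show ?thesis
    using av_uniformizer_pos by (simp add: power_int_diff pos_divide_le_eq mult.commute)
qed

lemma mem_coset_self [simp]: "x \<in> cos j x"
  by (simp add: coset_def)

lemma coset_eq_iff: "cos j x = cos j y \<longleftrightarrow> x - y \<in> I j"
proof
  assume "cos j x = cos j y"
  then have "y \<in> cos j x" by simp
  then show "x - y \<in> I j" by (simp add: coset_def)
next
  assume *: "x - y \<in> I j"
  have "x - z \<in> I j \<longleftrightarrow> y - z \<in> I j" for z
    using frac_ideal_diff[OF _ *, of "x - z"] frac_ideal_add[OF _ *, of "y - z"] by auto
  then show "cos j x = cos j y" by (simp add: coset_def)
qed

lemma rep_coset: "x - rep (cos j x) \<in> I j"
proof -
  have "rep (cos j x) \<in> cos j x"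
    unfolding rep_def by (rule someI[of "\<lambda>t. t \<in> cos j x" x]) simp
  then show ?thesis by (simp add: coset_def)
qed

lemma rep_coset': "rep (cos j x) - x \<in> I j"
  using rep_coset frac_ideal_minus_commute by blast

lemma coset_rep [simp]: "cos j (rep (cos j x)) = cos j x"
  by (simp add: coset_eq_iff rep_coset')

lemma rep_in_frac_ideal:
  assumes "C \<in> cos j ` I i" "i \<le> j"
  shows "rep C \<in> I i" "cos j (rep C) = C"
proof -
  obtain x where x: "x \<in> I i" "C = cos j x" using assms by auto
  show "rep C \<in> I i"
    using frac_ideal_diff[OF x(1) frac_ideal_mono[OF assms(2) rep_coset[of x j]]] x by simp
  show "cos j (rep C) = C" using x by simp
qed

lemma residue_field_eq: "residue_field av \<pi> = cos 1 ` I 0"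
proof -
  have "{(x, y). x \<in> I 0 \<and> y \<in> I 0 \<and> x - y \<in> I 1} `` {x} = cos 1 x" if "x \<in> I 0" for x
    using that frac_ideal_diff[OF that frac_ideal_mono[of 0 1 "x - _"]] by (auto simp: coset_def)
  then show ?thesis
    by (auto simp: residue_field_def ring_of_integers_eq quotient_def)
qed

lemma q_gt_1: "q > 1"
proof -
  have "1 / real q > 0" "1 / real q < 1"
    using av_uniformizer_pos av_uniformizer_less_1 normalized by auto
  then show ?thesis by (cases "q = 0") (auto simp: field_simps)
qed

lemma card_coset_step: "finite (cos (i + 1) ` I i) \<and> card (cos (i + 1) ` I i) = q"
proof -
  have "bij_betw (\<lambda>C. cos (i + 1) (\<pi> powi i * rep C)) (cos 1 ` I 0) (cos (i + 1) ` I i)"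
  proof (rule bij_betwI')
    fix C D assume C: "C \<in> cos 1 ` I 0" and D: "D \<in> cos 1 ` I 0"
    have "cos (i + 1) (\<pi> powi i * rep C) = cos (i + 1) (\<pi> powi i * rep D) \<longleftrightarrow> cos 1 (rep C) = cos 1 (rep D)"
      unfolding coset_eq_iff by (simp add: uniformizer_powi_mult flip: right_diff_distrib)
    then show "(cos (i + 1) (\<pi> powi i * rep C) = cos (i + 1) (\<pi> powi i * rep D)) = (C = D)"
      using rep_in_frac_ideal(2)[OF C] rep_in_frac_ideal(2)[OF D] by simp
  next
    fix C assume C: "C \<in> cos 1 ` I 0"
    show "cos (i + 1) (\<pi> powi i * rep C) \<in> cos (i + 1) ` I i"
      using rep_in_frac_ideal(1)[OF C] uniformizer_powi_mult[of i "rep C" 0] by simp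
  next
    fix D assume "D \<in> cos (i + 1) ` I i"
    then obtain x where x: "x \<in> I i" "D = cos (i + 1) x" by auto
    define y where "y = x / \<pi> powi i"
    have xy: "x = \<pi> powi i * y" using uniformizer(1) by (simp add: y_def)
    have y: "y \<in> I 0" using x(1) uniformizer_powi_mult[of i y 0] xy by simp
    have "D = cos (i + 1) (\<pi> powi i * rep (cos 1 y))"
      unfolding x(2) xy coset_eq_iff right_diff_distrib[symmetric] uniformizer_powi_mult
      by (rule rep_coset)
    then show "\<exists>C\<in>cos 1 ` I 0. D = cos (i + 1) (\<pi> powi i * rep C)" using y by blast
  qed
  then show ?thesis
    using bij_betw_finite bij_betw_same_card finite_residue_field
    by (metis residue_card_def residue_field_eq)
qed

text \<open>A class modulo the finest ideal amounts to a leading digit modulo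
  \<open>I (i + 1)\<close> and a remainder class inside \<open>I (i + 1)\<close>; each digit
  contributes a factor \<open>q\<close>.\<close>

lemma card_coset: "finite (cos (i + int d) ` I i) \<and> card (cos (i + int d) ` I i) = q ^ d"
proof (induction d arbitrary: i)
  case 0
  have "cos i ` I i = (\<lambda>_. cos i 0) ` I i"
    by (intro image_cong refl) (simp add: coset_eq_iff)
  also have "\<dots> = {cos i 0}" using frac_ideal_0 by blast
  finally show ?case by simp
next
  case (Suc d)
  let ?j = "i + int (Suc d)"
  have j: "?j = (i + 1) + int d" by simp
  have "bij_betw (\<lambda>(C, D). cos ?j (rep C + rep D)) (cos (i + 1) ` I i \<times> cos ?j ` I (i + 1)) (cos ?j ` I i)"
  proof (rule bij_betwI')
    fix p p' assume p: "p \<in> cos (i + 1) ` I i \<times> cos ?j ` I (i + 1)"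
      and p': "p' \<in> cos (i + 1) ` I i \<times> cos ?j ` I (i + 1)"
    obtain C D where CD: "p = (C, D)" "C \<in> cos (i + 1) ` I i" "D \<in> cos ?j ` I (i + 1)" using p by auto
    obtain C' D' where CD': "p' = (C', D')" "C' \<in> cos (i + 1) ` I i" "D' \<in> cos ?j ` I (i + 1)"
      using p' by auto
    have "p = p'" if "cos ?j (rep C + rep D) = cos ?j (rep C' + rep D')"
    proof -
      have 1: "rep C + rep D - (rep C' + rep D') \<in> I ?j" using that by (simp only: coset_eq_iff)
      then have "rep C + rep D - (rep C' + rep D') \<in> I (i + 1)" by (rule frac_ideal_mono[rotated]) simp
      moreover have "rep D - rep D' \<in> I (i + 1)"
        using rep_in_frac_ideal(1)[OF CD(3)] rep_in_frac_ideal(1)[OF CD'(3)] by (simp add: frac_ideal_diff)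
      ultimately have "rep C + rep D - (rep C' + rep D') - (rep D - rep D') \<in> I (i + 1)"
        by (rule frac_ideal_diff)
      then have "cos (i + 1) (rep C) = cos (i + 1) (rep C')" unfolding coset_eq_iff by (simp add: algebra_simps)
      then have C: "C = C'" using rep_in_frac_ideal(2)[OF CD(2)] rep_in_frac_ideal(2)[OF CD'(2)] by simp
      then have "cos ?j (rep D) = cos ?j (rep D')" using 1 unfolding coset_eq_iff by (simp add: algebra_simps)
      then have "D = D'" using rep_in_frac_ideal(2)[OF CD(3)] rep_in_frac_ideal(2)[OF CD'(3)] by simp
      with C CD CD' show ?thesis by simp
    qed
    then show "((case p of (C, D) \<Rightarrow> cos ?j (rep C + rep D)) = (case p' of (C, D) \<Rightarrow> cos ?j (rep C + rep D))) = (p = p')"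
      using CD(1) CD'(1) by auto
  next
    fix p assume "p \<in> cos (i + 1) ` I i \<times> cos ?j ` I (i + 1)"
    then obtain C D where CD: "p = (C, D)" "C \<in> cos (i + 1) ` I i" "D \<in> cos ?j ` I (i + 1)" by auto
    have "rep C + rep D \<in> I i"
      using rep_in_frac_ideal(1)[OF CD(2)] frac_ideal_mono[OF _ rep_in_frac_ideal(1)[OF CD(3)], of i]
      by (simp add: frac_ideal_add)
    then show "(case p of (C, D) \<Rightarrow> cos ?j (rep C + rep D)) \<in> cos ?j ` I i" using CD by simp
  next
    fix E assume "E \<in> cos ?j ` I i"
    then obtain x where x: "x \<in> I i" "E = cos ?j x" by auto
    define y where "y = x - rep (cos (i + 1) x)"
    have y: "y \<in> I (i + 1)" unfolding y_def by (rule rep_coset)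
    have "x - (rep (cos (i + 1) x) + rep (cos ?j y)) = y - rep (cos ?j y)" by (simp add: y_def)
    then have "E = cos ?j (rep (cos (i + 1) x) + rep (cos ?j y))"
      unfolding x(2) coset_eq_iff using rep_coset[of y ?j] by (simp only:)
    then show "\<exists>p\<in>cos (i + 1) ` I i \<times> cos ?j ` I (i + 1). E = (case p of (C, D) \<Rightarrow> cos ?j (rep C + rep D))"
      using x y by (intro bexI[of _ "(cos (i + 1) x, cos ?j y)"]) auto
  qed
  note bij = this
  show ?case
    using bij_betw_finite[OF bij] bij_betw_same_card[OF bij, symmetric] Suc.IH[of "i + 1", folded j] card_coset_step[of i] by (simp add: card_cartesian_product)
qed

lemma finite_coset: "i \<le> j \<Longrightarrow> finite (cos j ` I i)"
  using card_coset[of i "nat (j - i)"] by simp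

lemma card_coset_eq: "i \<le> j \<Longrightarrow> card (cos j ` I i) = q ^ nat (j - i)"
  using card_coset[of i "nat (j - i)"] by simp

section \<open>Topology, Borel sets and Haar measure in terms of cosets\<close>

lemma open_coset: "open (cos j x)"
  unfolding open_contains_ball
proof
  fix y assume y: "y \<in> cos j x"
  have "ball y (av \<pi> powi j) \<subseteq> cos j x"
  proof
    fix z assume "z \<in> ball y (av \<pi> powi j)"
    then have "y - z \<in> I j" by (simp add: dist_av frac_ideal_iff)
    then show "z \<in> cos j x" using frac_ideal_add[of "x - y" j "y - z"] y by (simp add: coset_def)
  qed
  then show "\<exists>e>0. ball y e \<subseteq> cos j x"
    using av_uniformizer_pos by (intro exI[of _ "av \<pi> powi j"]) auto
qed

lemma open_imp_coset:
  assumes "open S" "x \<in> S"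
  shows "\<exists>j\<ge>k. cos (int j) x \<subseteq> S"
proof -
  obtain e where e: "e > 0" "ball x e \<subseteq> S" using assms open_contains_ball by blast
  obtain j where j: "av \<pi> ^ j < e"
    using real_arch_pow_inv[OF e(1) av_uniformizer_less_1] by blast
  have "cos (int (max j k)) x \<subseteq> ball x e"
  proof
    fix y assume "y \<in> cos (int (max j k)) x"
    then have "x - y \<in> I (int j)" using frac_ideal_mono[of "int j" "int (max j k)"] by (simp add: coset_def)
    then show "y \<in> ball x e" using j by (simp add: dist_av frac_ideal_iff)
  qed
  then show ?thesis using e by (intro exI[of _ "max j k"]) auto
qed

text \<open>The indices guarantee \<open>- int i \<le> int (i + j)\<close>: every image is then
  finite by \<open>finite_coset\<close>, and the basis is countable, as
  \<open>borel_eq_countable_basis\<close> requires.\<close>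

definition all_cosets :: "'k set set" where
  "all_cosets = (\<Union>i. \<Union>j. cos (int (i + j)) ` I (- int i))"

lemma borel_eq_sigma_cosets: "(borel :: 'k measure) = sigma UNIV all_cosets"
proof (rule borel_eq_countable_basis)
  show "countable all_cosets"
    unfolding all_cosets_def by (intro countable_UN countableI_type countable_finite[OF finite_coset]) auto
  show "topological_basis all_cosets"
  proof (rule topological_basisI)
    fix B assume "B \<in> all_cosets" then show "open B"
      by (auto simp: all_cosets_def open_coset)
  next
    fix S x assume S: "open S" "(x :: 'k) \<in> S"
    obtain i where i: "x \<in> I (- int i)" using frac_ideal_exhaust by blast
    obtain j where j: "j \<ge> i" "cos (int j) x \<subseteq> S" using open_imp_coset[OF S] by blast
    have "cos (int (i + (j - i))) x \<in> all_cosets" unfolding all_cosets_def using i by blast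
    then show "\<exists>B\<in>all_cosets. x \<in> B \<and> B \<subseteq> S" using j by (intro bexI[of _ "cos (int j) x"]) auto
  qed
qed

text \<open>The ring of integers has measure 1 and is a disjoint union of \<open>q ^ j\<close>
  translates of \<open>cos (int j) 0\<close>.\<close>

lemma emeasure_coset:
  assumes \<mu>: "normalized_Haar av \<mu>"
  shows "emeasure \<mu> (cos (int j) x) = ennreal (1 / real q ^ j)"
proof -
  have meas: "cos k y \<in> sets borel" for k y by (simp add: open_coset)
  have transl: "emeasure \<mu> (cos (int j) y) = emeasure \<mu> (cos (int j) 0)" for y
  proof -
    have "cos (int j) y = (+) y ` cos (int j) 0"
    proof (intro equalityI subsetI)
      fix z assume "z \<in> cos (int j) y"
      then show "z \<in> (+) y ` cos (int j) 0"
        by (intro image_eqI[of _ _ "z - y"]) (simp_all add: coset_def frac_ideal_minus_commute)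
    qed (auto simp: coset_def)
    then show ?thesis using \<mu> meas by (simp add: normalized_Haar_def)
  qed
  have sets: "sets \<mu> = sets borel" using \<mu> by (simp add: normalized_Haar_def)
  have fin: "finite (cos (int j) ` I 0)" by (rule finite_coset) simp
  have un: "I 0 = \<Union> (cos (int j) ` I 0)"
  proof (intro equalityI subsetI)
    fix y assume "y \<in> \<Union> (cos (int j) ` I 0)"
    then obtain x where x: "x \<in> I 0" "x - y \<in> I (int j)" by (auto simp: coset_def)
    from frac_ideal_diff[OF x(1) frac_ideal_mono[OF _ x(2)]] show "y \<in> I 0" by simp
  next
    fix y assume "y \<in> I 0"
    then show "y \<in> \<Union> (cos (int j) ` I 0)" by (intro UnionI[of "cos (int j) y"] imageI mem_coset_self)
  qed
  have disj: "disjoint_family_on (\<lambda>C. C) (cos (int j) ` I 0)"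
  proof -
    have "cos (int j) x = cos (int j) z" if "z \<in> cos (int j) x" for x z
      using that unfolding coset_eq_iff by (simp add: coset_def)
    then show ?thesis unfolding disjoint_family_on_def by blast
  qed
  have "1 = emeasure \<mu> (I 0)" using \<mu> by (simp add: normalized_Haar_def ring_of_integers_eq)
  also have "\<dots> = emeasure \<mu> (\<Union>C\<in>cos (int j) ` I 0. C)"
    using arg_cong[OF un, of "emeasure \<mu>"] by simp
  also have "\<dots> = (\<Sum>C\<in>cos (int j) ` I 0. emeasure \<mu> C)"
    by (rule sum_emeasure[symmetric, OF _ disj fin]) (use meas sets in auto)
  also have "\<dots> = (\<Sum>C\<in>cos (int j) ` I 0. emeasure \<mu> (cos (int j) 0))"
    by (intro sum.cong refl) (auto intro: transl)
  also have "\<dots> = ennreal (real q ^ j) * emeasure \<mu> (cos (int j) 0)"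
    using card_coset_eq[of 0 "int j"] by (simp add: ennreal_of_nat_eq_real_of_nat)
  finally have eq: "ennreal (real q ^ j) * emeasure \<mu> (cos (int j) 0) = 1" by simp
  have pos: "real q ^ j > 0" using q_gt_1 by simp
  \<comment> \<open>Multiplication in \<open>ennreal\<close> does not cancel in general, so the
    equation is multiplied by the real inverse.\<close>
  have "emeasure \<mu> (cos (int j) 0) = ennreal (1 / real q ^ j) * (ennreal (real q ^ j) * emeasure \<mu> (cos (int j) 0))"
    using pos by (subst mult.assoc[symmetric], subst ennreal_mult[symmetric]) auto
  also have "\<dots> = ennreal (1 / real q ^ j)" unfolding eq by simp
  finally show ?thesis unfolding transl[of x] .
qed

end

section \<open>Residue characteristic two\<close>

lemma power_int_less_iff:
  fixes b :: real
  assumes "0 < b" "b < 1"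
  shows "b powi i < b powi j \<longleftrightarrow> j < i"
proof
  assume "b powi i < b powi j"
  then show "j < i"
    using power_int_decreasing[of i j b] assms by (cases "i \<le> j") auto
qed (use power_int_strict_decreasing[of j i b] assms in auto)

text \<open>The case to be excluded: \<open>av_2_eq_1\<close> interprets this locale inside a proof
  by contradiction.\<close>

locale dyadic_field = nonarch_local_field av \<pi>
  for av :: "'k::{field, metric_space} \<Rightarrow> real" and \<pi> :: 'k +
  assumes av_2_less: "av 2 < 1" and char_0: "CHAR('k) = 0"
begin

lemma of_int_eq_0 [simp]: "(of_int z :: 'k) = 0 \<longleftrightarrow> z = 0"
  by (simp add: of_int_eq_0_iff_char_dvd char_0)

lemma av_2_pos: "av 2 > 0"
  using of_int_eq_0[of 2] av_eq_0_iff[of 2] av_nonneg[of 2] by simp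

lemma av_of_int_le: "av (of_int z) \<le> 1"
  by (cases z rule: int_cases2) (simp_all add: av_of_nat_le)

lemma av_of_int_odd: "odd z \<Longrightarrow> av (of_int z) = 1"
proof -
  assume "odd z"
  then obtain j where "z = 2 * j + 1" by (elim oddE)
  then have "(of_int z :: 'k) = 1 + 2 * of_int j" by simp
  moreover have "av (2 * of_int j) < av 1"
    using mult_left_le[OF av_of_int_le[of j], of "av 2"] av_2_less by (simp add: av_mult av_nonneg)
  ultimately show ?thesis using av_add_less[of "2 * of_int j" 1] by simp
qed

lemma av_of_int:
  assumes "z \<noteq> 0"
  shows "av (of_int z) = av 2 ^ multiplicity 2 z"
proof -
  obtain y where y: "z = 2 ^ multiplicity 2 z * y" "\<not> 2 dvd y"
    using multiplicity_decompose'[of z 2] assms by auto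
  have "(of_int z :: 'k) = 2 ^ multiplicity 2 z * of_int y"
    by (subst y(1)) simp
  then show ?thesis using y(2) by (simp add: av_mult av_power av_of_int_odd)
qed

text \<open>\<open>of_rat\<close> needs the class \<open>field_char_0\<close>, whereas
  characteristic zero is here a locale assumption on \<open>CHAR\<close>; the canonical map is
  therefore written with numerators and denominators.\<close>

definition \<iota> :: "rat \<Rightarrow> 'k" where
  "\<iota> x = (case quotient_of x of (a, b) \<Rightarrow> of_int a / of_int b)"

lemma iota_divide: "b \<noteq> 0 \<Longrightarrow> \<iota> (of_int a / of_int b) = of_int a / of_int b"
proof -
  assume b: "b \<noteq> 0"
  obtain p r where pr: "quotient_of (of_int a / of_int b) = (p, r)" by (cases "quotient_of (of_int a / of_int b)")
  have r: "r > 0" using quotient_of_denom_pos[OF pr] .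
  have "(of_int a / of_int b :: rat) = of_int p / of_int r" by (rule quotient_of_div[OF pr])
  then have "(of_int (a * r) :: rat) = of_int (p * b)" using b r by (simp add: field_simps)
  then have "a * r = p * b" by (simp only: of_int_eq_iff)
  then have "(of_int a * of_int r :: 'k) = of_int p * of_int b" by (metis of_int_mult)
  then show ?thesis using b r by (simp add: \<iota>_def pr frac_eq_eq)
qed

lemma rat_quotientE:
  obtains a b where "(x :: rat) = of_int a / of_int b" "b \<noteq> 0"
  using quotient_of_div[of x] quotient_of_denom_pos[of x] by (metis less_irrefl surj_pair)

lemma iota_1: "\<iota> 1 = 1"
  using iota_divide[of 1 1] by simp

lemma iota_mult: "\<iota> (x * y) = \<iota> x * \<iota> y"
proof -
  obtain a b where x: "x = of_int a / of_int b" "b \<noteq> 0" by (rule rat_quotientE)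
  obtain a' b' where y: "y = of_int a' / of_int b'" "b' \<noteq> 0" by (rule rat_quotientE)
  have "x * y = of_int (a * a') / of_int (b * b')" by (simp add: x y)
  then show ?thesis using x y iota_divide[of "b * b'" "a * a'"] by (simp add: iota_divide)
qed

lemma iota_add: "\<iota> (x + y) = \<iota> x + \<iota> y"
proof -
  obtain a b where x: "x = of_int a / of_int b" "b \<noteq> 0" by (rule rat_quotientE)
  obtain a' b' where y: "y = of_int a' / of_int b'" "b' \<noteq> 0" by (rule rat_quotientE)
  have "x + y = of_int (a * b' + a' * b) / of_int (b * b')" using x y by (simp add: add_frac_eq)
  then show ?thesis
    using x y iota_divide[of "b * b'" "a * b' + a' * b"] by (simp add: iota_divide add_frac_eq)
qed

lemma iota_minus: "\<iota> (- x) = - \<iota> x"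
  using iota_add[of x "- x"] iota_divide[of 1 0] by (simp add: eq_neg_iff_add_eq_0 add.commute)

lemma iota_diff: "\<iota> (x - y) = \<iota> x - \<iota> y"
  using iota_add[of x "- y"] by (simp add: iota_minus)

definition val :: "rat \<Rightarrow> int" where
  "val x = (case quotient_of x of (a, b) \<Rightarrow> int (multiplicity 2 a) - int (multiplicity 2 b))"

lemma padic_abs_val: "x \<noteq> 0 \<Longrightarrow> padic_abs 2 x = (1/2) powi val x"
  by (auto simp: padic_abs_def val_def power_int_def split: prod.splits)

lemma av_iota_val:
  assumes "x \<noteq> 0"
  shows "av (\<iota> x) = av 2 powi val x"
proof -
  obtain a b where ab: "quotient_of x = (a, b)" by (cases "quotient_of x")
  have "b > 0" "a \<noteq> 0"
    using quotient_of_denom_pos[OF ab] quotient_of_div[OF ab] assms by auto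
  then show ?thesis
    using av_2_pos by (simp add: \<iota>_def val_def ab av_divide av_of_int power_int_diff)
qed

text \<open>Both absolute values are powers with the exponent \<open>val x\<close>, of the bases
  \<open>1/2\<close> and \<open>av 2\<close> between 0 and 1. They need not agree, but they have the
  same small rationals, which is all that Cauchy and null sequences see.\<close>

lemma padic_abs_less_iff: "padic_abs 2 x < (1/2) ^ k \<longleftrightarrow> av (\<iota> x) < av 2 ^ k"
proof (cases "x = 0")
  case True
  then show ?thesis using av_2_pos iota_divide[of 1 0] by (simp add: padic_abs_def)
next
  case False
  then show ?thesis
    using power_int_less_iff[of "1/2" "val x" "int k"] power_int_less_iff[of "av 2" "val x" "int k"] av_2_pos av_2_less
    by (simp add: padic_abs_val av_iota_val)
qed

text \<open>Two indices serve both notions: differences for Cauchy sequences, and a function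
  constant in \<open>j\<close> for null sequences.\<close>

lemma eventually_small_iff:
  fixes x :: "nat \<Rightarrow> nat \<Rightarrow> rat"
  shows "(\<forall>e>0. \<exists>N. \<forall>i\<ge>N. \<forall>j\<ge>N. padic_abs 2 (x i j) < e) \<longleftrightarrow> (\<forall>e>0. \<exists>N. \<forall>i\<ge>N. \<forall>j\<ge>N. av (\<iota> (x i j)) < e)"
proof (intro iffI allI impI)
  fix e :: real assume *: "\<forall>e>0. \<exists>N. \<forall>i\<ge>N. \<forall>j\<ge>N. padic_abs 2 (x i j) < e" and e: "e > 0"
  obtain k where k: "av 2 ^ k < e" using real_arch_pow_inv[OF e av_2_less] by blast
  have "(1/2 :: real) ^ k > 0" by simp
  from *[rule_format, OF this] obtain N where N: "\<forall>i\<ge>N. \<forall>j\<ge>N. padic_abs 2 (x i j) < (1/2) ^ k" ..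
  show "\<exists>N. \<forall>i\<ge>N. \<forall>j\<ge>N. av (\<iota> (x i j)) < e"
  proof (intro exI allI impI)
    fix i j assume "N \<le> i" "N \<le> j"
    then have "av (\<iota> (x i j)) < av 2 ^ k" using N by (simp flip: padic_abs_less_iff)
    then show "av (\<iota> (x i j)) < e" using k by linarith
  qed
next
  fix e :: real assume *: "\<forall>e>0. \<exists>N. \<forall>i\<ge>N. \<forall>j\<ge>N. av (\<iota> (x i j)) < e" and e: "e > 0"
  obtain k where k: "(1/2 :: real) ^ k < e" using real_arch_pow_inv[OF e, of "1/2"] by auto
  have "av 2 ^ k > 0" using av_2_pos by simp
  from *[rule_format, OF this] obtain N where N: "\<forall>i\<ge>N. \<forall>j\<ge>N. av (\<iota> (x i j)) < av 2 ^ k" ..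
  show "\<exists>N. \<forall>i\<ge>N. \<forall>j\<ge>N. padic_abs 2 (x i j) < e"
  proof (intro exI allI impI)
    fix i j assume "N \<le> i" "N \<le> j"
    then have "padic_abs 2 (x i j) < (1/2) ^ k" using N by (simp only: padic_abs_less_iff)
    then show "padic_abs 2 (x i j) < e" using k by linarith
  qed
qed

lemma padic_Cauchy_iff: "padic_Cauchy 2 x \<longleftrightarrow> (\<exists>l. (\<lambda>i. \<iota> (x i)) \<longlonglongrightarrow> l)"
proof -
  have "padic_Cauchy 2 x \<longleftrightarrow> Cauchy (\<lambda>i. \<iota> (x i))"
    unfolding padic_Cauchy_def eventually_small_iff by (auto simp: Cauchy_def dist_av iota_diff)
  also have "\<dots> \<longleftrightarrow> (\<exists>l. (\<lambda>i. \<iota> (x i)) \<longlonglongrightarrow> l)"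
    using complete LIMSEQ_imp_Cauchy by (auto simp: complete_def)
  finally show ?thesis .
qed

lemma padic_null_iff: "padic_null 2 x \<longleftrightarrow> (\<lambda>i. \<iota> (x i)) \<longlonglongrightarrow> 0"
proof -
  have const: "(\<forall>i\<ge>N. \<forall>j\<ge>N. Q i) \<longleftrightarrow> (\<forall>i\<ge>N. Q i)" for Q and N :: nat by blast
  have "padic_abs 2 y \<ge> 0" for y by (simp add: padic_abs_def case_prod_beta Let_def)
  then have "padic_null 2 x \<longleftrightarrow> (\<forall>e>0. \<exists>N. \<forall>i\<ge>N. padic_abs 2 (x i) < e)"
    by (simp add: padic_null_def LIMSEQ_def dist_real_def)
  also have "\<dots> \<longleftrightarrow> (\<forall>e>0. \<exists>N. \<forall>i\<ge>N. av (\<iota> (x i)) < e)"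
    using eventually_small_iff[of "\<lambda>i j. x i"] unfolding const .
  also have "\<dots> \<longleftrightarrow> (\<lambda>i. \<iota> (x i)) \<longlonglongrightarrow> 0"
    by (simp add: LIMSEQ_def dist_av)
  finally show ?thesis .
qed

section \<open>Limits in the field and the map from 2-adic Cauchy sequences\<close>

lemma tendsto_av_iff: "X \<longlonglongrightarrow> l \<longleftrightarrow> (\<lambda>i. av (X i - l)) \<longlonglongrightarrow> 0"
  by (subst tendsto_dist_iff) (simp add: dist_av)

text \<open>The sort of \<open>'k\<close> combines a field and a metric without relating them, so
  continuity of the ring operations has to come from \<open>dist_av\<close>.\<close>

lemma LIMSEQ_add:
  assumes "X \<longlonglongrightarrow> l" "Y \<longlonglongrightarrow> m"
  shows "(\<lambda>i. X i + Y i :: 'k) \<longlonglongrightarrow> l + m"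
  unfolding tendsto_av_iff
proof (rule tendsto_sandwich[OF _ _ tendsto_const])
  have "av (X i + Y i - (l + m)) \<le> av (X i - l) + av (Y i - m)" for i
    using av_ultrametric[of "X i - l" "Y i - m"] av_nonneg[of "X i - l"] av_nonneg[of "Y i - m"]
    by (simp add: algebra_simps)
  then show "\<forall>\<^sub>F i in sequentially. av (X i + Y i - (l + m)) \<le> av (X i - l) + av (Y i - m)" by simp
  show "(\<lambda>i. av (X i - l) + av (Y i - m)) \<longlonglongrightarrow> 0"
    using tendsto_add[OF assms[unfolded tendsto_av_iff]] by simp
qed (simp add: av_nonneg)

lemma LIMSEQ_mult:
  assumes "X \<longlonglongrightarrow> l" "Y \<longlonglongrightarrow> m"
  shows "(\<lambda>i. X i * Y i :: 'k) \<longlonglongrightarrow> l * m"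
  unfolding tendsto_av_iff
proof (rule tendsto_sandwich[OF _ _ tendsto_const])
  let ?b = "\<lambda>i. av (X i - l) * av (Y i - m) + (av l * av (Y i - m) + av (X i - l) * av m)"
  have "av (X i * Y i - l * m) \<le> ?b i" for i
  proof -
    have "X i * Y i - l * m = (X i - l) * (Y i - m) + (l * (Y i - m) + (X i - l) * m)"
      by (simp add: algebra_simps)
    then have "av (X i * Y i - l * m) \<le> max (av ((X i - l) * (Y i - m))) (max (av (l * (Y i - m))) (av ((X i - l) * m)))"
      using order_trans[OF av_ultrametric max.mono[OF order_refl av_ultrametric]] by simp
    also have "\<dots> \<le> ?b i" by (simp add: av_mult av_nonneg)
    finally show ?thesis .
  qed
  then show "\<forall>\<^sub>F i in sequentially. av (X i * Y i - l * m) \<le> ?b i" by simp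
  have "?b \<longlonglongrightarrow> 0 * 0 + (av l * 0 + 0 * av m)"
    using assms[unfolded tendsto_av_iff] by (intro tendsto_intros)
  then show "?b \<longlonglongrightarrow> 0" by simp
qed (simp add: av_nonneg)

text \<open>In residue characteristic two this limit map on Cauchy sequences induces an embedding of \<open>Q\<^sub>2\<close>.\<close>

definition padic_lim :: "(nat \<Rightarrow> rat) \<Rightarrow> 'k" where
  "padic_lim x = lim (\<lambda>i. \<iota> (x i))"

lemma padic_lim_eq: "(\<lambda>i. \<iota> (x i)) \<longlonglongrightarrow> l \<Longrightarrow> padic_lim x = l"
  unfolding padic_lim_def by (rule limI)

lemma padic_lim: "padic_Cauchy 2 x \<Longrightarrow> (\<lambda>i. \<iota> (x i)) \<longlonglongrightarrow> padic_lim x"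
  using padic_lim_eq unfolding padic_Cauchy_iff by blast

lemma padic_lim_add:
  assumes "padic_Cauchy 2 x" "padic_Cauchy 2 y"
  shows "padic_Cauchy 2 (\<lambda>i. x i + y i)" "padic_lim (\<lambda>i. x i + y i) = padic_lim x + padic_lim y"
proof -
  have *: "(\<lambda>i. \<iota> (x i + y i)) \<longlonglongrightarrow> padic_lim x + padic_lim y"
    unfolding iota_add by (intro LIMSEQ_add padic_lim assms)
  then show "padic_Cauchy 2 (\<lambda>i. x i + y i)" unfolding padic_Cauchy_iff by blast
  show "padic_lim (\<lambda>i. x i + y i) = padic_lim x + padic_lim y" by (rule padic_lim_eq[OF *])
qed

lemma padic_lim_mult:
  assumes "padic_Cauchy 2 x" "padic_Cauchy 2 y"
  shows "padic_Cauchy 2 (\<lambda>i. x i * y i)" "padic_lim (\<lambda>i. x i * y i) = padic_lim x * padic_lim y"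
proof -
  have *: "(\<lambda>i. \<iota> (x i * y i)) \<longlonglongrightarrow> padic_lim x * padic_lim y"
    unfolding iota_mult by (intro LIMSEQ_mult padic_lim assms)
  then show "padic_Cauchy 2 (\<lambda>i. x i * y i)" unfolding padic_Cauchy_iff by blast
  show "padic_lim (\<lambda>i. x i * y i) = padic_lim x * padic_lim y" by (rule padic_lim_eq[OF *])
qed

lemma padic_lim_const: "padic_Cauchy 2 (\<lambda>i. a)" "padic_lim (\<lambda>i. a) = \<iota> a"
  unfolding padic_Cauchy_iff by (blast intro: tendsto_const, rule padic_lim_eq, rule tendsto_const)

lemma ring_padic_Cauchy_ring: "ring (padic_Cauchy_ring 2)"
proof (intro ringI abelian_groupI monoidI)
  fix x :: "nat \<Rightarrow> rat" assume "x \<in> carrier (padic_Cauchy_ring 2)"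
  then have "padic_Cauchy 2 x" by (simp add: padic_Cauchy_ring_def)
  then have "padic_Cauchy 2 (\<lambda>i. (-1) * x i)" by (intro padic_lim_mult padic_lim_const)
  then show "\<exists>y\<in>carrier (padic_Cauchy_ring 2). y \<oplus>\<^bsub>padic_Cauchy_ring 2\<^esub> x = \<zero>\<^bsub>padic_Cauchy_ring 2\<^esub>"
    by (intro bexI[of _ "\<lambda>i. (-1) * x i"]) (simp_all add: padic_Cauchy_ring_def)
qed (simp_all add: padic_Cauchy_ring_def padic_lim_add padic_lim_mult padic_lim_const mult.assoc add_ac
    distrib_left distrib_right)

lemma ring_type_ring: "ring (type_ring :: 'k ring)"
proof (intro ringI abelian_groupI monoidI)
  fix x :: 'k
  show "\<exists>y\<in>carrier type_ring. y \<oplus>\<^bsub>type_ring\<^esub> x = \<zero>\<^bsub>type_ring\<^esub>"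
    by (intro bexI[of _ "- x"]) (simp_all add: type_ring_def)
qed (simp_all add: type_ring_def mult.assoc add.assoc add.commute distrib_left distrib_right)

text \<open>The limit map is a ring homomorphism whose kernel consists of the null sequences, by
  uniqueness of limits; it therefore factors through the quotient \<open>Qp 2\<close>.\<close>

lemma extension_of_Q2: "is_extension_of_Qp 2 TYPE('k)"
proof -
  have "padic_lim \<in> ring_hom (padic_Cauchy_ring 2) type_ring"
    by (rule ring_hom_memI)
      (simp_all add: padic_Cauchy_ring_def type_ring_def padic_lim_add padic_lim_mult padic_lim_const iota_1)
  then interpret ring_hom_ring "padic_Cauchy_ring 2" type_ring padic_lim
    by (intro ring_hom_ringI2 ring_padic_Cauchy_ring ring_type_ring)
  have "padic_lim x = 0 \<longleftrightarrow> padic_null 2 x" if "padic_Cauchy 2 x" for x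
    unfolding padic_null_iff
  proof
    assume "padic_lim x = 0"
    then show "(\<lambda>i. \<iota> (x i)) \<longlonglongrightarrow> 0" using padic_lim[OF that] by simp
  qed (rule padic_lim_eq)
  then have "a_kernel (padic_Cauchy_ring 2) type_ring padic_lim = {x. padic_Cauchy 2 x \<and> padic_null 2 x}"
    unfolding a_kernel_def' by (intro Collect_cong) (simp add: padic_Cauchy_ring_def type_ring_def cong: conj_cong)
  from the_elem_hom[unfolded this] show ?thesis
    unfolding is_extension_of_Qp_def Qp_def by (metis empty_iff)
qed

end

text \<open>If \<open>av 2 < 1\<close>, then \<open>1 + 2 * of_nat j\<close> has absolute value 1
  and is not zero, which excludes odd characteristic. Characteristic zero remains, and there
  \<open>extension_of_Q2\<close> contradicts the second hypothesis.\<close>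

lemma (in nonarch_local_field) av_2_eq_1:
  assumes "CHAR('k) \<noteq> 2" "\<not> is_extension_of_Qp 2 TYPE('k)"
  shows "av 2 = 1"
proof (rule ccontr)
  assume "av 2 \<noteq> 1"
  moreover have "av 2 \<le> 1" using av_ultrametric[of 1 1] by simp
  ultimately have less: "av 2 < 1" by simp
  have "CHAR('k) = 0"
  proof (rule ccontr)
    assume "CHAR('k) \<noteq> 0"
    then have "prime CHAR('k)" by (intro prime_CHAR_semidom) simp
    then have "odd CHAR('k)" using primes_dvd_imp_eq[OF two_is_prime_nat] assms(1) by metis
    then obtain j where j: "CHAR('k) = 2 * j + 1" by (elim oddE)
    have "(0 :: 'k) = of_nat CHAR('k)" by simp
    also have "\<dots> = 1 + 2 * of_nat j" unfolding j by simp
    finally have "1 + 2 * of_nat j = (0 :: 'k)" by simp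
    moreover have "av (2 * of_nat j) < av 1"
      using mult_left_le[OF av_of_nat_le[of j], of "av 2"] less by (simp add: av_mult av_nonneg)
    ultimately show False using av_add_less[of "2 * of_nat j" 1] by simp
  qed
  then interpret dyadic_field av \<pi>
    by unfold_locales (use less in simp_all)
  show False using extension_of_Q2 assms(2) by simp
qed

section \<open>The kernel on finite quotients\<close>

text \<open>The hypotheses on the characteristic and on extensions of Q_2 are present only through
  \<open>av_2\<close>.\<close>

locale unitary_setting = nonarch_local_field av \<pi>
  for av :: "'k::{field, metric_space} \<Rightarrow> real" and \<pi> :: 'k +
  fixes \<Psi> :: "'k \<Rightarrow> complex" and \<mu> :: "'k measure" and n :: nat
  assumes character: "unramified_character av \<pi> \<Psi>"
    and Haar: "normalized_Haar av \<mu>"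
    and n_pos: "n \<ge> 1"
    and av_2: "av 2 = 1"
begin

lemma psi_add: "\<Psi> (x + y) = \<Psi> x * \<Psi> y"
  and psi_norm [simp]: "cmod (\<Psi> x) = 1"
  and psi_integer: "x \<in> I 0 \<Longrightarrow> \<Psi> x = 1"
  and psi_nontrivial: "\<exists>x\<in>I (-1). \<Psi> x \<noteq> 1"
  using character by (auto simp: unramified_character_def ring_of_integers_eq)

lemma psi_cong: "x - y \<in> I 0 \<Longrightarrow> \<Psi> x = \<Psi> y"
  using psi_add[of "x - y" y] psi_integer by simp

lemma psi_minus: "\<Psi> (- x) = cnj (\<Psi> x)"
proof -
  have "\<Psi> (- x) * \<Psi> x = 1" using psi_add[of "- x" x] psi_integer[of 0] by simp
  moreover have "cnj (\<Psi> x) * \<Psi> x = 1"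
    using complex_norm_square[of "\<Psi> x"] by (simp add: mult.commute)
  ultimately show ?thesis
    by (metis mult.assoc mult.commute mult.right_neutral)
qed

lemma psi_diff: "\<Psi> (x - y) = \<Psi> x * cnj (\<Psi> y)"
  using psi_add[of x "- y"] by (simp add: psi_minus)

text \<open>Orthogonality of characters. For \<open>x\<close> in \<open>I (- j)\<close> the phase
  depends only on the class; if the resulting character of \<open>I i\<close> is nontrivial, a
  translation permutes the classes and multiplies the sum by a number other than 1.\<close>

lemma sum_psi:
  assumes "i \<le> j" "x \<in> I (- j)"
  shows "(\<Sum>C\<in>cos j ` I i. \<Psi> (x * rep C)) = (if x \<in> I (- i) then of_nat (q ^ nat (j - i)) else 0)"
proof (cases "x \<in> I (- i)")
  case True
  have "(\<Sum>C\<in>cos j ` I i. \<Psi> (x * rep C)) = (\<Sum>C\<in>cos j ` I i. 1)"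
  proof (rule sum.cong[OF refl])
    fix C assume "C \<in> cos j ` I i"
    then have "rep C \<in> I i" using rep_in_frac_ideal assms by blast
    then show "\<Psi> (x * rep C) = 1"
      using frac_ideal_mult[OF True, of "rep C" i] by (simp add: psi_integer)
  qed
  then show ?thesis using True assms by (simp add: card_coset_eq)
next
  case False
  obtain z where z: "z \<in> I (-1)" "\<Psi> z \<noteq> 1" using psi_nontrivial by blast
  have x: "av x \<ge> av \<pi> powi (- i - 1)" by (rule not_frac_ideal_imp[OF False])
  have x0: "x \<noteq> 0" using False by auto
  \<comment> \<open>Chosen so that \<open>x * y\<close> is the point \<open>z\<close> at which
    \<open>\<Psi>\<close> is nontrivial; the discreteness bound on \<open>av x\<close> puts
    \<open>y\<close> into \<open>I i\<close>.\<close>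
  define y where "y = z / x"
  have "av y \<le> av \<pi> powi (-1) / av \<pi> powi (- i - 1)"
    unfolding y_def av_divide using x z(1) av_uniformizer_pos
    by (intro frac_le) (auto simp: frac_ideal_iff)
  also have "\<dots> = av \<pi> powi i"
    using av_uniformizer_pos by (simp add: power_int_diff power_int_minus field_simps)
  finally have y: "y \<in> I i" by (simp add: frac_ideal_iff)
  have xy: "x * y = z" using x0 by (simp add: y_def)
  let ?\<sigma> = "\<lambda>C. cos j (rep C + y)"
  have "inj_on ?\<sigma> (cos j ` I i)"
  proof (rule inj_onI)
    fix C D assume C: "C \<in> cos j ` I i" and D: "D \<in> cos j ` I i" and "?\<sigma> C = ?\<sigma> D"
    then have "cos j (rep C) = cos j (rep D)" unfolding coset_eq_iff by simp
    then show "C = D" using rep_in_frac_ideal(2) C D assms(1) by metis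
  qed
  moreover have "?\<sigma> ` (cos j ` I i) \<subseteq> cos j ` I i"
    using rep_in_frac_ideal(1)[OF _ assms(1)] y by (auto intro!: imageI frac_ideal_add)
  ultimately have bij: "bij_betw ?\<sigma> (cos j ` I i) (cos j ` I i)"
    using finite_coset[OF assms(1)] by (simp add: bij_betw_def endo_inj_surj)
  have "(\<Sum>C\<in>cos j ` I i. \<Psi> (x * rep C)) = (\<Sum>C\<in>cos j ` I i. \<Psi> (x * rep (?\<sigma> C)))"
    by (rule sum.reindex_bij_betw[OF bij, symmetric])
  also have "\<dots> = (\<Sum>C\<in>cos j ` I i. \<Psi> z * \<Psi> (x * rep C))"
  proof (rule sum.cong[OF refl])
    fix C
    have "x * rep (?\<sigma> C) - x * (rep C + y) \<in> I 0"
      using frac_ideal_mult[OF assms(2) rep_coset'[of j "rep C + y"]] by (simp add: algebra_simps)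
    then have "\<Psi> (x * rep (?\<sigma> C)) = \<Psi> (x * (rep C + y))" by (rule psi_cong)
    then show "\<Psi> (x * rep (?\<sigma> C)) = \<Psi> z * \<Psi> (x * rep C)"
      by (simp add: distrib_left psi_add xy mult.commute)
  qed
  also have "\<dots> = \<Psi> z * (\<Sum>C\<in>cos j ` I i. \<Psi> (x * rep C))" by (simp add: sum_distrib_left)
  finally show ?thesis using z(2) False by simp
qed

section \<open>Principal units and the map phi\<close>

abbreviation U :: "'k set" where "U \<equiv> principal_units av \<pi> n"
abbreviation \<Gamma> :: "'k set set" where "\<Gamma> \<equiv> Gam av \<pi> n"

lemma U_iff: "a \<in> U \<longleftrightarrow> a - 1 \<in> I (int n)"
proof
  assume "a - 1 \<in> I (int n)"
  then have "1 + (a - 1) \<in> U" unfolding principal_units_def by blast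
  then show "a \<in> U" by simp
qed (auto simp: principal_units_def)

lemma av_frac_ideal_n: "x \<in> I (int n) \<Longrightarrow> av x < 1"
  using frac_ideal_mono[of 1 "int n" x] n_pos by (simp add: frac_ideal_1_iff)

lemma U_av [simp]: "a \<in> U \<Longrightarrow> av a = 1"
  using av_add_less[of "a - 1" 1] av_frac_ideal_n by (simp add: U_iff)

lemma U_nonzero: "a \<in> U \<Longrightarrow> a \<noteq> 0"
  using U_av av_zero by fastforce

lemma one_U [simp]: "1 \<in> U"
  by (simp add: U_iff)

lemma U_mult: "a \<in> U \<Longrightarrow> b \<in> U \<Longrightarrow> a * b \<in> U"
proof -
  assume a: "a \<in> U" and b: "b \<in> U"
  have "a * b - 1 = a * (b - 1) + (a - 1)" by (simp add: algebra_simps)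
  then show ?thesis
    using frac_ideal_add[of "a * (b - 1)" "int n" "a - 1"] a b frac_ideal_unit_mult(1)[OF U_av[OF a], of "b - 1"]
    by (simp only: U_iff)
qed

lemma U_inverse: "a \<in> U \<Longrightarrow> inverse a \<in> U"
proof -
  assume a: "a \<in> U"
  have "a * (inverse a - 1) = - (a - 1)" using U_nonzero[OF a] by (simp add: algebra_simps)
  then have "a * (inverse a - 1) \<in> I (int n)" using a by (metis U_iff frac_ideal_minus)
  then show ?thesis using frac_ideal_unit_mult(1)[OF U_av[OF a]] by (simp add: U_iff)
qed

lemma U_divide: "a \<in> U \<Longrightarrow> b \<in> U \<Longrightarrow> a / b \<in> U"
  by (simp add: divide_inverse U_mult U_inverse)

lemma U_close: "a \<in> U \<Longrightarrow> a - b \<in> I j \<Longrightarrow> int n \<le> j \<Longrightarrow> b \<in> U"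
  using frac_ideal_diff[of "a - 1" "int n" "a - b"] frac_ideal_mono[of "int n" j "a - b"] by (simp add: U_iff)

text \<open>The cofactor of \<open>a - b\<close> is 1 + 1/(ab), regrouped so that the unit 2
  dominates an element of the maximal ideal.\<close>

lemma av_phi_diff:
  assumes a: "a \<in> U" and b: "b \<in> U"
  shows "av (phi a - phi b) = av (a - b)"
proof -
  have "phi a - phi b = (a - b) - (inverse a - inverse b)"
    by (simp add: phi_def)
  also have "inverse a - inverse b = - ((a - b) * inverse (a * b))"
    using inverse_diff_inverse[OF U_nonzero[OF a] U_nonzero[OF b]] by (simp add: mult_ac)
  also have "(a - b) - - ((a - b) * inverse (a * b)) = (a - b) * (2 + (inverse (a * b) - 1))"
    by (simp add: distrib_left right_diff_distrib)
  finally have "phi a - phi b = (a - b) * (2 + (inverse (a * b) - 1))" .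
  moreover have "inverse (a * b) - 1 \<in> I (int n)"
    using U_inverse[OF U_mult[OF a b]] by (simp add: U_iff)
  then have "av (2 + (inverse (a * b) - 1)) = 1"
    using av_add_less[of "inverse (a * b) - 1" 2] av_frac_ideal_n av_2 by simp
  ultimately show ?thesis by (simp add: av_mult)
qed

lemma phi_in:
  assumes "a \<in> U"
  shows "phi a \<in> I (int n)"
proof -
  have "phi (1 :: 'k) = 0" by (simp add: phi_def)
  then have "av (phi a) = av (a - 1)"
    using av_phi_diff[OF assms one_U] by simp
  then show ?thesis
    using assms by (simp only: U_iff frac_ideal_iff)
qed

lemma av_divide_right_diff:
  assumes "a \<in> U" "b \<in> U" "b' \<in> U"
  shows "av (a / b - a / b') = av (b - b')"
proof -
  have "inverse b - inverse b' = - (inverse b * (b - b') * inverse b')"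
    using assms by (intro inverse_diff_inverse U_nonzero)
  then have "a / b - a / b' = a * - (inverse b * (b - b') * inverse b')"
    by (simp add: divide_inverse flip: right_diff_distrib)
  then show ?thesis using assms by (simp add: av_mult av_inverse)
qed

lemma av_divide_left_diff: "b \<in> U \<Longrightarrow> av (a / b - a' / b) = av (a - a')"
  by (simp add: av_divide flip: diff_divide_distrib)

text \<open>\<open>R m\<close> represents \<open>U\<close> modulo \<open>\<pi>\<^sup>m O\<close>, and \<open>B m\<close> is \<open>\<pi>\<^sup>-\<^sup>m O / \<pi>\<^sup>-\<^sup>n O\<close>; both have \<open>N m\<close> elements if \<open>m \<ge> n\<close>.\<close>

definition R :: "nat \<Rightarrow> 'k set" where
  "R m = rep ` cos (int m) ` U"

definition B :: "nat \<Rightarrow> 'k set set" where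
  "B m = cos (- int n) ` I (- int m)"

definition P :: "nat \<Rightarrow> (('k \<times> 'k set) \<times> ('k \<times> 'k set)) set" where
  "P m = (R m \<times> B m) \<times> (R m \<times> B m)"

definition N :: "nat \<Rightarrow> nat" where
  "N m = q ^ (m - n)"

lemma R_subset_U: "n \<le> m \<Longrightarrow> r \<in> R m \<Longrightarrow> r \<in> U"
  unfolding R_def using U_close[OF _ rep_coset, of _ "int m"] by auto

lemma R_cong: "r \<in> R m \<Longrightarrow> r' \<in> R m \<Longrightarrow> r - r' \<in> I (int m) \<longleftrightarrow> r = r'"
  by (auto simp: R_def simp flip: coset_eq_iff)

lemma rep_coset_R: "a \<in> U \<Longrightarrow> rep (cos (int m) a) \<in> R m"
  by (simp add: R_def)

lemma card_R:
  assumes "n \<le> m"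
  shows "finite (R m)" "card (R m) = N m"
proof -
  have "bij_betw (\<lambda>C. rep (cos (int m) (1 + rep C))) (cos (int m) ` I (int n)) (R m)"
  proof (rule bij_betwI')
    fix C D assume C: "C \<in> cos (int m) ` I (int n)" and D: "D \<in> cos (int m) ` I (int n)"
    have "C = D" if "rep (cos (int m) (1 + rep C)) = rep (cos (int m) (1 + rep D))"
    proof -
      have "cos (int m) (1 + rep C) = cos (int m) (1 + rep D)" using that coset_rep by metis
      then have "cos (int m) (rep C) = cos (int m) (rep D)" unfolding coset_eq_iff by simp
      then show ?thesis using rep_in_frac_ideal(2) C D assms by (metis of_nat_mono)
    qed
    then show "(rep (cos (int m) (1 + rep C)) = rep (cos (int m) (1 + rep D))) = (C = D)" by auto
  next
    fix C assume "C \<in> cos (int m) ` I (int n)"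
    then have "rep C \<in> I (int n)" using rep_in_frac_ideal(1) assms by (metis of_nat_mono)
    then show "rep (cos (int m) (1 + rep C)) \<in> R m" by (intro rep_coset_R) (simp add: U_iff)
  next
    fix r assume "r \<in> R m"
    then obtain a where a: "a \<in> U" "r = rep (cos (int m) a)" by (auto simp: R_def)
    have "cos (int m) (1 + rep (cos (int m) (a - 1))) = cos (int m) a"
      using rep_coset'[of "int m" "a - 1"] unfolding coset_eq_iff by (simp add: algebra_simps)
    then show "\<exists>C\<in>cos (int m) ` I (int n). r = rep (cos (int m) (1 + rep C))"
      using a by (intro bexI[of _ "cos (int m) (a - 1)"]) (auto simp: U_iff)
  qed
  then have "finite (R m) \<longleftrightarrow> finite (cos (int m) ` I (int n))" "card (R m) = card (cos (int m) ` I (int n))"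
    using bij_betw_finite bij_betw_same_card by (blast, metis)
  then show "finite (R m)" "card (R m) = N m"
    using assms finite_coset[of "int n" "int m"] card_coset_eq[of "int n" "int m"]
    by (simp_all add: N_def nat_diff_distrib)
qed

lemma card_B:
  assumes "n \<le> m"
  shows "finite (B m)" "card (B m) = N m"
  using assms finite_coset[of "- int m" "- int n"] card_coset_eq[of "- int m" "- int n"]
  by (simp_all add: B_def N_def nat_diff_distrib)

lemma N_pos [simp]: "N m > 0"
  using q_gt_1 by (simp add: N_def)

lemma rep_B:
  assumes "C \<in> B m" "n \<le> m"
  shows "rep C \<in> I (- int m)" "cos (- int n) (rep C) = C"
  using assms rep_in_frac_ideal[of C "- int n" "- int m"] by (auto simp: B_def)

lemma finite_P: "n \<le> m \<Longrightarrow> finite (P m)"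
  by (simp add: P_def card_R card_B)

text \<open>The unit coordinates go outside because, once they are fixed, the phases are linear in
  the representatives of the other coordinates, and the inner sums become character sums.\<close>

lemma sum_P: "sum H (P m) = (\<Sum>b\<in>R m \<times> R m. \<Sum>S1\<in>B m. \<Sum>S2\<in>B m. H ((fst b, S1), (snd b, S2)))"
proof -
  have "sum H (P m) = (\<Sum>b1\<in>R m. \<Sum>S1\<in>B m. \<Sum>b2\<in>R m. \<Sum>S2\<in>B m. H ((b1, S1), (b2, S2)))"
    unfolding P_def by (simp add: sum.cartesian_product' case_prod_beta)
  also have "\<dots> = (\<Sum>b1\<in>R m. \<Sum>b2\<in>R m. \<Sum>S1\<in>B m. \<Sum>S2\<in>B m. H ((b1, S1), (b2, S2)))"
    by (intro sum.cong refl sum.swap)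
  also have "\<dots> = (\<Sum>b\<in>R m \<times> R m. \<Sum>S1\<in>B m. \<Sum>S2\<in>B m. H ((fst b, S1), (snd b, S2)))"
    by (simp add: sum.cartesian_product' case_prod_beta)
  finally show ?thesis .
qed

lemma sum_psi_B:
  assumes "n \<le> m" "x \<in> I (int n)"
  shows "(\<Sum>S\<in>B m. \<Psi> (x * rep S)) = (if x \<in> I (int m) then of_nat (N m) else 0)"
  using sum_psi[of "- int m" "- int n" x] assms by (simp add: B_def N_def nat_diff_distrib)

text \<open>Abstract form of the changes of variables behind the two orthogonality relations.
  \<open>I (int n)\<close> has as many classes modulo \<open>I (int m)\<close> as \<open>R m\<close>
  has elements, so injectivity makes \<open>(\<tau>1, \<tau>2)\<close> a bijection onto all pairs of
  classes.\<close>

definition separating :: "nat \<Rightarrow> ('k \<times> 'k \<Rightarrow> 'k) \<Rightarrow> ('k \<times> 'k \<Rightarrow> 'k) \<Rightarrow> bool" where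
  "separating m \<tau>1 \<tau>2 \<longleftrightarrow> (\<forall>b\<in>R m \<times> R m. \<tau>1 b \<in> I (int n) \<and> \<tau>2 b \<in> I (int n)) \<and>
     (\<forall>b\<in>R m \<times> R m. \<forall>b'\<in>R m \<times> R m. \<tau>1 b - \<tau>1 b' \<in> I (int m) \<and> \<tau>2 b - \<tau>2 b' \<in> I (int m) \<longrightarrow> b = b')"

lemma sum_psi_separating:
  assumes m: "n \<le> m" and sep: "separating m \<tau>1 \<tau>2" and d: "d1 \<in> I (- int m)" "d2 \<in> I (- int m)"
  shows "(\<Sum>b\<in>R m \<times> R m. \<Psi> (\<tau>1 b * d1 + \<tau>2 b * d2)) =
    (if d1 \<in> I (- int n) \<and> d2 \<in> I (- int n) then of_nat (N m ^ 2) else 0)"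
proof -
  let ?Q = "cos (int m) ` I (int n)"
  let ?\<sigma> = "\<lambda>b. (cos (int m) (\<tau>1 b), cos (int m) (\<tau>2 b))"
  have nm: "int n \<le> int m" using m by simp
  have sub: "?\<sigma> ` (R m \<times> R m) \<subseteq> ?Q \<times> ?Q"
    using sep by (auto simp: separating_def intro!: imageI)
  have inj: "inj_on ?\<sigma> (R m \<times> R m)"
    using sep unfolding separating_def inj_on_def by (simp add: coset_eq_iff)
  have "card (?\<sigma> ` (R m \<times> R m)) = card (?Q \<times> ?Q)"
    unfolding card_image[OF inj] card_cartesian_product
    using card_R[OF m] card_coset_eq[OF nm] m by (simp add: N_def nat_diff_distrib)
  then have bij: "bij_betw ?\<sigma> (R m \<times> R m) (?Q \<times> ?Q)"
    using inj sub finite_coset[OF nm] by (simp add: bij_betw_def card_subset_eq)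
  define G where "G X = \<Psi> (d1 * rep (fst X)) * \<Psi> (d2 * rep (snd X))" for X
  have "\<Psi> (\<tau>1 b * d1 + \<tau>2 b * d2) = G (?\<sigma> b)" for b
  proof -
    have *: "\<Psi> (x * d) = \<Psi> (d * rep (cos (int m) x))" if "d \<in> I (- int m)" for x d
    proof (rule psi_cong)
      have "(x - rep (cos (int m) x)) * d \<in> I 0"
        by (rule frac_ideal_mult_0[OF rep_coset that])
      then show "x * d - d * rep (cos (int m) x) \<in> I 0"
        by (simp only: left_diff_distrib mult.commute[of d])
    qed
    show ?thesis
      using *[OF d(1), of "\<tau>1 b"] *[OF d(2), of "\<tau>2 b"] by (simp add: psi_add G_def)
  qed
  then have "(\<Sum>b\<in>R m \<times> R m. \<Psi> (\<tau>1 b * d1 + \<tau>2 b * d2)) = (\<Sum>b\<in>R m \<times> R m. G (?\<sigma> b))"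
    by simp
  also have "\<dots> = sum G (?Q \<times> ?Q)"
    by (rule sum.reindex_bij_betw[OF bij])
  also have "\<dots> = (\<Sum>X1\<in>?Q. \<Sum>X2\<in>?Q. \<Psi> (d1 * rep X1) * \<Psi> (d2 * rep X2))"
    by (simp add: G_def sum.cartesian_product')
  also have "\<dots> = (\<Sum>X\<in>?Q. \<Psi> (d1 * rep X)) * (\<Sum>X\<in>?Q. \<Psi> (d2 * rep X))"
    by (rule sum_product[symmetric])
  finally show ?thesis
    using sum_psi[OF nm d(1)] sum_psi[OF nm d(2)] m
    by (simp add: N_def nat_diff_distrib power2_eq_square)
qed

text \<open>Common scheme of both orthogonality relations. The inner sums vanish unless
  \<open>c\<close>, which will be equality of the unit coordinates of two rows or columns. Under
  \<open>c\<close> the remaining phase is linear in \<open>d1\<close> and \<open>d2\<close>, the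
  differences of their other coordinates, and the sum over units detects whether these are trivial.
  Each stage contributes a factor \<open>N m ^ 2\<close>.\<close>

lemma sum_P_psi:
  assumes m: "n \<le> m" and sep: "separating m \<tau>1 \<tau>2" and d: "d1 \<in> I (- int m)" "d2 \<in> I (- int m)"
    and x: "\<And>b. b \<in> R m \<times> R m \<Longrightarrow> x1 b \<in> I (int n) \<and> x2 b \<in> I (int n)"
    and c: "\<And>b. b \<in> R m \<times> R m \<Longrightarrow> x1 b \<in> I (int m) \<and> x2 b \<in> I (int m) \<longleftrightarrow> c"
    and D: "\<And>b. b \<in> R m \<times> R m \<Longrightarrow> c \<Longrightarrow> D b = \<tau>1 b * d1 + \<tau>2 b * d2"
    and H: "\<And>b S1 S2. b \<in> R m \<times> R m \<Longrightarrow> H ((fst b, S1), (snd b, S2)) = \<Psi> (D b + (x1 b * rep S1 + x2 b * rep S2))"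
  shows "sum H (P m) = (if c \<and> d1 \<in> I (- int n) \<and> d2 \<in> I (- int n) then of_nat (N m ^ 4) else 0)"
proof -
  have "sum H (P m) = (\<Sum>b\<in>R m \<times> R m. \<Sum>S1\<in>B m. \<Sum>S2\<in>B m. \<Psi> (D b) * (\<Psi> (x1 b * rep S1) * \<Psi> (x2 b * rep S2)))"
    unfolding sum_P by (intro sum.cong refl) (simp add: H psi_add)
  also have "\<dots> = (\<Sum>b\<in>R m \<times> R m. \<Psi> (D b) * ((\<Sum>S1\<in>B m. \<Psi> (x1 b * rep S1)) * (\<Sum>S2\<in>B m. \<Psi> (x2 b * rep S2))))"
    by (intro sum.cong refl, subst sum_product) (simp only: sum_distrib_left)
  also have "\<dots> = (\<Sum>b\<in>R m \<times> R m. \<Psi> (D b) * (if c then of_nat (N m ^ 2) else 0))"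
    using x c by (intro sum.cong refl) (simp add: sum_psi_B[OF m] power2_eq_square, metis)
  also have "\<dots> = (if c then of_nat (N m ^ 2) * (\<Sum>b\<in>R m \<times> R m. \<Psi> (\<tau>1 b * d1 + \<tau>2 b * d2)) else 0)"
    using D by (auto simp: sum_distrib_left mult.commute intro!: sum.cong)
  also have "\<dots> = (if c \<and> d1 \<in> I (- int n) \<and> d2 \<in> I (- int n) then of_nat (N m ^ 4) else 0)"
    unfolding sum_psi_separating[OF m sep d] by (simp flip: power_add)
  finally show ?thesis .
qed

text \<open>The first argument is the point \<open>h\<close> of evaluation, the second the variable
  \<open>p\<close> of integration. In each factor, \<open>p\<close> times the inverse of
  \<open>h\<close> is \<open>a / b\<close> together with the class of \<open>b * (t - s)\<close>;
  this is where the factors \<open>b2\<close> and \<open>b1\<close> come from.\<close>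

definition K :: "('k \<times> 'k set) \<times> ('k \<times> 'k set) \<Rightarrow> ('k \<times> 'k set) \<times> ('k \<times> 'k set) \<Rightarrow> complex" where
  "K = (\<lambda>((b1, S1), (b2, S2)) ((a1, T1), (a2, T2)).
     \<Psi> (phi (a1 / b1) * b2 * (rep T2 - rep S2) - phi (a2 / b2) * b1 * (rep T1 - rep S1)))"

section \<open>Isometry estimates for the phases and orthogonality of the kernel\<close>

lemma phi_mult_in: "a \<in> U \<Longrightarrow> b \<in> U \<Longrightarrow> b' \<in> U \<Longrightarrow> phi (a / b) * b' \<in> I (int n)"
  by (simp add: frac_ideal_unit_mult phi_in U_divide)

lemma av_phi_mult_diff_left:
  assumes "a \<in> U" "a' \<in> U" "b \<in> U" "b' \<in> U"
  shows "av (phi (a / b) * b' - phi (a' / b) * b') = av (a - a')"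
proof -
  have "av (phi (a / b) * b' - phi (a' / b) * b') = av (phi (a / b) - phi (a' / b))"
    using assms by (simp add: av_mult flip: left_diff_distrib)
  also have "\<dots> = av (a - a')"
    using assms by (simp add: av_phi_diff U_divide av_divide_left_diff)
  finally show ?thesis .
qed

text \<open>With \<open>c\<close> held fixed the difference would have absolute value exactly
  \<open>av (b - b')\<close>. The correction for moving \<open>c\<close> has the coefficient
  \<open>phi (a / b')\<close>, which lies in \<open>I 1\<close> because \<open>n \<ge> 1\<close> and
  so gains a factor \<open>av \<pi>\<close>.\<close>

lemma av_le_phi_mult_diff:
  assumes "a \<in> U" "b \<in> U" "b' \<in> U" "c \<in> U" "c' \<in> U"
  shows "av (b - b') \<le> max (av (phi (a / b) * c - phi (a / b') * c')) (av \<pi> * av (c - c'))"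
proof -
  have "av (b - b') = av ((phi (a / b) - phi (a / b')) * c)"
    using assms by (simp add: av_mult av_phi_diff U_divide av_divide_right_diff)
  also have "(phi (a / b) - phi (a / b')) * c
      = (phi (a / b) * c - phi (a / b') * c') - phi (a / b') * (c - c')"
    by (simp add: algebra_simps)
  also have "av \<dots> \<le> max (av (phi (a / b) * c - phi (a / b') * c')) (av (phi (a / b') * (c - c')))"
    by (rule av_diff)
  also have "av (phi (a / b') * (c - c')) \<le> av \<pi> * av (c - c')"
  proof -
    have "phi (a / b') \<in> I 1"
      using assms n_pos frac_ideal_mono[OF _ phi_in[OF U_divide], of 1] by simp
    then show ?thesis by (simp add: av_mult frac_ideal_iff mult_right_mono av_nonneg)
  qed
  finally show ?thesis by (simp add: max.mono)
qed

text \<open>Each of the two displacements is bounded by the larger of \<open>av \<pi> powi m\<close> and a proper fraction of the other one.\<close>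

lemma phi_twisted_inj:
  assumes U: "a1 \<in> U" "a2 \<in> U" "b1 \<in> U" "b2 \<in> U" "b1' \<in> U" "b2' \<in> U"
    and *: "phi (a2 / b2) * b1 - phi (a2 / b2') * b1' \<in> I j" "phi (a1 / b1) * b2 - phi (a1 / b1') * b2' \<in> I j"
  shows "b1 - b1' \<in> I j \<and> b2 - b2' \<in> I j"
proof -
  let ?x = "av (b1 - b1')" and ?y = "av (b2 - b2')" and ?w = "av \<pi>" and ?e = "av \<pi> powi j"
  have x: "?x \<le> max ?e (?w * ?y)"
    using av_le_phi_mult_diff[of a1 b1 b1' b2 b2'] U *(2) by (auto simp: frac_ideal_iff)
  have y: "?y \<le> max ?e (?w * ?x)"
    using av_le_phi_mult_diff[of a2 b2 b2' b1 b1'] U *(1) by (auto simp: frac_ideal_iff)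
  have e: "?e > 0" using av_uniformizer_pos by simp
  have less: "?w * z < z" if "z > 0" for z using that av_uniformizer_less_1 by simp
  have le: "?w * z \<le> z" if "z \<ge> 0" for z using that av_uniformizer_less_1 by (simp add: mult_left_le_one_le av_nonneg)
  have "?x \<le> ?e"
  proof (rule ccontr)
    assume "\<not> ?x \<le> ?e"
    then show False using x y e less[of ?x] le[of ?y] av_nonneg[of "b2 - b2'"] by linarith
  qed
  moreover have "?y \<le> ?e"
  proof (rule ccontr)
    assume "\<not> ?y \<le> ?e"
    then show False using x y e less[of ?y] le[of ?x] av_nonneg[of "b1 - b1'"] by linarith
  qed
  ultimately show ?thesis by (simp add: frac_ideal_iff)
qed

text \<open>For two columns with equal unit coordinates these are the coefficients of the
  differences of \<open>rep T1\<close> and \<open>rep T2\<close>, as functions of the units of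
  \<open>h\<close>. The two coordinates are coupled, hence the appeal to
  \<open>phi_twisted_inj\<close>.\<close>

lemma separating_target:
  assumes m: "n \<le> m" and a: "a1 \<in> U" "a2 \<in> U"
  shows "separating m (\<lambda>b. - (phi (a2 / snd b) * fst b)) (\<lambda>b. phi (a1 / fst b) * snd b)"
  unfolding separating_def
proof (intro conjI ballI impI)
  fix b b' assume "b \<in> R m \<times> R m" "b' \<in> R m \<times> R m"
    and *: "- (phi (a2 / snd b) * fst b) - - (phi (a2 / snd b') * fst b') \<in> I (int m) \<and>
      phi (a1 / fst b) * snd b - phi (a1 / fst b') * snd b' \<in> I (int m)"
  then have R: "fst b \<in> R m" "snd b \<in> R m" "fst b' \<in> R m" "snd b' \<in> R m" by auto
  have "phi (a2 / snd b) * fst b - phi (a2 / snd b') * fst b' \<in> I (int m)"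
    using * frac_ideal_minus_commute by simp
  then have "fst b - fst b' \<in> I (int m) \<and> snd b - snd b' \<in> I (int m)"
    using * R_subset_U[OF m] R a by (intro phi_twisted_inj[of a1 a2]) auto
  then show "b = b'" using R by (simp add: R_cong prod_eq_iff)
qed (use R_subset_U[OF m] a in \<open>auto simp: phi_mult_in\<close>)

text \<open>The counterpart for rows: the multipliers \<open>b1\<close> and \<open>b2\<close> are
  now constant, the coordinates decouple, and the isometry of \<open>phi\<close> suffices.\<close>

lemma separating_source:
  assumes m: "n \<le> m" and b: "b1 \<in> U" "b2 \<in> U"
  shows "separating m (\<lambda>a. phi (snd a / b2) * b1) (\<lambda>a. - (phi (fst a / b1) * b2))"
  unfolding separating_def
proof (intro conjI ballI impI)
  fix a a' assume "a \<in> R m \<times> R m" "a' \<in> R m \<times> R m"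
    and *: "phi (snd a / b2) * b1 - phi (snd a' / b2) * b1 \<in> I (int m) \<and>
      - (phi (fst a / b1) * b2) - - (phi (fst a' / b1) * b2) \<in> I (int m)"
  then have R: "fst a \<in> R m" "snd a \<in> R m" "fst a' \<in> R m" "snd a' \<in> R m" by auto
  have "phi (fst a / b1) * b2 - phi (fst a' / b1) * b2 \<in> I (int m)"
    using * frac_ideal_minus_commute by simp
  then have "fst a - fst a' \<in> I (int m) \<and> snd a - snd a' \<in> I (int m)"
    using * R_subset_U[OF m] R b by (simp add: frac_ideal_iff av_phi_mult_diff_left)
  then show "a = a'" using R by (simp add: R_cong prod_eq_iff)
qed (use R_subset_U[OF m] b in \<open>auto simp: phi_mult_in\<close>)

lemma rep_B_diff:
  assumes "n \<le> m" "C \<in> B m" "C' \<in> B m"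
  shows "rep C - rep C' \<in> I (- int m)" "rep C - rep C' \<in> I (- int n) \<longleftrightarrow> C = C'"
  using rep_B[OF assms(2,1)] rep_B[OF assms(3,1)] coset_eq_iff[of "- int n" "rep C" "rep C'"]
  by (auto simp: frac_ideal_diff)

text \<open>The coefficients of \<open>rep S1\<close> and \<open>rep S2\<close> lie in
  \<open>I (int m)\<close> exactly when the units of \<open>p\<close> and \<open>p'\<close> agree,
  by \<open>av_phi_mult_diff_left\<close>; the twisted map of \<open>separating_target\<close> then
  compares the remaining coordinates.\<close>

lemma K_orthogonal_columns:
  assumes m: "n \<le> m" and p: "p \<in> P m" "p' \<in> P m"
  shows "(\<Sum>h\<in>P m. K h p * cnj (K h p')) = (if p = p' then of_nat (N m ^ 4) else 0)"
proof -
  obtain a1 T1 a2 T2 where p': "p = ((a1, T1), (a2, T2))" "a1 \<in> R m" "a2 \<in> R m" "T1 \<in> B m" "T2 \<in> B m"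
    using p by (auto simp: P_def)
  obtain a1' T1' a2' T2' where p'': "p' = ((a1', T1'), (a2', T2'))" "a1' \<in> R m" "a2' \<in> R m" "T1' \<in> B m" "T2' \<in> B m"
    using p by (auto simp: P_def)
  note U = p'(2,3)[THEN R_subset_U[OF m]] p''(2,3)[THEN R_subset_U[OF m]]
  have RU: "fst b \<in> U" "snd b \<in> U" if "b \<in> R m \<times> R m" for b using that R_subset_U[OF m] by auto
  have "(\<Sum>h\<in>P m. K h p * cnj (K h p'))
    = (if (a1 = a1' \<and> a2 = a2') \<and> rep T1 - rep T1' \<in> I (- int n) \<and> rep T2 - rep T2' \<in> I (- int n)
       then of_nat (N m ^ 4) else 0)"
  proof (rule sum_P_psi[where ?x1.0 = "\<lambda>b. phi (a2 / snd b) * fst b - phi (a2' / snd b) * fst b"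
          and ?x2.0 = "\<lambda>b. - (phi (a1 / fst b) * snd b - phi (a1' / fst b) * snd b)"
          and D = "\<lambda>b. (phi (a1 / fst b) * snd b * rep T2 - phi (a2 / snd b) * fst b * rep T1)
            - (phi (a1' / fst b) * snd b * rep T2' - phi (a2' / snd b) * fst b * rep T1')", OF m separating_target[OF m U(1,2)]])
    show "K ((fst b, S1), (snd b, S2)) p * cnj (K ((fst b, S1), (snd b, S2)) p')
      = \<Psi> ((phi (a1 / fst b) * snd b * rep T2 - phi (a2 / snd b) * fst b * rep T1)
            - (phi (a1' / fst b) * snd b * rep T2' - phi (a2' / snd b) * fst b * rep T1')
          + ((phi (a2 / snd b) * fst b - phi (a2' / snd b) * fst b) * rep S1
            + - (phi (a1 / fst b) * snd b - phi (a1' / fst b) * snd b) * rep S2))" for b S1 S2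
      unfolding p'(1) p''(1) K_def by (simp add: algebra_simps flip: psi_diff)
    show "rep T1 - rep T1' \<in> I (- int m)" "rep T2 - rep T2' \<in> I (- int m)"
      using rep_B_diff(1)[OF m] p' p'' by auto
    fix b assume b: "b \<in> R m \<times> R m"
    show "phi (a2 / snd b) * fst b - phi (a2' / snd b) * fst b \<in> I (int n)
      \<and> - (phi (a1 / fst b) * snd b - phi (a1' / fst b) * snd b) \<in> I (int n)"
      using RU[OF b] U by (simp add: frac_ideal_diff phi_mult_in del: minus_diff_eq)
    have "phi (a2 / snd b) * fst b - phi (a2' / snd b) * fst b \<in> I (int m) \<longleftrightarrow> a2 - a2' \<in> I (int m)"
      "phi (a1 / fst b) * snd b - phi (a1' / fst b) * snd b \<in> I (int m) \<longleftrightarrow> a1 - a1' \<in> I (int m)"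
      using RU[OF b] U by (simp_all add: frac_ideal_iff av_phi_mult_diff_left)
    then show "(phi (a2 / snd b) * fst b - phi (a2' / snd b) * fst b \<in> I (int m)
      \<and> - (phi (a1 / fst b) * snd b - phi (a1' / fst b) * snd b) \<in> I (int m)) = (a1 = a1' \<and> a2 = a2')"
      using p' p'' by (auto simp: R_cong simp del: minus_diff_eq)
    assume "a1 = a1' \<and> a2 = a2'"
    then show "(phi (a1 / fst b) * snd b * rep T2 - phi (a2 / snd b) * fst b * rep T1)
            - (phi (a1' / fst b) * snd b * rep T2' - phi (a2' / snd b) * fst b * rep T1')
       = - (phi (a2 / snd b) * fst b) * (rep T1 - rep T1') + phi (a1 / fst b) * snd b * (rep T2 - rep T2')"
      by (simp add: algebra_simps)
  qed
  then show ?thesis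
    using p' p'' by (simp add: rep_B_diff(2)[OF m])
qed

text \<open>The roles are exchanged: \<open>phi_twisted_inj\<close> recognizes equal units, and the
  decoupled map of \<open>separating_source\<close> handles the remaining sum. \<open>F_surj\<close>
  inverts the matrix with this relation.\<close>

lemma K_orthogonal_rows:
  assumes m: "n \<le> m" and h: "h \<in> P m" "h' \<in> P m"
  shows "(\<Sum>p\<in>P m. K h p * cnj (K h' p)) = (if h = h' then of_nat (N m ^ 4) else 0)"
proof -
  obtain b1 S1 b2 S2 where h': "h = ((b1, S1), (b2, S2))" "b1 \<in> R m" "b2 \<in> R m" "S1 \<in> B m" "S2 \<in> B m"
    using h by (auto simp: P_def)
  obtain b1' S1' b2' S2' where h'': "h' = ((b1', S1'), (b2', S2'))" "b1' \<in> R m" "b2' \<in> R m" "S1' \<in> B m" "S2' \<in> B m"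
    using h by (auto simp: P_def)
  note U = h'(2,3)[THEN R_subset_U[OF m]] h''(2,3)[THEN R_subset_U[OF m]]
  have RU: "fst a \<in> U" "snd a \<in> U" if "a \<in> R m \<times> R m" for a using that R_subset_U[OF m] by auto
  have "(\<Sum>p\<in>P m. K h p * cnj (K h' p))
    = (if (b1 = b1' \<and> b2 = b2') \<and> rep S1 - rep S1' \<in> I (- int n) \<and> rep S2 - rep S2' \<in> I (- int n)
       then of_nat (N m ^ 4) else 0)"
  proof (rule sum_P_psi[where ?x1.0 = "\<lambda>a. - (phi (snd a / b2) * b1 - phi (snd a / b2') * b1')"
          and ?x2.0 = "\<lambda>a. phi (fst a / b1) * b2 - phi (fst a / b1') * b2'"
          and D = "\<lambda>a. (phi (snd a / b2) * b1 * rep S1 - phi (fst a / b1) * b2 * rep S2)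
            - (phi (snd a / b2') * b1' * rep S1' - phi (fst a / b1') * b2' * rep S2')", OF m separating_source[OF m U(1,2)]])
    show "K h ((fst a, T1), (snd a, T2)) * cnj (K h' ((fst a, T1), (snd a, T2)))
      = \<Psi> ((phi (snd a / b2) * b1 * rep S1 - phi (fst a / b1) * b2 * rep S2)
            - (phi (snd a / b2') * b1' * rep S1' - phi (fst a / b1') * b2' * rep S2')
          + (- (phi (snd a / b2) * b1 - phi (snd a / b2') * b1') * rep T1
            + (phi (fst a / b1) * b2 - phi (fst a / b1') * b2') * rep T2))" for a T1 T2
      unfolding h'(1) h''(1) K_def by (simp add: algebra_simps flip: psi_diff)
    show "rep S1 - rep S1' \<in> I (- int m)" "rep S2 - rep S2' \<in> I (- int m)"
      using rep_B_diff(1)[OF m] h' h'' by auto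
    fix a assume a: "a \<in> R m \<times> R m"
    show "- (phi (snd a / b2) * b1 - phi (snd a / b2') * b1') \<in> I (int n)
      \<and> phi (fst a / b1) * b2 - phi (fst a / b1') * b2' \<in> I (int n)"
      using RU[OF a] U by (simp add: frac_ideal_diff phi_mult_in del: minus_diff_eq)
    show "(- (phi (snd a / b2) * b1 - phi (snd a / b2') * b1') \<in> I (int m)
      \<and> phi (fst a / b1) * b2 - phi (fst a / b1') * b2' \<in> I (int m)) = (b1 = b1' \<and> b2 = b2')"
    proof
      assume "- (phi (snd a / b2) * b1 - phi (snd a / b2') * b1') \<in> I (int m)
        \<and> phi (fst a / b1) * b2 - phi (fst a / b1') * b2' \<in> I (int m)"
      then have "b1 - b1' \<in> I (int m) \<and> b2 - b2' \<in> I (int m)"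
        using RU[OF a] U by (intro phi_twisted_inj[of "fst a" "snd a"]) (auto simp del: minus_diff_eq)
      then show "b1 = b1' \<and> b2 = b2'" using h' h'' by (simp add: R_cong)
    qed auto
    assume "b1 = b1' \<and> b2 = b2'"
    then show "(phi (snd a / b2) * b1 * rep S1 - phi (fst a / b1) * b2 * rep S2)
            - (phi (snd a / b2') * b1' * rep S1' - phi (fst a / b1') * b2' * rep S2')
       = phi (snd a / b2) * b1 * (rep S1 - rep S1') + - (phi (fst a / b1) * b2) * (rep S2 - rep S2')"
      by (simp add: algebra_simps)
  qed
  then show ?thesis
    using h' h'' by (simp add: rep_B_diff(2)[OF m])
qed

end

context unitary_setting
begin

section \<open>Locally constant functions of finite level\<close>

abbreviation X2 :: "(('k \<times> 'k set) \<times> ('k \<times> 'k set)) set" where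
  "X2 \<equiv> (U \<times> \<Gamma>) \<times> (U \<times> \<Gamma>)"

abbreviation M :: "(('k \<times> 'k set) \<times> ('k \<times> 'k set)) measure" where
  "M \<equiv> XX_measure av \<pi> \<mu> n"

lemma Gam_rel_Image: "Gam_rel av \<pi> n `` {t} = cos (- int n) t"
  by (auto simp: Gam_rel_def coset_def)

lemma Gamma_eq: "\<Gamma> = range (cos (- int n))"
  by (auto simp: Gam_def quotient_def Gam_rel_Image)

lemma coset_in_Gamma [simp]: "cos (- int n) t \<in> \<Gamma>"
  by (simp add: Gamma_eq)

lemma coset_rep_Gamma: "T \<in> \<Gamma> \<Longrightarrow> cos (- int n) (rep T) = T"
  by (auto simp: Gamma_eq)

lemma B_subset_Gamma: "T \<in> B m \<Longrightarrow> T \<in> \<Gamma>"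
  by (auto simp: B_def Gamma_eq)

lemma B_mono: "m \<le> m' \<Longrightarrow> T \<in> B m \<Longrightarrow> T \<in> B m'"
  using frac_ideal_mono[of "- int m'" "- int m"] by (auto simp: B_def)

lemma coset_in_B_iff: "n \<le> m \<Longrightarrow> cos (- int n) t \<in> B m \<longleftrightarrow> t \<in> I (- int m)"
  using rep_B(1)[of "cos (- int n) t" m] frac_ideal_mono[OF _ rep_coset[of t "- int n"], of "- int m"]
    frac_ideal_add[of "t - rep (cos (- int n) t)" "- int m" "rep (cos (- int n) t)"]
  by (auto simp: B_def)

lemma Gamma_exhaust: "T \<in> \<Gamma> \<Longrightarrow> \<exists>m\<ge>k. T \<in> B m"
proof -
  assume T: "T \<in> \<Gamma>"
  obtain m where "rep T \<in> I (- int m)" using frac_ideal_exhaust by blast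
  then have "T \<in> B m" using coset_rep_Gamma[OF T] unfolding B_def by (metis imageI)
  then show ?thesis using B_mono[of m "max m k" T] by (intro exI[of _ "max m k"]) auto
qed

lemma countable_Gamma: "countable \<Gamma>"
proof -
  have "\<Gamma> \<subseteq> (\<Union>m\<in>{n..}. B m)" using Gamma_exhaust[of _ n] by fastforce
  moreover have "countable (\<Union>m\<in>{n..}. B m)"
    by (intro countable_UN countableI_type countable_finite[OF card_B(1)]) auto
  ultimately show ?thesis using countable_subset by blast
qed

lemma U_eq_coset: "U = cos (int n) 1"
  by (auto simp: U_iff coset_def frac_ideal_minus_commute)

lemma coset_subset_U: "n \<le> m \<Longrightarrow> a \<in> U \<Longrightarrow> cos (int m) a \<subseteq> U"
  using U_close by (auto simp: coset_def)

lemma mem_coset_iff: "y \<in> cos j x \<longleftrightarrow> cos j x = cos j y"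
  unfolding coset_eq_iff by (simp add: coset_def)

lemma rep_coset_eq_iff: "rep (cos j x) = rep (cos j y) \<longleftrightarrow> cos j x = cos j y"
  by (metis coset_rep)

section \<open>Sigma-finiteness and the volume of boxes\<close>

lemma sets_Haar: "sets \<mu> = sets borel"
  using Haar by (simp add: normalized_Haar_def)

lemma space_Haar [simp]: "space \<mu> = UNIV"
  using sets_eq_imp_space_eq[OF sets_Haar] by simp

lemma coset_sets [simp]: "cos j x \<in> sets \<mu>"
  by (simp add: sets_Haar open_coset)

lemma U_sets [simp]: "U \<in> sets \<mu>"
  by (simp add: U_eq_coset)

lemma space_X [simp]: "space (X_measure av \<pi> \<mu> n) = U \<times> \<Gamma>"
  by (simp add: X_measure_def space_pair_measure space_restrict_space)

lemma space_M [simp]: "space M = X2"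
  by (simp add: XX_measure_def space_pair_measure)

lemma sigma_finite_Gamma: "sigma_finite_measure (count_space \<Gamma>)"
  by (rule sigma_finite_measure_count_space_countable[OF countable_Gamma])

lemma finite_measure_U: "finite_measure (restrict_space \<mu> U)"
proof
  show "emeasure (restrict_space \<mu> U) (space (restrict_space \<mu> U)) \<noteq> \<infinity>"
    by (simp add: space_restrict_space emeasure_restrict_space) (simp add: U_eq_coset emeasure_coset[OF Haar])
qed

lemma sigma_finite_X: "sigma_finite_measure (X_measure av \<pi> \<mu> n)"
proof -
  interpret A: finite_measure "restrict_space \<mu> U" by (rule finite_measure_U)
  interpret C: sigma_finite_measure "count_space \<Gamma>" by (rule sigma_finite_Gamma)
  interpret pair_sigma_finite "restrict_space \<mu> U" "count_space \<Gamma>" ..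
  show ?thesis unfolding X_measure_def by (rule sigma_finite_measure_axioms)
qed

definition box :: "nat \<Rightarrow> ('k \<times> 'k set) \<times> ('k \<times> 'k set) \<Rightarrow> (('k \<times> 'k set) \<times> ('k \<times> 'k set)) set" where
  "box m = (\<lambda>((a1, T1), (a2, T2)). (cos (int m) a1 \<times> {T1}) \<times> (cos (int m) a2 \<times> {T2}))"

lemma
  assumes m: "n \<le> m" and p: "p \<in> X2"
  shows box_sets: "box m p \<in> sets M"
    and emeasure_box: "emeasure M (box m p) = ennreal ((1 / real q ^ m)\<^sup>2)"
proof -
  interpret C: sigma_finite_measure "count_space \<Gamma>" by (rule sigma_finite_Gamma)
  interpret X: sigma_finite_measure "X_measure av \<pi> \<mu> n" by (rule sigma_finite_X)
  obtain a1 T1 a2 T2 where p': "p = ((a1, T1), (a2, T2))" "a1 \<in> U" "a2 \<in> U" "T1 \<in> \<Gamma>" "T2 \<in> \<Gamma>"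
    using p by auto
  have 1: "cos (int m) a \<in> sets (restrict_space \<mu> U)"
    "emeasure (restrict_space \<mu> U) (cos (int m) a) = ennreal (1 / real q ^ m)" if "a \<in> U" for a
    using coset_subset_U[OF m that] by (auto simp: sets_restrict_space_iff emeasure_restrict_space emeasure_coset[OF Haar])
  have 2: "cos (int m) a \<times> {T} \<in> sets (X_measure av \<pi> \<mu> n)"
    "emeasure (X_measure av \<pi> \<mu> n) (cos (int m) a \<times> {T}) = ennreal (1 / real q ^ m)"
    if "a \<in> U" "T \<in> \<Gamma>" for a T
    using 1[OF that(1)] that(2) unfolding X_measure_def
    by (auto simp: C.emeasure_pair_measure_Times)
  show "box m p \<in> sets M"
    unfolding box_def p'(1) XX_measure_def using 2 p' by auto
  show "emeasure M (box m p) = ennreal ((1 / real q ^ m)\<^sup>2)"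
    unfolding box_def p'(1) XX_measure_def using 2 p'
    by (simp add: X.emeasure_pair_measure_Times power2_eq_square flip: ennreal_mult)
qed

text \<open>Rounds the unit coordinates to \<open>R m\<close>. The boxes of level \<open>m\<close>
  are the fibres of this map, and it describes functions of level \<open>m\<close> without reference
  to topology.\<close>

definition snap :: "nat \<Rightarrow> ('k \<times> 'k set) \<times> ('k \<times> 'k set) \<Rightarrow> ('k \<times> 'k set) \<times> ('k \<times> 'k set)" where
  "snap m = (\<lambda>((a1, T1), (a2, T2)). ((rep (cos (int m) a1), T1), (rep (cos (int m) a2), T2)))"

definition grid :: "nat \<Rightarrow> (('k \<times> 'k set) \<times> ('k \<times> 'k set)) set" where
  "grid m = (R m \<times> \<Gamma>) \<times> (R m \<times> \<Gamma>)"

lemma snap_grid: "x \<in> X2 \<Longrightarrow> snap m x \<in> grid m"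
  by (auto simp: snap_def grid_def rep_coset_R)

lemma snap_P: "x \<in> X2 \<Longrightarrow> snap m x \<in> P m \<longleftrightarrow> snd (fst x) \<in> B m \<and> snd (snd x) \<in> B m"
  by (auto simp: snap_def P_def rep_coset_R)

lemma grid_subset: "n \<le> m \<Longrightarrow> grid m \<subseteq> X2"
  using R_subset_U by (auto simp: grid_def)

lemma P_subset: "n \<le> m \<Longrightarrow> P m \<subseteq> X2" "P m \<subseteq> grid m"
  using R_subset_U B_subset_Gamma by (auto simp: P_def grid_def)

lemma mem_box_iff: "p \<in> grid m \<Longrightarrow> x \<in> box m p \<longleftrightarrow> snap m x = p"
proof -
  have *: "y \<in> cos (int m) r \<longleftrightarrow> rep (cos (int m) y) = r" if r: "r \<in> R m" for y r
  proof -
    obtain a where a: "r = rep (cos (int m) a)" using r by (auto simp: R_def)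
    show ?thesis unfolding a rep_coset_eq_iff mem_coset_iff by auto
  qed
  assume "p \<in> grid m"
  then show ?thesis
    by (cases p, cases x) (auto simp: box_def snap_def grid_def *)
qed

lemma countable_grid: "n \<le> m \<Longrightarrow> countable (grid m)"
  unfolding grid_def by (intro countable_SIGMA countable_finite[OF card_R(1)] countable_Gamma) auto

text \<open>Functions of level \<open>m\<close>; values outside \<open>X2\<close> are unconstrained.\<close>

definition V :: "nat \<Rightarrow> (('k \<times> 'k set) \<times> ('k \<times> 'k set) \<Rightarrow> 'b::zero) set" where
  "V m = {f. (\<forall>x\<in>X2. \<forall>y\<in>X2. snap m y = snap m x \<longrightarrow> f y = f x) \<and>
    (\<forall>x\<in>X2. f x \<noteq> 0 \<longrightarrow> snap m x \<in> P m)}"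

lemma snap_in_X2: "n \<le> m \<Longrightarrow> x \<in> X2 \<Longrightarrow> snap m x \<in> X2"
  using snap_grid grid_subset by blast

lemma snap_snap: "m \<le> m' \<Longrightarrow> snap m (snap m' x) = snap m x"
  using frac_ideal_mono[of "int m" "int m'", OF _ rep_coset']
  by (simp add: snap_def case_prod_beta rep_coset_eq_iff coset_eq_iff)

section \<open>Rules and integrals for functions of level m\<close>

lemma VI:
  assumes "\<And>x y. x \<in> X2 \<Longrightarrow> y \<in> X2 \<Longrightarrow> snap m y = snap m x \<Longrightarrow> f y = f x"
    and "\<And>x. x \<in> X2 \<Longrightarrow> f x \<noteq> 0 \<Longrightarrow> snap m x \<in> P m"
  shows "f \<in> V m"
  unfolding V_def using assms by (intro CollectI conjI ballI impI)

lemma V_eq: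
  assumes "f \<in> V m" "x \<in> X2" "y \<in> X2" "snap m y = snap m x"
  shows "f y = f x"
  by (rule assms(1)[unfolded V_def, THEN CollectD, THEN conjunct1, rule_format, OF assms(2-4)])

lemma V_support:
  assumes "f \<in> V m" "x \<in> X2" "f x \<noteq> 0"
  shows "snap m x \<in> P m"
  by (rule assms(1)[unfolded V_def, THEN CollectD, THEN conjunct2, rule_format, OF assms(2,3)])

lemma V_snap:
  assumes "f \<in> V m" "n \<le> m" "x \<in> X2"
  shows "f (snap m x) = f x"
  by (rule V_eq[OF assms(1,3) snap_in_X2[OF assms(2,3)]]) (simp add: snap_snap)

lemma V_zero: "f \<in> V m \<Longrightarrow> x \<in> X2 \<Longrightarrow> snap m x \<notin> P m \<Longrightarrow> f x = 0"
  by (rule ccontr) (erule notE, rule V_support)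

lemma V_cong:
  assumes "f \<in> V m" "\<And>x. x \<in> X2 \<Longrightarrow> g x = f x"
  shows "g \<in> V m"
proof (rule VI)
  fix x y assume "x \<in> X2" "y \<in> X2" "snap m y = snap m x"
  then show "g y = g x" using V_eq[OF assms(1), of x y] assms(2) by simp
next
  fix x assume "x \<in> X2" "g x \<noteq> 0"
  then show "snap m x \<in> P m" using V_support[OF assms(1), of x] assms(2) by simp
qed

lemma V_mono:
  assumes "n \<le> m" "m \<le> m'" "f \<in> V m"
  shows "f \<in> V m'"
proof (rule VI)
  fix x y assume xy: "x \<in> X2" "y \<in> X2" "snap m' y = snap m' x"
  then have "snap m y = snap m x" using snap_snap[OF assms(2)] by metis
  then show "f y = f x" by (rule V_eq[OF assms(3) xy(1,2)])
next
  fix x assume x: "x \<in> X2" "f x \<noteq> 0"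
  then have "snap m x \<in> P m" by (rule V_support[OF assms(3)])
  then show "snap m' x \<in> P m'" using x B_mono[OF assms(2)] by (simp add: snap_P)
qed

lemma V_map:
  assumes "f \<in> V m" "g 0 = 0"
  shows "(\<lambda>x. g (f x)) \<in> V m"
proof (rule VI)
  fix x y assume "x \<in> X2" "y \<in> X2" "snap m y = snap m x"
  then show "g (f y) = g (f x)" using V_eq[OF assms(1), of x y] by simp
next
  fix x assume "x \<in> X2" "g (f x) \<noteq> 0"
  then show "snap m x \<in> P m" using V_support[OF assms(1), of x] assms(2) by fastforce
qed

lemma V_add:
  fixes f g :: "_ \<Rightarrow> 'b::monoid_add"
  assumes "f \<in> V m" "g \<in> V m"
  shows "(\<lambda>x. f x + g x) \<in> V m"
proof (rule VI)
  fix x y assume "x \<in> X2" "y \<in> X2" "snap m y = snap m x"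
  then show "f y + g y = f x + g x" using V_eq[OF assms(1), of x y] V_eq[OF assms(2), of x y] by simp
next
  fix x assume "x \<in> X2" "f x + g x \<noteq> 0"
  then show "snap m x \<in> P m" using V_support[OF assms(1), of x] V_support[OF assms(2), of x] by fastforce
qed

lemma V_decompose:
  fixes f :: "_ \<Rightarrow> 'b::real_vector"
  assumes "f \<in> V m" "n \<le> m" "x \<in> X2"
  shows "f x = (\<Sum>p\<in>P m. indicator (box m p) x *\<^sub>R f p)"
proof -
  have "(\<Sum>p\<in>P m. indicator (box m p) x *\<^sub>R f p) = (\<Sum>p\<in>P m. if p = snap m x then f p else 0)"
  proof (rule sum.cong[OF refl])
    fix p assume "p \<in> P m"
    then have "x \<in> box m p \<longleftrightarrow> snap m x = p" by (intro mem_box_iff subsetD[OF P_subset(2)])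
    then show "indicator (box m p) x *\<^sub>R f p = (if p = snap m x then f p else 0)"
      by (simp add: indicator_def)
  qed
  also have "\<dots> = f x"
    using V_snap[OF assms] V_zero[OF assms(1,3)] finite_P[OF assms(2)] by auto
  finally show ?thesis by simp
qed

text \<open>A function of level \<open>m\<close> is a finite combination of indicators of boxes, all
  of volume q^(-2m). The general range type covers \<open>f\<close>, its squared modulus and real
  indicators alike.\<close>

lemma integral_V:
  fixes f :: "_ \<Rightarrow> 'b::{banach, second_countable_topology}"
  assumes "f \<in> V m" "n \<le> m"
  shows "integrable M f \<and> integral\<^sup>L M f = (1 / real q ^ m)\<^sup>2 *\<^sub>R sum f (P m)"
proof -
  have ind: "integrable M (indicator (box m p) :: _ \<Rightarrow> real)" "integral\<^sup>L M (indicator (box m p)) = (1 / real q ^ m)\<^sup>2"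
    if "p \<in> P m" for p
  proof -
    have "p \<in> X2" using that P_subset assms(2) by blast
    note b = box_sets[OF assms(2) this] emeasure_box[OF assms(2) this]
    show "integrable M (indicator (box m p) :: _ \<Rightarrow> real)"
      by (rule integrable_real_indicator) (use b in auto)
    show "integral\<^sup>L M (indicator (box m p)) = (1 / real q ^ m)\<^sup>2"
      using b sets.sets_into_space[OF b(1)] by (simp add: measure_def Int_absorb2)
  qed
  have eq: "f x = (\<Sum>p\<in>P m. indicator (box m p) x *\<^sub>R f p)" if "x \<in> space M" for x
    using V_decompose[OF assms] that by simp
  have "integrable M (\<lambda>x. \<Sum>p\<in>P m. indicator (box m p) x *\<^sub>R f p)"
    by (intro Bochner_Integration.integrable_sum integrable_scaleR_left ind)
  then have "integrable M f"
    by (subst Bochner_Integration.integrable_cong[OF refl eq])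
  moreover have "integral\<^sup>L M f = (\<integral>x. (\<Sum>p\<in>P m. indicator (box m p) x *\<^sub>R f p) \<partial>M)"
    by (rule Bochner_Integration.integral_cong[OF refl eq])
  moreover have "\<dots> = (\<Sum>p\<in>P m. \<integral>x. indicator (box m p) x *\<^sub>R f p \<partial>M)"
    by (intro Bochner_Integration.integral_sum integrable_scaleR_left ind)
  moreover have "\<dots> = (1 / real q ^ m)\<^sup>2 *\<^sub>R sum f (P m)"
    unfolding scaleR_sum_right
  proof (rule sum.cong[OF refl])
    fix p assume p: "p \<in> P m"
    have "(\<integral>x. indicator (box m p) x *\<^sub>R f p \<partial>M) = integral\<^sup>L M (indicator (box m p)) *\<^sub>R f p"
      by (rule integral_scaleR_left) (rule ind(1)[OF p])
    then show "(\<integral>x. indicator (box m p) x *\<^sub>R f p \<partial>M) = (1 / real q ^ m)\<^sup>2 *\<^sub>R f p"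
      by (simp only: ind(2)[OF p])
  qed
  ultimately show ?thesis by simp
qed

lemma V_L2_fun: "f \<in> V m \<Longrightarrow> n \<le> m \<Longrightarrow> f \<in> L2_fun M"
  using integral_V[of f m] integral_V[OF V_map[of f m "\<lambda>z. (cmod z)\<^sup>2"]]
  by (auto simp: L2_fun_def)

lemma L2_norm_V:
  "f \<in> V m \<Longrightarrow> n \<le> m \<Longrightarrow> (L2_norm M f)\<^sup>2 = (1 / real q ^ m)\<^sup>2 * (\<Sum>p\<in>P m. (cmod (f p))\<^sup>2)"
  using integral_V[OF V_map[of f m "\<lambda>z. (cmod z)\<^sup>2"]] by (simp add: L2_norm_square)

text \<open>The empty set is added for stability under intersections; the bound on the level keeps
  every box inside \<open>X2\<close>.\<close>

definition boxes :: "(('k \<times> 'k set) \<times> ('k \<times> 'k set)) set set" where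
  "boxes = insert {} (\<Union>m\<in>{n..}. box m ` X2)"

lemma boxes_iff: "E \<in> boxes \<longleftrightarrow> E = {} \<or> (\<exists>m. n \<le> m \<and> (\<exists>p. p \<in> X2 \<and> E = box m p))"
  by (simp only: boxes_def insert_iff UN_iff image_iff Bex_def atLeast_iff)

lemma boxesI: "n \<le> m \<Longrightarrow> p \<in> X2 \<Longrightarrow> box m p \<in> boxes"
  unfolding boxes_iff by metis

text \<open>The ultrametric phenomenon that every point of a ball is a centre.\<close>

lemma box_eq_box:
  assumes "x \<in> box m p"
  shows "box m p = box m x"
  using assms by (cases p, cases x) (auto simp: box_def mem_coset_iff)

lemma box_mono: "m \<le> m' \<Longrightarrow> box m' x \<subseteq> box m x"
proof -
  assume "m \<le> m'"
  then have "cos (int m') a \<subseteq> cos (int m) a" for a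
    using frac_ideal_mono[of "int m" "int m'"] by (auto simp: coset_def)
  then show ?thesis unfolding box_def case_prod_beta by (intro Sigma_mono order_refl)
qed

lemma box_subset: "n \<le> m \<Longrightarrow> p \<in> X2 \<Longrightarrow> box m p \<subseteq> X2"
  using sets.sets_into_space[OF box_sets] by simp

lemma boxes_subset: "boxes \<subseteq> Pow X2"
proof
  fix E assume "E \<in> boxes"
  then consider "E = {}" | m p where "n \<le> m" "p \<in> X2" "E = box m p"
    unfolding boxes_iff by metis
  then show "E \<in> Pow X2"
    by cases (use box_subset in \<open>simp_all only: Pow_iff empty_subsetI\<close>)
qed

text \<open>Two boxes are disjoint or nested, because a common point is a centre of both.\<close>

lemma Int_stable_boxes: "Int_stable boxes"
proof -
  have *: "box m p \<inter> box m' p' \<in> boxes" if "n \<le> m" "m \<le> m'" "p' \<in> X2" for m m' p p'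
  proof (cases "box m p \<inter> box m' p' = {}")
    case False
    then obtain x where x: "x \<in> box m p" "x \<in> box m' p'" by blast
    have "box m p \<inter> box m' p' = box m' p'"
      unfolding box_eq_box[OF x(1)] box_eq_box[OF x(2)] using box_mono[OF that(2), of x] by blast
    moreover have "box m' p' \<in> boxes"
      using order_trans[OF that(1,2)] that(3) by (rule boxesI)
    ultimately show ?thesis by simp
  qed (simp only: boxes_iff simp_thms)
  show ?thesis
    unfolding Int_stable_def
  proof (intro ballI)
    fix E E' assume E: "E \<in> boxes" "E' \<in> boxes"
    show "E \<inter> E' \<in> boxes"
    proof (cases "E = {} \<or> E' = {}")
      case True then show ?thesis by (auto simp: boxes_iff)
    next
      case False
      then obtain m p m' p' where "E = box m p" "n \<le> m" "p \<in> X2" "E' = box m' p'" "n \<le> m'" "p' \<in> X2"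
        using E unfolding boxes_iff by metis
      then show ?thesis
        using *[of m m' p' p] *[of m' m p p'] by (metis Int_commute nle_le)
    qed
  qed
qed

text \<open>The inclusion of \<open>sets M\<close> is measurability of the identity from the
  generated algebra into \<open>M\<close>, checked on the four coordinates: the units on cosets, the
  others on single points of \<open>\<Gamma>\<close>.\<close>

lemma sets_M_eq: "sets M = sigma_sets X2 boxes"
proof
  have Pow: "boxes \<subseteq> Pow X2"
    by (rule boxes_subset)
  have "boxes \<subseteq> sets M"
  proof
    fix E assume "E \<in> boxes"
    then consider "E = {}" | m p where "n \<le> m" "p \<in> X2" "E = box m p"
      unfolding boxes_iff by metis
    then show "E \<in> sets M"
      by cases (simp_all only: box_sets sets.empty_sets)
  qed
  from sets.sigma_sets_subset[OF this] show "sigma_sets X2 boxes \<subseteq> sets M"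
    by (simp only: space_M)
  let ?S = "sigma X2 boxes"
  \<comment> \<open>A set that depends only on \<open>snap m\<close> is a union of boxes over the
    grid, and the grid is countable because \<open>\<Gamma>\<close> is.\<close>
  have grid: "{x \<in> X2. Q (snap m x)} \<in> sets ?S" if m: "n \<le> m" for m Q
  proof -
    have "{x \<in> X2. Q (snap m x)} = (\<Union>p\<in>{p \<in> grid m. Q p}. box m p)"
    proof (intro equalityI subsetI)
      fix x assume "x \<in> {x \<in> X2. Q (snap m x)}"
      then show "x \<in> (\<Union>p\<in>{p \<in> grid m. Q p}. box m p)"
        using snap_grid mem_box_iff[of "snap m x" m x] by blast
    next
      fix x assume "x \<in> (\<Union>p\<in>{p \<in> grid m. Q p}. box m p)"
      then obtain p where p: "p \<in> grid m" "Q p" "x \<in> box m p" by blast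
      have "x \<in> X2" using p(3) box_subset[OF m subsetD[OF grid_subset[OF m] p(1)]] by blast
      then show "x \<in> {x \<in> X2. Q (snap m x)}" using p mem_box_iff by simp
    qed
    also have "\<dots> \<in> sets ?S"
    proof (rule sets.countable_UN'')
      show "countable {p \<in> grid m. Q p}"
        using countable_grid[OF m] by (rule countable_subset[rotated]) auto
      fix p assume "p \<in> {p \<in> grid m. Q p}"
      then have "box m p \<in> boxes" by (intro boxesI m subsetD[OF grid_subset[OF m]]) simp
      then show "box m p \<in> sets ?S" using Pow by (simp add: sigma_sets.Basic)
    qed
    finally show ?thesis .
  qed
  have space: "space ?S = X2" using Pow by (simp add: space_measure_of_conv)
  have unit: "(\<lambda>x. g x) \<in> measurable ?S (restrict_space \<mu> U)"
    if g: "\<And>m x. x \<in> X2 \<Longrightarrow> cos (int m) (g (snap m x)) = cos (int m) (g x)" "\<And>x. x \<in> X2 \<Longrightarrow> g x \<in> U" for g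
  proof (rule measurable_restrict_space2)
    show "g \<in> space ?S \<rightarrow> U" using g by (simp add: space)
    have "g \<in> measurable ?S (sigma UNIV all_cosets)"
    proof (rule measurable_measure_of)
      fix C assume "C \<in> all_cosets"
      then obtain i j y where C: "C = cos (int (i + j)) y" by (auto simp: all_cosets_def)
      \<comment> \<open>Fine enough to decide membership in \<open>C\<close>, and at least
        \<open>n\<close>, as \<open>grid\<close> requires.\<close>
      let ?m = "max n (i + j)"
      have "{x \<in> X2. g x \<in> C} = {x \<in> X2. g (snap ?m x) \<in> C}"
      proof (intro Collect_cong conj_cong refl)
        fix x assume "x \<in> X2"
        then have "g (snap ?m x) - g x \<in> I (int ?m)" using g(1)[of x ?m] unfolding coset_eq_iff by blast
        then have "g (snap ?m x) - g x \<in> I (int (i + j))" by (rule frac_ideal_mono[rotated]) simp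
        then have "cos (int (i + j)) (g (snap ?m x)) = cos (int (i + j)) (g x)" unfolding coset_eq_iff .
        then show "g x \<in> C \<longleftrightarrow> g (snap ?m x) \<in> C" unfolding C mem_coset_iff by simp
      qed
      moreover have "g -` C \<inter> space ?S = {x \<in> X2. g x \<in> C}" using space by blast
      ultimately show "g -` C \<inter> space ?S \<in> sets ?S" using grid[of ?m "\<lambda>p. g p \<in> C"] by simp
    qed auto
    then show "g \<in> measurable ?S \<mu>"
      using measurable_cong_sets[OF refl sets_Haar, of ?S] borel_eq_sigma_cosets by simp
  qed
  have disc: "(\<lambda>x. g x) \<in> measurable ?S (count_space \<Gamma>)"
    if g: "\<And>x. x \<in> X2 \<Longrightarrow> g (snap n x) = g x" "\<And>x. x \<in> X2 \<Longrightarrow> g x \<in> \<Gamma>" for g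
  proof -
    have "g -` {T} \<inter> space ?S \<in> sets ?S" for T
    proof -
      have "g -` {T} \<inter> space ?S = {x \<in> X2. g (snap n x) = T}" using space g(1) by auto
      then show ?thesis using grid[of n "\<lambda>p. g p = T"] by simp
    qed
    then show ?thesis
      using g(2) space by (subst measurable_count_space_eq_countable[OF countable_Gamma]) auto
  qed
  have "(\<lambda>x. ((fst (fst x), snd (fst x)), (fst (snd x), snd (snd x)))) \<in> measurable ?S M"
    unfolding XX_measure_def X_measure_def
    by (intro measurable_Pair unit disc) (auto simp: snap_def)
  then have id: "(\<lambda>x. x) \<in> measurable ?S M" by simp
  show "sets M \<subseteq> sigma_sets X2 boxes"
  proof
    fix A assume A: "A \<in> sets M"
    then have "(\<lambda>x. x) -` A \<inter> space ?S \<in> sets ?S" by (rule measurable_sets[OF id])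
    moreover have "(\<lambda>x. x) -` A \<inter> space ?S = A" using sets.sets_into_space[OF A] space by auto
    ultimately show "A \<in> sigma_sets X2 boxes" using Pow by simp
  qed
qed

text \<open>Described by levels instead of topology, so that the matrices apply;
  \<open>test_function_in_V\<close> shows that it contains all test functions.\<close>

definition test_space :: "(('k \<times> 'k set) \<times> ('k \<times> 'k set) \<Rightarrow> complex) set" where
  "test_space = (\<Union>m\<in>{n..}. V m)"

lemma test_spaceI: "n \<le> m \<Longrightarrow> f \<in> V m \<Longrightarrow> f \<in> test_space"
  unfolding test_space_def by (rule UN_I[of m]) simp_all

lemma test_spaceE:
  assumes "f \<in> test_space"
  obtains m where "n \<le> m" "f \<in> V m"
  using assms unfolding test_space_def by (elim UN_E) simp

lemma L2_subspace_test_space: "L2_subspace M test_space"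
proof
  show "test_space \<subseteq> L2_fun M" using V_L2_fun by (blast elim: test_spaceE)
  have "(\<lambda>x. 0) \<in> V n" by (rule VI) simp_all
  then show "(\<lambda>x. 0) \<in> test_space" by (rule test_spaceI[rotated]) simp
next
  fix f g assume "f \<in> test_space" "g \<in> test_space"
  then obtain i j where i: "n \<le> i" "f \<in> V i" and j: "n \<le> j" "g \<in> V j" by (metis test_spaceE)
  have "(\<lambda>x. f x + g x) \<in> V (max i j)"
    by (intro V_add V_mono[OF i(1) _ i(2)] V_mono[OF j(1) _ j(2)]) auto
  then show "(\<lambda>x. f x + g x) \<in> test_space" by (rule test_spaceI[rotated]) (use i in simp)
next
  fix f c assume "f \<in> test_space"
  then obtain m where m: "n \<le> m" "f \<in> V m" by (rule test_spaceE)
  then show "(\<lambda>x. c * f x) \<in> test_space" using V_map[of f m "\<lambda>z. c * z"] by (intro test_spaceI) simp_all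
qed

text \<open>The level \<open>m\<close> of invariance and the level \<open>k\<close> of the support
  are kept apart, since a fine box cut off by a large set has different ones; both conditions
  persist at the maximum.\<close>

lemma indicator_test_space:
  assumes "n \<le> m" "n \<le> k" "A \<subseteq> X2"
    and A: "\<And>x y. x \<in> X2 \<Longrightarrow> y \<in> X2 \<Longrightarrow> snap m x = snap m y \<Longrightarrow> x \<in> A \<Longrightarrow> y \<in> A"
    and B: "\<And>x. x \<in> A \<Longrightarrow> snap k x \<in> P k"
  shows "(indicator A :: _ \<Rightarrow> complex) \<in> test_space"
proof -
  have "(indicator A :: _ \<Rightarrow> complex) \<in> V (max m k)"
  proof (rule VI)
    fix x y assume xy: "x \<in> X2" "y \<in> X2" "snap (max m k) y = snap (max m k) x"
    then have "snap m y = snap m x" using snap_snap[of m "max m k"] by (metis max.cobounded1)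
    then have "y \<in> A \<longleftrightarrow> x \<in> A" using A[OF xy(1,2)] A[OF xy(2,1)] by metis
    then show "indicator A y = (indicator A x :: complex)" by (simp only: indicator_def)
  next
    fix x assume "x \<in> X2" "indicator A x \<noteq> (0 :: complex)"
    then show "snap (max m k) x \<in> P (max m k)"
      using B[of x] B_mono[of k "max m k"] by (simp add: indicator_def snap_P split: if_splits)
  qed
  then show ?thesis by (rule test_spaceI[rotated]) (use assms(1) in simp)
qed

lemma test_space_dense:
  assumes "f \<in> L2_fun M" "e > 0"
  shows "\<exists>d\<in>test_space. L2_norm M (\<lambda>x. f x - d x) < e"
proof -
  interpret L2_subspace M test_space by (rule L2_subspace_test_space)
  \<comment> \<open>These sets exhaust \<open>X2\<close> as the classes range over larger and larger
    \<open>B (n + k)\<close>; the offset \<open>n\<close> keeps the level admissible.\<close>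
  define \<Omega> where "\<Omega> k = {x \<in> X2. snap (n + k) x \<in> P (n + k)}" for k
  have \<Omega>X: "\<Omega> k \<subseteq> X2" for k by (auto simp: \<Omega>_def)
  have \<Omega>I: "(indicator (\<Omega> k) :: _ \<Rightarrow> real) \<in> V (n + k)" for k
    by (rule VI) (auto simp: indicator_def \<Omega>_def split: if_splits)
  have meas: "\<Omega> k \<in> sets M" "emeasure M (\<Omega> k) < \<infinity>" for k
  proof -
    \<comment> \<open>Measurability and finite measure are read off from integrability of the
      indicator, a function of level \<open>n + k\<close>.\<close>
    have int: "integrable M (indicator (\<Omega> k) :: _ \<Rightarrow> real)"
      using integral_V[OF \<Omega>I[of k]] by simp
    then show "\<Omega> k \<in> sets M"
      using \<Omega>X[of k] borel_measurable_indicator_iff[of "\<Omega> k" M] by (auto simp: Int_absorb2 integrable_iff_bounded)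
    then show "emeasure M (\<Omega> k) < \<infinity>"
      using int integrable_indicator_iff[of M "\<Omega> k"] \<Omega>X[of k] by (simp add: Int_absorb2)
  qed
  have "f \<in> L2_closure M test_space"
  proof (rule closure_eq_L2_fun[where \<Omega> = \<Omega> and E = boxes])
    show "incseq \<Omega>"
    proof (intro monoI subsetI)
      fix i j x assume "(i :: nat) \<le> j" "x \<in> \<Omega> i"
      then show "x \<in> \<Omega> j" using B_mono[of "n + i" "n + j"] by (auto simp: \<Omega>_def snap_P)
    qed
    show "(\<Union>k. \<Omega> k) = space M"
    proof (intro equalityI subsetI)
      fix x assume "x \<in> space M"
      then have x: "x \<in> X2" by simp
      then have "snd (fst x) \<in> \<Gamma>" "snd (snd x) \<in> \<Gamma>" by auto
      then obtain i j where "snd (fst x) \<in> B i" "snd (snd x) \<in> B j"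
        using Gamma_exhaust by metis
      then have "snd (fst x) \<in> B (n + max i j)" "snd (snd x) \<in> B (n + max i j)"
        using B_mono[of i "n + max i j"] B_mono[of j "n + max i j"] by auto
      then show "x \<in> (\<Union>k. \<Omega> k)" using x snap_P[OF x, of "n + max i j"] unfolding \<Omega>_def by blast
    qed (use \<Omega>X in auto)
    show "boxes \<subseteq> Pow (space M)" unfolding space_M by (rule boxes_subset)
    show "indicator (\<Omega> k) \<in> test_space" for k
      by (rule indicator_test_space[of "n + k" "n + k"]) (auto simp: \<Omega>_def)
    show "indicator (A \<inter> \<Omega> k) \<in> test_space" if "A \<in> boxes" for k A
    proof (cases "A = {}")
      case False
      with that obtain m p where m: "A = box m p" "n \<le> m" "p \<in> X2" unfolding boxes_iff by metis
      show ?thesis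
      proof (rule indicator_test_space[of "max m (n + k)" "n + k"])
        fix x y assume xy: "x \<in> X2" "y \<in> X2" "snap (max m (n + k)) x = snap (max m (n + k)) y" "x \<in> A \<inter> \<Omega> k"
        have 1: "snap m x = snap m y" "snap (n + k) x = snap (n + k) y"
          using xy(3) snap_snap[of _ "max m (n + k)"] by (metis max.cobounded1, metis max.cobounded2)
        have "box m x = box m y"
          using 1(1) by (auto simp: snap_def box_def rep_coset_eq_iff split: prod.splits)
        moreover have "y \<in> box m y" by (auto simp: box_def split: prod.splits)
        ultimately have "y \<in> A" using xy(4) box_eq_box[of x m p] m by auto
        then show "y \<in> A \<inter> \<Omega> k" using xy 1(2) by (simp add: \<Omega>_def)
      qed (use m \<Omega>X in \<open>auto simp: \<Omega>_def\<close>)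
    next
      case True
      then have "indicator (A \<inter> \<Omega> k) = (\<lambda>x. 0 :: complex)" by (simp add: fun_eq_iff)
      with zero show ?thesis by metis
    qed
  qed (use meas Int_stable_boxes sets_M_eq assms in auto)
  then show ?thesis using assms(2) by (simp add: L2_closure_def)
qed

end

context unitary_setting
begin

section \<open>The operator on functions of finite level\<close>

abbreviation F where "F \<equiv> F_op av \<pi> \<Psi> \<mu> n"

text \<open>The factor q^(2n) of \<open>F\<close> times the volume q^(-2m) of a box. Since every row
  has \<open>N m ^ 4\<close> entries of modulus 1, this normalizes the rows.\<close>

definition kernel_scale :: "nat \<Rightarrow> complex" where
  "kernel_scale m = 1 / of_nat (N m ^ 2)"

definition kernel_sum :: "nat \<Rightarrow> (('k \<times> 'k set) \<times> ('k \<times> 'k set) \<Rightarrow> complex) \<Rightarrow> ('k \<times> 'k set) \<times> ('k \<times> 'k set) \<Rightarrow> complex" where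
  "kernel_sum m f h = kernel_scale m * (\<Sum>p\<in>P m. K h p * f p)"

text \<open>Right multiplication by \<open>(b, S)\<close> in \<open>X_group\<close>, rounded to
  representatives: the finite form of the substitution.\<close>

definition shift :: "nat \<Rightarrow> 'k \<times> 'k set \<Rightarrow> 'k \<times> 'k set \<Rightarrow> 'k \<times> 'k set" where
  "shift m = (\<lambda>(b, S) (a, T). (rep (cos (int m) (a * b)), cos (- int n) (inverse b * rep T + rep S)))"

lemma shift_bij:
  assumes m: "n \<le> m" and b: "b \<in> U" and S: "S \<in> B m"
  shows "bij_betw (shift m (b, S)) (R m \<times> B m) (R m \<times> B m)"
proof -
  have avb: "av b = 1" "av (inverse b) = 1" using U_av[OF b] U_av[OF U_inverse[OF b]] by auto
  have inj: "inj_on (shift m (b, S)) (R m \<times> B m)"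
  proof (rule inj_onI)
    fix x y assume x: "x \<in> R m \<times> B m" and y: "y \<in> R m \<times> B m" and eq: "shift m (b, S) x = shift m (b, S) y"
    obtain a T where aT: "x = (a, T)" "a \<in> R m" "T \<in> B m" using x by auto
    obtain a' T' where aT': "y = (a', T')" "a' \<in> R m" "T' \<in> B m" using y by auto
    have "a * b - a' * b \<in> I (int m)"
      using eq unfolding aT aT' shift_def by (simp add: rep_coset_eq_iff coset_eq_iff)
    then have "(a - a') * b \<in> I (int m)" by (simp only: left_diff_distrib)
    then have "a = a'" using aT aT' by (simp add: frac_ideal_unit_mult avb R_cong)
    moreover have "inverse b * rep T - inverse b * rep T' \<in> I (- int n)"
      using eq unfolding aT aT' shift_def by (simp add: coset_eq_iff)
    then have "inverse b * (rep T - rep T') \<in> I (- int n)" by (simp only: right_diff_distrib)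
    then have "T = T'" using aT aT' by (simp add: frac_ideal_unit_mult avb rep_B_diff(2)[OF m])
    ultimately show "x = y" using aT aT' by simp
  qed
  have "shift m (b, S) x \<in> R m \<times> B m" if x: "x \<in> R m \<times> B m" for x
  proof -
    obtain a T where aT: "x = (a, T)" "a \<in> R m" "T \<in> B m" using x by auto
    have "inverse b * rep T + rep S \<in> I (- int m)"
      using rep_B(1)[OF aT(3) m] rep_B(1)[OF S m] by (intro frac_ideal_add) (simp_all add: frac_ideal_unit_mult avb)
    then show ?thesis
      using aT b R_subset_U[OF m] by (simp add: shift_def rep_coset_R U_mult coset_in_B_iff[OF m])
  qed
  then have "shift m (b, S) ` (R m \<times> B m) \<subseteq> R m \<times> B m" by blast
  then show ?thesis
    using inj card_R(1)[OF m] card_B(1)[OF m] by (simp add: bij_betw_def endo_inj_surj)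
qed

lemma psi_mult_cong:
  assumes "x - x' \<in> I (int m)" "t \<in> I (- int m)" "x' \<in> I (int n)" "t - t' \<in> I (- int n)"
  shows "x * t - x' * t' \<in> I 0"
proof -
  have "x * t - x' * t' = (x - x') * t + x' * (t - t')" by (simp add: algebra_simps)
  then show ?thesis
    using frac_ideal_mult_0[OF assms(1,2)] frac_ideal_mult_0[OF assms(3,4)] by (simp only: frac_ideal_add)
qed

text \<open>Rounding alters the value of \<open>phi\<close> by an element of
  \<open>I (int m)\<close>, paired with \<open>I (- int m)\<close>, and the class representative by
  an element of \<open>I (- int n)\<close>, paired with \<open>I (int n)\<close>. Both products are
  integers and invisible to \<open>\<Psi>\<close>. The units \<open>b\<close> and \<open>b'\<close>
  belong to different factors of \<open>X2\<close>.\<close>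

lemma shift_kernel_cong:
  assumes m: "n \<le> m" and U: "a \<in> U" "b \<in> U" "b' \<in> U" and B: "S \<in> B m" "T \<in> B m"
  shows "phi (rep (cos (int m) (a * b)) / b) * b' * (rep (cos (- int n) (inverse b' * rep T + rep S)) - rep S)
    - phi a * rep T \<in> I 0"
proof -
  define a' where "a' = rep (cos (int m) (a * b))"
  define t where "t = rep (cos (- int n) (inverse b' * rep T + rep S)) - rep S"
  have a': "a' - a * b \<in> I (int m)" unfolding a'_def by (rule rep_coset')
  have a'U: "a' \<in> U"
    using U_close[OF U_mult[OF U(1,2)]] a' m frac_ideal_minus_commute by (metis of_nat_mono)
  have nz: "b \<noteq> 0" "b' \<noteq> 0" using U U_nonzero by auto
  have "a' / b - a = (a' - a * b) / b" using nz by (simp add: diff_divide_distrib)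
  then have "av (phi (a' / b) - phi a) = av (a' - a * b)"
    using U a'U by (simp add: av_phi_diff U_divide av_divide)
  then have 1: "phi (a' / b) - phi a \<in> I (int m)" using a' by (simp only: frac_ideal_iff)
  have "t - inverse b' * rep T \<in> I (- int n)"
    using rep_coset'[of "- int n" "inverse b' * rep T + rep S"] by (simp add: t_def algebra_simps)
  then have "b' * (t - inverse b' * rep T) \<in> I (- int n)"
    using U by (simp only: frac_ideal_unit_mult U_av)
  then have 2: "b' * t - rep T \<in> I (- int n)"
    using nz by (simp add: right_diff_distrib mult.assoc[symmetric])
  have "- int m \<le> - int n" using m by simp
  from frac_ideal_mono[OF this 2] have "b' * t - rep T \<in> I (- int m)" .
  then have 3: "b' * t \<in> I (- int m)"
    using frac_ideal_add[of "b' * t - rep T" "- int m" "rep T"] rep_B(1)[OF B(2) m] by simp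
  have "phi (a' / b) * (b' * t) - phi a * rep T \<in> I 0"
    by (rule psi_mult_cong[OF 1 3 phi_in[OF U(1)] 2])
  then show ?thesis by (simp only: a'_def t_def mult.assoc)
qed

lemma X_group_mult:
  "(a, T) \<otimes>\<^bsub>X_group av \<pi> n\<^esub> (b, S) = (a * b, cos (- int n) (inverse b * rep T + rep S))"
  by (simp add: X_group_def Gam_rel_Image)

text \<open>Right translation by \<open>h\<close> respects level \<open>m\<close> because the
  classes of \<open>h\<close> lie in \<open>B m\<close>. The phase is under control where the
  translated \<open>f\<close> is nonzero: there \<open>T1\<close> and \<open>T2\<close> lie in
  \<open>B m\<close>, and a change of the units by \<open>I (int m)\<close> changes its argument by
  an integer. This explains the case split.\<close>

lemma F_integrand_V:
  assumes f: "f \<in> V m" and m: "n \<le> m" and h: "h \<in> X2" "snap m h \<in> P m"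
  shows "F_integrand av \<pi> \<Psi> n f h \<in> V m"
proof -
  obtain b1 S1 b2 S2 where h': "h = ((b1, S1), (b2, S2))" "b1 \<in> U" "b2 \<in> U" "S1 \<in> \<Gamma>" "S2 \<in> \<Gamma>"
    using h(1) by auto
  have S: "S1 \<in> B m" "S2 \<in> B m" using h(2) snap_P[OF h(1)] h' by auto
  let ?g = "\<lambda>a1 T1 a2 T2. ((a1 * b1, cos (- int n) (inverse b1 * rep T1 + rep S1)), (a2 * b2, cos (- int n) (inverse b2 * rep T2 + rep S2)))"
  have Fi: "F_integrand av \<pi> \<Psi> n f h ((a1, T1), (a2, T2))
      = \<Psi> (phi a1 * rep T2 - phi a2 * rep T1) * f (?g a1 T1 a2 T2)" for a1 T1 a2 T2
    unfolding h'(1) F_integrand_def by (simp add: X_group_mult)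
  have gX: "?g a1 T1 a2 T2 \<in> X2" if "a1 \<in> U" "a2 \<in> U" for a1 T1 a2 T2
    using that h' by (simp add: U_mult)
  have BT: "T \<in> B m" if T: "T \<in> \<Gamma>" "S \<in> B m" "b \<in> U" "cos (- int n) (inverse b * rep T + rep S) \<in> B m" for T S b
  proof -
    have "inverse b * rep T + rep S \<in> I (- int m)" using T(4) by (simp add: coset_in_B_iff[OF m])
    then have "inverse b * rep T \<in> I (- int m)"
      using frac_ideal_diff[OF _ rep_B(1)[OF T(2) m], of "inverse b * rep T + rep S"] by simp
    then have "rep T \<in> I (- int m)" using U_av[OF U_inverse[OF T(3)]] by (simp add: frac_ideal_unit_mult)
    then show ?thesis using coset_in_B_iff[OF m, of "rep T"] coset_rep_Gamma[OF T(1)] by simp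
  qed
  have supp: "T1 \<in> B m \<and> T2 \<in> B m"
    if T: "a1 \<in> U" "a2 \<in> U" "T1 \<in> \<Gamma>" "T2 \<in> \<Gamma>" "f (?g a1 T1 a2 T2) \<noteq> 0" for a1 T1 a2 T2
  proof -
    have "snap m (?g a1 T1 a2 T2) \<in> P m" by (rule V_support[OF f gX[OF T(1,2)] T(5)])
    then have "cos (- int n) (inverse b1 * rep T1 + rep S1) \<in> B m" "cos (- int n) (inverse b2 * rep T2 + rep S2) \<in> B m"
      unfolding snap_P[OF gX[OF T(1,2)]] by auto
    then show ?thesis using BT S h' T by blast
  qed
  show ?thesis
  proof (rule VI)
    fix x y assume xy: "x \<in> X2" "y \<in> X2" "snap m y = snap m x"
    obtain a1 T1 a2 T2 where x: "x = ((a1, T1), (a2, T2))" "a1 \<in> U" "a2 \<in> U" "T1 \<in> \<Gamma>" "T2 \<in> \<Gamma>"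
      using xy(1) by auto
    obtain d1 d2 where y: "y = ((d1, T1), (d2, T2))" "d1 \<in> U" "d2 \<in> U"
        "d1 - a1 \<in> I (int m)" "d2 - a2 \<in> I (int m)"
      using xy(2,3) unfolding x(1) snap_def by (auto simp: rep_coset_eq_iff coset_eq_iff)
    have "d1 * b1 - a1 * b1 \<in> I (int m)" "d2 * b2 - a2 * b2 \<in> I (int m)"
      using y(4,5) h'(2,3) by (simp_all add: frac_ideal_unit_mult flip: left_diff_distrib)
    then have "snap m (?g d1 T1 d2 T2) = snap m (?g a1 T1 a2 T2)"
      by (simp add: snap_def rep_coset_eq_iff coset_eq_iff)
    then have f_eq: "f (?g d1 T1 d2 T2) = f (?g a1 T1 a2 T2)"
      using x y by (intro V_eq[OF f gX gX])
    show "F_integrand av \<pi> \<Psi> n f h y = F_integrand av \<pi> \<Psi> n f h x"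
    proof (cases "f (?g a1 T1 a2 T2) = 0")
      case False
      then have T: "T1 \<in> B m" "T2 \<in> B m" using supp x by auto
      have "phi d1 - phi a1 \<in> I (int m)" "phi d2 - phi a2 \<in> I (int m)"
        using x y by (simp_all add: frac_ideal_iff av_phi_diff)
      then have "(phi d1 - phi a1) * rep T2 - (phi d2 - phi a2) * rep T1 \<in> I 0"
        using frac_ideal_mult_0 rep_B(1)[OF _ m] T frac_ideal_diff by metis
      then have "\<Psi> (phi d1 * rep T2 - phi d2 * rep T1) = \<Psi> (phi a1 * rep T2 - phi a2 * rep T1)"
        by (intro psi_cong) (simp add: algebra_simps)
      then show ?thesis unfolding x(1) y(1) Fi f_eq by simp
    qed (simp add: x(1) y(1) Fi f_eq)
  next
    fix x assume x: "x \<in> X2" "F_integrand av \<pi> \<Psi> n f h x \<noteq> 0"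
    obtain a1 T1 a2 T2 where x': "x = ((a1, T1), (a2, T2))" "a1 \<in> U" "a2 \<in> U" "T1 \<in> \<Gamma>" "T2 \<in> \<Gamma>"
      using x(1) by auto
    then have "f (?g a1 T1 a2 T2) \<noteq> 0" using x(2) unfolding x'(1) Fi by auto
    then show "snap m x \<in> P m" using supp[OF x'(2-5)] unfolding snap_P[OF x(1)] by (simp add: x'(1))
  qed
qed

text \<open>The integral is a sum over \<open>P m\<close> by \<open>integral_V\<close>, and
  \<open>shift\<close> permutes \<open>P m\<close> in each factor. The condition on \<open>h\<close>
  is what makes the shifts preserve \<open>B m\<close>.\<close>

lemma F_eq_kernel_sum:
  assumes f: "f \<in> V m" and m: "n \<le> m" and h: "h \<in> X2" "snap m h \<in> P m"
  shows "F f h = kernel_sum m f h"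
proof -
  obtain b1 S1 b2 S2 where h': "h = ((b1, S1), (b2, S2))" "b1 \<in> U" "b2 \<in> U" "S1 \<in> \<Gamma>" "S2 \<in> \<Gamma>"
    using h(1) by auto
  have S: "S1 \<in> B m" "S2 \<in> B m" using h(2) snap_P[OF h(1)] h' by auto
  let ?\<sigma> = "map_prod (shift m (b1, S1)) (shift m (b2, S2))"
  have bij: "bij_betw ?\<sigma> (P m) (P m)"
    unfolding P_def by (intro bij_betw_map_prod shift_bij m h' S)
  have summand: "F_integrand av \<pi> \<Psi> n f h p = K h (?\<sigma> p) * f (?\<sigma> p)" if p: "p \<in> P m" for p
  proof -
    obtain a1 T1 a2 T2 where p': "p = ((a1, T1), (a2, T2))" "a1 \<in> R m" "a2 \<in> R m" "T1 \<in> B m" "T2 \<in> B m"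
      using p by (auto simp: P_def)
    note aU = p'(2,3)[THEN R_subset_U[OF m]]
    let ?T1 = "cos (- int n) (inverse b1 * rep T1 + rep S1)" and ?T2 = "cos (- int n) (inverse b2 * rep T2 + rep S2)"
    let ?a1 = "rep (cos (int m) (a1 * b1))" and ?a2 = "rep (cos (int m) (a2 * b2))"
    let ?g = "((a1 * b1, ?T1), (a2 * b2, ?T2))"
    have gX: "?g \<in> X2" using aU h' by (simp add: U_mult)
    have \<sigma>: "?\<sigma> p = ((?a1, ?T1), (?a2, ?T2))" by (simp add: p'(1) shift_def)
    have snap: "?\<sigma> p = snap m ?g" unfolding \<sigma> by (simp add: snap_def)
    have f_eq: "f (?\<sigma> p) = f ?g" unfolding snap by (rule V_snap[OF f m gX])
    have "(phi (?a1 / b1) * b2 * (rep ?T2 - rep S2) - phi a1 * rep T2)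
        - (phi (?a2 / b2) * b1 * (rep ?T1 - rep S1) - phi a2 * rep T1) \<in> I 0"
      by (intro frac_ideal_diff shift_kernel_cong m aU h' S p')
    then have "\<Psi> (phi (?a1 / b1) * b2 * (rep ?T2 - rep S2) - phi (?a2 / b2) * b1 * (rep ?T1 - rep S1))
        = \<Psi> (phi a1 * rep T2 - phi a2 * rep T1)"
      by (intro psi_cong) (simp add: algebra_simps)
    then have "K h (?\<sigma> p) = \<Psi> (phi a1 * rep T2 - phi a2 * rep T1)"
      unfolding \<sigma> h'(1) K_def by simp
    then show ?thesis unfolding f_eq unfolding p'(1) h'(1) F_integrand_def by (simp add: X_group_mult)
  qed
  have q0: "real q \<noteq> 0" using q_gt_1 by simp
  have N: "of_nat q ^ (2 * n) * complex_of_real ((1 / real q ^ m)\<^sup>2) = kernel_scale m"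
  proof -
    have "real q ^ m = real (N m) * real q ^ n"
      unfolding N_def using m by (simp flip: power_add)
    then have "real q ^ (2 * n) * (1 / real q ^ m)\<^sup>2 = 1 / real (N m) ^ 2"
      using q0 by (simp add: power_mult power2_eq_square mult.commute[of 2])
    then have "complex_of_real (real q ^ (2 * n) * (1 / real q ^ m)\<^sup>2) = complex_of_real (1 / real (N m) ^ 2)"
      by (rule arg_cong)
    then show ?thesis by (simp add: kernel_scale_def)
  qed
  have "F f h = of_nat q ^ (2 * n) * ((1 / real q ^ m)\<^sup>2 *\<^sub>R sum (F_integrand av \<pi> \<Psi> n f h) (P m))"
    unfolding F_op_def using integral_V[OF F_integrand_V[OF f m h] m] by simp
  also have "\<dots> = kernel_scale m * sum (F_integrand av \<pi> \<Psi> n f h) (P m)"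
    unfolding N[symmetric] scaleR_conv_of_real by (simp only: mult.assoc)
  also have "sum (F_integrand av \<pi> \<Psi> n f h) (P m) = (\<Sum>p\<in>P m. K h (?\<sigma> p) * f (?\<sigma> p))"
    by (rule sum.cong[OF refl summand])
  also have "\<dots> = (\<Sum>p\<in>P m. K h p * f p)"
    by (rule sum.reindex_bij_betw[OF bij])
  finally show ?thesis by (simp only: kernel_sum_def)
qed

lemma kernel_scale_N: "kernel_scale m * cnj (kernel_scale m) * of_nat (N m ^ 4) = 1"
proof -
  have "of_nat (N m ^ 2) \<noteq> (0::complex)" using N_pos[of m] by (simp del: N_pos)
  moreover have "(of_nat (N m ^ 4) :: complex) = of_nat (N m ^ 2) * of_nat (N m ^ 2)"
    by (simp flip: power_add)
  ultimately show ?thesis by (simp add: kernel_scale_def)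
qed

text \<open>Expanding the squares leaves the Gram matrix of the columns, which is the identity after
  scaling.\<close>

lemma kernel_sum_isometric:
  assumes m: "n \<le> m"
  shows "(\<Sum>h\<in>P m. (cmod (kernel_sum m f h))\<^sup>2) = (\<Sum>p\<in>P m. (cmod (f p))\<^sup>2)"
proof -
  have "complex_of_real (\<Sum>h\<in>P m. (cmod (kernel_sum m f h))\<^sup>2) = (\<Sum>h\<in>P m. kernel_sum m f h * cnj (kernel_sum m f h))"
    unfolding of_real_sum by (intro sum.cong refl complex_norm_square)
  also have "\<dots> = (\<Sum>h\<in>P m. \<Sum>p\<in>P m. \<Sum>p'\<in>P m. kernel_scale m * cnj (kernel_scale m) * (f p * cnj (f p') * (K h p * cnj (K h p'))))"
    unfolding kernel_sum_def complex_cnj_mult cnj_sum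
  proof (rule sum.cong[OF refl])
    fix h
    have "kernel_scale m * (\<Sum>p\<in>P m. K h p * f p) * (cnj (kernel_scale m) * (\<Sum>p\<in>P m. cnj (K h p) * cnj (f p)))
      = kernel_scale m * cnj (kernel_scale m) * ((\<Sum>p\<in>P m. K h p * f p) * (\<Sum>p\<in>P m. cnj (K h p) * cnj (f p)))"
      by (simp only: mult_ac)
    also have "\<dots> = (\<Sum>p\<in>P m. \<Sum>p'\<in>P m. kernel_scale m * cnj (kernel_scale m) * ((K h p * f p) * (cnj (K h p') * cnj (f p'))))"
      unfolding sum_product by (simp only: sum_distrib_left)
    finally show "kernel_scale m * (\<Sum>p\<in>P m. K h p * f p) * (cnj (kernel_scale m) * (\<Sum>p\<in>P m. cnj (K h p) * cnj (f p)))
      = (\<Sum>p\<in>P m. \<Sum>p'\<in>P m. kernel_scale m * cnj (kernel_scale m) * (f p * cnj (f p') * (K h p * cnj (K h p'))))"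
      by (simp only: mult_ac)
  qed
  also have "\<dots> = (\<Sum>p\<in>P m. \<Sum>h\<in>P m. \<Sum>p'\<in>P m. kernel_scale m * cnj (kernel_scale m) * (f p * cnj (f p') * (K h p * cnj (K h p'))))"
    by (rule sum.swap)
  also have "\<dots> = (\<Sum>p\<in>P m. \<Sum>p'\<in>P m. \<Sum>h\<in>P m. kernel_scale m * cnj (kernel_scale m) * (f p * cnj (f p') * (K h p * cnj (K h p'))))"
    by (intro sum.cong refl sum.swap)
  also have "\<dots> = (\<Sum>p\<in>P m. \<Sum>p'\<in>P m. if p = p' then f p * cnj (f p') else 0)"
  proof (intro sum.cong refl)
    fix p p' assume p: "p \<in> P m" "p' \<in> P m"
    have "(\<Sum>h\<in>P m. kernel_scale m * cnj (kernel_scale m) * (f p * cnj (f p') * (K h p * cnj (K h p'))))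
      = kernel_scale m * cnj (kernel_scale m) * (f p * cnj (f p') * (\<Sum>h\<in>P m. K h p * cnj (K h p')))"
      by (simp only: sum_distrib_left)
    also have "\<dots> = (if p = p' then (kernel_scale m * cnj (kernel_scale m) * of_nat (N m ^ 4)) * (f p * cnj (f p')) else 0)"
      unfolding K_orthogonal_columns[OF m p] by simp
    finally show "(\<Sum>h\<in>P m. kernel_scale m * cnj (kernel_scale m) * (f p * cnj (f p') * (K h p * cnj (K h p'))))
      = (if p = p' then f p * cnj (f p') else 0)" by (simp only: kernel_scale_N mult_1)
  qed
  also have "\<dots> = complex_of_real (\<Sum>p\<in>P m. (cmod (f p))\<^sup>2)"
    using finite_P[OF m] by (simp flip: complex_norm_square)
  finally show ?thesis by (simp only: of_real_eq_iff)
qed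

text \<open>Changing units within their classes alters the coefficients by elements of
  \<open>I (int m)\<close>, which meet differences of representatives in
  \<open>I (- int m)\<close>.\<close>

lemma K_cong:
  assumes m: "n \<le> m" and p: "p \<in> X2" "snap m p \<in> P m" "p' \<in> X2" "snap m p' = snap m p"
    and h: "h \<in> X2" "snap m h \<in> P m" "h' \<in> X2" "snap m h' = snap m h"
  shows "K h' p' = K h p"
proof -
  obtain a1 T1 a2 T2 where p': "p = ((a1, T1), (a2, T2))" "a1 \<in> U" "a2 \<in> U" using p(1) by auto
  obtain d1 d2 where d: "p' = ((d1, T1), (d2, T2))" "d1 \<in> U" "d2 \<in> U" "d1 - a1 \<in> I (int m)" "d2 - a2 \<in> I (int m)"
    using p(3,4) unfolding p'(1) snap_def by (auto simp: rep_coset_eq_iff coset_eq_iff)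
  obtain b1 S1 b2 S2 where h': "h = ((b1, S1), (b2, S2))" "b1 \<in> U" "b2 \<in> U" using h(1) by auto
  obtain e1 e2 where e: "h' = ((e1, S1), (e2, S2))" "e1 \<in> U" "e2 \<in> U" "e1 - b1 \<in> I (int m)" "e2 - b2 \<in> I (int m)"
    using h(3,4) unfolding h'(1) snap_def by (auto simp: rep_coset_eq_iff coset_eq_iff)
  have T: "T1 \<in> B m" "T2 \<in> B m" using p(2) unfolding snap_P[OF p(1)] by (simp_all add: p'(1))
  have S: "S1 \<in> B m" "S2 \<in> B m" using h(2) unfolding snap_P[OF h(1)] by (simp_all add: h'(1))
  have main: "phi (d / e) * e' - phi (a / b) * b' \<in> I (int m)"
    if U: "d \<in> U" "e \<in> U" "e' \<in> U" "a \<in> U" "b \<in> U" "b' \<in> U"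
      and close: "d - a \<in> I (int m)" "e - b \<in> I (int m)" "e' - b' \<in> I (int m)" for d e e' a b b'
  proof -
    have "av (d / e - a / e) \<le> av \<pi> powi int m" "av (a / e - a / b) \<le> av \<pi> powi int m"
      using U close by (simp_all add: av_divide_left_diff av_divide_right_diff frac_ideal_iff)
    then have "phi (d / e) - phi (a / e) \<in> I (int m)" "phi (a / e) - phi (a / b) \<in> I (int m)"
      using U by (simp_all add: av_phi_diff U_divide frac_ideal_iff)
    then have "(phi (d / e) - phi (a / e)) + (phi (a / e) - phi (a / b)) \<in> I (int m)"
      by (rule frac_ideal_add)
    then have 1: "(phi (d / e) - phi (a / b)) * e' \<in> I (int m)" using U by (simp add: frac_ideal_unit_mult)
    have "phi (a / b) * (e' - b') \<in> I (int n + int m)"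
      by (rule frac_ideal_mult[OF phi_in[OF U_divide[OF U(4,5)]] close(3)])
    then have "phi (a / b) * (e' - b') \<in> I (int m)" by (rule frac_ideal_mono[rotated]) simp
    then have "(phi (d / e) - phi (a / b)) * e' + phi (a / b) * (e' - b') \<in> I (int m)"
      by (rule frac_ideal_add[OF 1])
    then show ?thesis by (simp add: algebra_simps)
  qed
  have "(phi (d1 / e1) * e2 - phi (a1 / b1) * b2) * (rep T2 - rep S2)
      - (phi (d2 / e2) * e1 - phi (a2 / b2) * b1) * (rep T1 - rep S1) \<in> I 0"
    by (intro frac_ideal_diff frac_ideal_mult_0[OF main] rep_B(1)[OF _ m] p' d h' e T S)
  then have "\<Psi> (phi (d1 / e1) * e2 * (rep T2 - rep S2) - phi (d2 / e2) * e1 * (rep T1 - rep S1))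
    = \<Psi> (phi (a1 / b1) * b2 * (rep T2 - rep S2) - phi (a2 / b2) * b1 * (rep T1 - rep S1))"
    by (intro psi_cong) (simp add: algebra_simps)
  then show ?thesis unfolding p'(1) d(1) h'(1) e(1) K_def by simp
qed

lemma P_snap: "n \<le> m \<Longrightarrow> p \<in> P m \<Longrightarrow> p \<in> X2 \<and> snap m p \<in> P m"
proof -
  assume m: "n \<le> m" and p: "p \<in> P m"
  then have "p \<in> X2" using P_subset by blast
  then show ?thesis using p unfolding snap_P[OF \<open>p \<in> X2\<close>] by (auto simp: P_def)
qed

lemma kernel_sum_cong:
  assumes m: "n \<le> m" and h: "h \<in> X2" "snap m h \<in> P m" "h' \<in> X2" "snap m h' = snap m h"
  shows "kernel_sum m f h' = kernel_sum m f h"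
proof -
  have "K h' p = K h p" if "p \<in> P m" for p
    using P_snap[OF m that] by (intro K_cong[OF m _ _ _ _ h]) auto
  then show ?thesis by (simp add: kernel_sum_def)
qed

text \<open>Both sides are the squared L2 norm of \<open>f\<close>.\<close>

lemma sum_P_eq_of_V:
  assumes "f \<in> V m" "n \<le> m" "m \<le> m'"
  shows "(1 / real q ^ m')\<^sup>2 * (\<Sum>p\<in>P m'. (cmod (f p))\<^sup>2) = (1 / real q ^ m)\<^sup>2 * (\<Sum>p\<in>P m. (cmod (f p))\<^sup>2)"
  using L2_norm_V[OF assms(1,2)] L2_norm_V[OF V_mono[OF assms(2,3,1)]] assms by simp

text \<open>The support bound follows by counting: summing over the finer grid of level \<open>m'\<close> gives the same
  norm as summing over the grid of level \<open>m\<close>, which leaves nothing for the points outside \<open>P m\<close>.\<close>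

lemma F_in_V:
  assumes f: "f \<in> V m" and m: "n \<le> m"
  shows "F f \<in> V m"
proof -
  define g where "g h = (if snap m h \<in> P m then F f h else 0)" for h
  have gV: "g \<in> V m"
  proof (rule VI)
    fix x y assume xy: "x \<in> X2" "y \<in> X2" "snap m y = snap m x"
    show "g y = g x"
    proof (cases "snap m x \<in> P m")
      case True
      then show ?thesis
        using xy kernel_sum_cong[OF m xy(1) True xy(2,3), of f] F_eq_kernel_sum[OF f m] by (simp add: g_def)
    qed (simp add: g_def xy(3))
  qed (simp add: g_def split: if_splits)
  have gm: "(\<Sum>p\<in>P m. (cmod (g p))\<^sup>2) = (\<Sum>p\<in>P m. (cmod (f p))\<^sup>2)"
    unfolding kernel_sum_isometric[OF m, of f, symmetric]
  proof (rule sum.cong[OF refl])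
    fix p assume "p \<in> P m"
    from P_snap[OF m this] show "(cmod (g p))\<^sup>2 = (cmod (kernel_sum m f p))\<^sup>2"
      using F_eq_kernel_sum[OF f m] by (simp add: g_def)
  qed
  have "F f x = g x" if x: "x \<in> X2" for x
  proof -
    obtain i j where "snd (fst x) \<in> B i" "snd (snd x) \<in> B j"
      using Gamma_exhaust x by (metis mem_Times_iff)
    \<comment> \<open>A level at which \<open>x\<close> itself falls under the matrix
      formula.\<close>
    define m' where "m' = max m (max i j)"
    have mm': "m \<le> m'" "n \<le> m'" "i \<le> m'" "j \<le> m'" using m by (auto simp: m'_def)
    have xP: "snap m' x \<in> P m'"
      unfolding snap_P[OF x] using B_mono mm' \<open>snd (fst x) \<in> B i\<close> \<open>snd (snd x) \<in> B j\<close> by blast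
    note fV' = V_mono[OF m mm'(1) f] and gV' = V_mono[OF m mm'(1) gV]
    have q0: "(1 / real q ^ m')\<^sup>2 \<noteq> 0" using q_gt_1 by simp
    have F_eq: "F f p = kernel_sum m' f p" if "p \<in> P m'" for p
      using P_snap[OF mm'(2) that] F_eq_kernel_sum[OF fV' mm'(2)] by blast
    have "(\<Sum>p\<in>P m'. (cmod (F f p))\<^sup>2) = (\<Sum>p\<in>P m'. (cmod (f p))\<^sup>2)"
      unfolding kernel_sum_isometric[OF mm'(2), of f, symmetric] by (intro sum.cong refl) (simp add: F_eq)
    also have "\<dots> = (\<Sum>p\<in>P m'. (cmod (g p))\<^sup>2)"
      using trans[OF sum_P_eq_of_V[OF f m mm'(1)] sum_P_eq_of_V[OF gV m mm'(1), unfolded gm, symmetric]]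
      by (simp only: mult_left_cancel[OF q0])
    finally have "(\<Sum>p\<in>P m'. (cmod (F f p))\<^sup>2 - (cmod (g p))\<^sup>2) = 0"
      by (simp add: sum_subtractf)
    \<comment> \<open>Each term is nonnegative, since \<open>g\<close> is at every point either
      \<open>F f\<close> or zero.\<close>
    then have eq0: "\<forall>p\<in>P m'. (cmod (F f p))\<^sup>2 - (cmod (g p))\<^sup>2 = 0"
      by (subst (asm) sum_nonneg_eq_0_iff[OF finite_P[OF mm'(2)]]) (auto simp: g_def)
    have Fg: "F f p = g p" if "p \<in> P m'" for p
      using bspec[OF eq0 that] by (auto simp: g_def split: if_splits)
    have "F f x = kernel_sum m' f x" by (rule F_eq_kernel_sum[OF fV' mm'(2) x xP])
    also have "\<dots> = kernel_sum m' f (snap m' x)"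
      by (rule kernel_sum_cong[OF mm'(2) x xP snap_in_X2[OF mm'(2) x], symmetric]) (simp add: snap_snap)
    also have "\<dots> = g (snap m' x)" using F_eq[OF xP] Fg[OF xP] by simp
    also have "\<dots> = g x" by (rule V_snap[OF gV' mm'(2) x])
    finally show ?thesis .
  qed
  then show ?thesis by (rule V_cong[OF gV])
qed

lemma F_isometric:
  assumes f: "f \<in> V m" and m: "n \<le> m"
  shows "L2_norm M (F f) = L2_norm M f"
proof -
  have "(\<Sum>p\<in>P m. (cmod (F f p))\<^sup>2) = (\<Sum>p\<in>P m. (cmod (f p))\<^sup>2)"
    unfolding kernel_sum_isometric[OF m, of f, symmetric]
    by (intro sum.cong refl) (use P_snap[OF m] F_eq_kernel_sum[OF f m] in simp)
  then have "(L2_norm M (F f))\<^sup>2 = (L2_norm M f)\<^sup>2"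
    by (simp only: L2_norm_V[OF f m] L2_norm_V[OF F_in_V[OF f m] m])
  then show ?thesis by (rule power2_eq_imp_eq) simp_all
qed

lemma V_eqI:
  fixes f g :: "_ \<Rightarrow> 'b::real_vector"
  assumes "f \<in> V m" "g \<in> V m" "n \<le> m" "\<And>p. p \<in> P m \<Longrightarrow> f p = g p" "x \<in> X2"
  shows "f x = g x"
  using V_decompose[OF assms(1,3,5)] V_decompose[OF assms(2,3,5)] assms(4) by simp

lemma F_surj:
  assumes g: "g \<in> V m" and m: "n \<le> m"
  obtains f where "f \<in> V m" "\<And>x. x \<in> X2 \<Longrightarrow> F f x = g x"
proof -
  \<comment> \<open>The conjugate transpose of the scaled matrix, applied to \<open>g\<close>.
    Orthogonality of the rows makes it a right inverse.\<close>
  define f where "f p = (if snap m p \<in> P m then cnj (kernel_scale m) * (\<Sum>h\<in>P m. cnj (K h p) * g h) else 0)" for p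
  have fV: "f \<in> V m"
  proof (rule VI)
    fix x y assume xy: "x \<in> X2" "y \<in> X2" "snap m y = snap m x"
    show "f y = f x"
    proof (cases "snap m x \<in> P m")
      case True
      have "K h y = K h x" if "h \<in> P m" for h
        using P_snap[OF m that] by (intro K_cong[OF m xy(1) True xy(2,3)]) auto
      then show ?thesis using xy(3) by (simp add: f_def)
    qed (simp add: f_def xy(3))
  qed (simp add: f_def split: if_splits)
  have "F f h = g h" if h: "h \<in> P m" for h
  proof -
    have "F f h = kernel_sum m f h" using P_snap[OF m h] F_eq_kernel_sum[OF fV m] by blast
    also have "\<dots> = kernel_scale m * (\<Sum>p\<in>P m. K h p * (cnj (kernel_scale m) * (\<Sum>h'\<in>P m. cnj (K h' p) * g h')))"
      unfolding kernel_sum_def using P_snap[OF m] by (simp add: f_def)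
    also have "\<dots> = (\<Sum>p\<in>P m. \<Sum>h'\<in>P m. kernel_scale m * (K h p * (cnj (kernel_scale m) * (cnj (K h' p) * g h'))))"
      by (simp only: sum_distrib_left)
    also have "\<dots> = (\<Sum>h'\<in>P m. \<Sum>p\<in>P m. kernel_scale m * (K h p * (cnj (kernel_scale m) * (cnj (K h' p) * g h'))))"
      by (rule sum.swap)
    also have "\<dots> = (\<Sum>h'\<in>P m. if h = h' then g h' else 0)"
    proof (rule sum.cong[OF refl])
      fix h' assume h': "h' \<in> P m"
      have "(\<Sum>p\<in>P m. kernel_scale m * (K h p * (cnj (kernel_scale m) * (cnj (K h' p) * g h'))))
        = (\<Sum>p\<in>P m. (kernel_scale m * cnj (kernel_scale m) * g h') * (K h p * cnj (K h' p)))"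
        by (simp only: mult_ac)
      also have "\<dots> = (kernel_scale m * cnj (kernel_scale m) * g h') * (\<Sum>p\<in>P m. K h p * cnj (K h' p))"
        by (simp only: sum_distrib_left)
      also have "\<dots> = (if h = h' then (kernel_scale m * cnj (kernel_scale m) * of_nat (N m ^ 4)) * g h' else 0)"
        unfolding K_orthogonal_rows[OF m h h'] by simp
      finally show "(\<Sum>p\<in>P m. kernel_scale m * (K h p * (cnj (kernel_scale m) * (cnj (K h' p) * g h')))) = (if h = h' then g h' else 0)"
        by (simp only: kernel_scale_N mult_1)
    qed
    also have "\<dots> = g h" using finite_P[OF m] h by simp
    finally show ?thesis .
  qed
  then have "F f x = g x" if "x \<in> X2" for x
    by (rule V_eqI[OF F_in_V[OF fV m] g m _ that])
  with fV show ?thesis by (rule that)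
qed

end

context unitary_setting
begin

section \<open>Test functions and the unitary extension\<close>

lemma topspace_XX [simp]: "topspace (XX_topology av \<pi> n) = X2"
  by (simp add: XX_topology_def X_topology_def)

lemma openin_box:
  assumes "n \<le> m" "x \<in> X2"
  shows "openin (XX_topology av \<pi> n) (box m x)"
proof -
  obtain a1 T1 a2 T2 where x: "x = ((a1, T1), (a2, T2))" "a1 \<in> U" "a2 \<in> U" "T1 \<in> \<Gamma>" "T2 \<in> \<Gamma>"
    using assms(2) by auto
  have "openin (top_of_set U) (cos (int m) a)" if "a \<in> U" for a
    using open_coset coset_subset_U[OF assms(1) that] by (simp add: openin_open_eq open_subset)
  then show ?thesis
    unfolding x(1) box_def XX_topology_def X_topology_def using x by (simp add: openin_prod_Times_iff)
qed

text \<open>The level is also raised until \<open>snap m x\<close> lies in \<open>P m\<close>, so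
  that a finite subcover bounds the level of invariance and the support at once.\<close>

lemma open_imp_box:
  assumes W: "openin (XX_topology av \<pi> n) W" and x: "x \<in> W"
  obtains m where "n \<le> m" "box m x \<subseteq> W" "snap m x \<in> P m"
proof -
  have xX: "x \<in> X2" using openin_subset[OF W] x by auto
  obtain a1 T1 a2 T2 where x': "x = ((a1, T1), (a2, T2))" by (metis surj_pair)
  have T\<Gamma>: "T1 \<in> \<Gamma>" "T2 \<in> \<Gamma>" using xX by (simp_all add: x')
  obtain W1 W2 where W': "openin (X_topology av \<pi> n) W1" "openin (X_topology av \<pi> n) W2"
      "(a1, T1) \<in> W1" "(a2, T2) \<in> W2" "W1 \<times> W2 \<subseteq> W"
    using W x unfolding x' XX_topology_def openin_prod_topology_alt by meson
  have side: "\<exists>k. \<forall>m\<ge>k. cos (int m) a \<times> {T} \<subseteq> W'" if W': "openin (X_topology av \<pi> n) W'" "(a, T) \<in> W'" for W' a T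
  proof -
    obtain A C where A: "openin (top_of_set U) A" "a \<in> A" "T \<in> C" "A \<times> C \<subseteq> W'"
      using W' unfolding X_topology_def openin_prod_topology_alt by meson
    obtain O' where O: "open O'" "A = U \<inter> O'" using A(1) unfolding openin_open by blast
    obtain j where j: "j \<ge> n" "cos (int j) a \<subseteq> O'" using open_imp_coset[of O' a n] O A(2) by blast
    have "cos (int m) a \<times> {T} \<subseteq> W'" if "m \<ge> j" for m
    proof -
      have "cos (int m) a \<subseteq> cos (int j) a"
        using that frac_ideal_mono[of "int j" "int m"] by (auto simp: coset_def)
      moreover have "cos (int m) a \<subseteq> U" using coset_subset_U[of m a] that j O A(2) by auto
      ultimately have "cos (int m) a \<times> {T} \<subseteq> A \<times> C" using j O A(3) by blast
      then show ?thesis using A(4) by (rule order_trans)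
    qed
    then show ?thesis by blast
  qed
  obtain k1 where k1: "\<forall>m\<ge>k1. cos (int m) a1 \<times> {T1} \<subseteq> W1" using side[OF W'(1,3)] ..
  obtain k2 where k2: "\<forall>m\<ge>k2. cos (int m) a2 \<times> {T2} \<subseteq> W2" using side[OF W'(2,4)] ..
  obtain j1 where j1: "T1 \<in> B j1" using Gamma_exhaust[OF T\<Gamma>(1), of 0] by auto
  obtain j2 where j2: "T2 \<in> B j2" using Gamma_exhaust[OF T\<Gamma>(2), of 0] by auto
  define m where "m = Max {n, k1, k2, j1, j2}"
  have m: "n \<le> m" "k1 \<le> m" "k2 \<le> m" "j1 \<le> m" "j2 \<le> m" by (auto simp: m_def)
  have "box m x \<subseteq> W1 \<times> W2"
    unfolding x' box_def using k1 k2 m by (simp add: Sigma_mono)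
  then have "box m x \<subseteq> W" using W'(5) by (rule order_trans)
  moreover have "snap m x \<in> P m"
    unfolding snap_P[OF xX] using j1 j2 m B_mono by (simp add: x')
  ultimately show ?thesis using m(1) that by blast
qed

lemma box_cong: "snap m x = snap m y \<Longrightarrow> box m x = box m y"
  by (cases x, cases y) (auto simp: snap_def box_def rep_coset_eq_iff)

lemma mem_box_self: "x \<in> box m x"
  by (cases x) (auto simp: box_def)

text \<open>Compactness of the support yields finitely many boxes on each of which \<open>f\<close>
  is constant. The largest of their levels works, because boxes are nested.\<close>

lemma test_function_in_V:
  assumes f: "f \<in> test_functions (XX_topology av \<pi> n)"
  obtains m where "n \<le> m" "f \<in> V m"
proof -
  let ?T = "XX_topology av \<pi> n"
  let ?K = "?T closure_of {x \<in> X2. f x \<noteq> 0}"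
  have lc: "locally_constant_on ?T f" and K: "compactin ?T ?K"
    using f by (auto simp: test_functions_def)
  have "\<exists>m. n \<le> m \<and> (\<forall>y\<in>box m x. f y = f x) \<and> snap m x \<in> P m" if x: "x \<in> X2" for x
  proof -
    have "x \<in> topspace ?T" using x by simp
    then obtain W where W: "openin ?T W" "x \<in> W" "\<forall>y\<in>W. f y = f x"
      using lc unfolding locally_constant_on_def by meson
    obtain m where "n \<le> m" "box m x \<subseteq> W" "snap m x \<in> P m" using open_imp_box[OF W(1,2)] .
    then show ?thesis using W(3) by blast
  qed
  then have "\<forall>x\<in>X2. \<exists>m. n \<le> m \<and> (\<forall>y\<in>box m x. f y = f x) \<and> snap m x \<in> P m" by (rule ballI)
  from bchoice[OF this] obtain lev where
    L: "\<forall>x\<in>X2. n \<le> lev x \<and> (\<forall>y\<in>box (lev x) x. f y = f x) \<and> snap (lev x) x \<in> P (lev x)" ..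
  have lev: "n \<le> lev x" "y \<in> box (lev x) x \<Longrightarrow> f y = f x" "snap (lev x) x \<in> P (lev x)" if "x \<in> X2" for x y
    using bspec[OF L that] by simp_all
  let ?W = "\<lambda>x. box (lev x) x"
  have KX: "?K \<subseteq> X2" using closure_of_subset_topspace[of ?T] by simp
  have "\<forall>E\<in>?W ` X2. openin ?T E"
    by (intro ballI, elim imageE) (simp only: openin_box lev(1))
  moreover have "?K \<subseteq> \<Union>(?W ` X2)"
  proof
    fix x assume "x \<in> ?K"
    then show "x \<in> \<Union>(?W ` X2)" by (intro UN_I[OF subsetD[OF KX] mem_box_self])
  qed
  ultimately have "\<exists>\<F>. finite \<F> \<and> \<F> \<subseteq> ?W ` X2 \<and> ?K \<subseteq> \<Union>\<F>"
    using K[unfolded compactin_def, THEN conjunct2, rule_format, of "?W ` X2"] by simp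
  then obtain \<F> where \<F>: "finite \<F>" "\<F> \<subseteq> ?W ` X2" "?K \<subseteq> \<Union>\<F>" by (elim exE conjE)
  from finite_subset_image[OF \<F>(1,2)] obtain D where "D \<subseteq> X2" "finite D" "\<F> = ?W ` D" by (elim exE conjE)
  with \<F>(3) have D: "finite D" "D \<subseteq> X2" "?K \<subseteq> (\<Union>x\<in>D. ?W x)" by simp_all
  define m where "m = Max (insert n (lev ` D))"
  have levm: "lev d \<le> m" if "d \<in> D" for d
    using D(1) that by (simp add: m_def)
  have nm: "n \<le> m" using D(1) by (simp add: m_def)
  have near: "\<exists>d\<in>D. x \<in> ?W d" if x: "x \<in> X2" "f x \<noteq> 0" for x
  proof -
    have "{x \<in> X2. f x \<noteq> 0} \<subseteq> ?K" by (intro closure_of_subset) simp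
    then have "x \<in> ?K" by (rule subsetD) (intro CollectI conjI x)
    from subsetD[OF D(3) this] show ?thesis by (rule UN_E) (rule bexI)
  qed
  \<comment> \<open>Restricted to nonzero values, where the finite cover applies; zero values follow
    by exchanging \<open>x\<close> and \<open>y\<close>.\<close>
  have const: "f y = f x" if xy: "x \<in> X2" "y \<in> X2" "snap m y = snap m x" "f x \<noteq> 0" for x y
  proof -
    obtain d where d: "d \<in> D" "x \<in> ?W d" using near[OF xy(1,4)] by blast
    have dX: "d \<in> X2" by (rule subsetD[OF D(2) d(1)])
    have "snap (lev d) y = snap (lev d) x"
      using snap_snap[OF levm[OF d(1)]] xy(3) by metis
    then have "box (lev d) y = ?W d" unfolding box_eq_box[OF d(2)] by (rule box_cong)
    then have "y \<in> ?W d" using mem_box_self[of y "lev d"] by simp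
    then show ?thesis using lev(2)[OF dX, of y] lev(2)[OF dX d(2)] by simp
  qed
  have "f \<in> V m"
  proof (rule VI)
    fix x y assume "x \<in> X2" "y \<in> X2" "snap m y = snap m x"
    then show "f y = f x" using const[of x y] const[of y x] by metis
  next
    fix x assume x: "x \<in> X2" "f x \<noteq> 0"
    obtain d where d: "d \<in> D" "x \<in> ?W d" using near[OF x] by blast
    have dX: "d \<in> X2" by (rule subsetD[OF D(2) d(1)])
    have "snd (fst d) \<in> B (lev d)" "snd (snd d) \<in> B (lev d)"
      using lev(3)[OF dX] unfolding snap_P[OF dX] by auto
    moreover have "snd (fst x) = snd (fst d)" "snd (snd x) = snd (snd d)"
      using d(2) by (auto simp: box_def split: prod.splits)
    ultimately show "snap m x \<in> P m"
      unfolding snap_P[OF x(1)] using B_mono[OF levm[OF d(1)]] by simp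
  qed
  with nm show ?thesis by (rule that)
qed

text \<open>Every \<open>h\<close> is covered by \<open>P k\<close> at some higher level
  \<open>k\<close>, and \<open>f\<close> is a function of that level too.\<close>

lemma integrable_F_integrand:
  assumes f: "f \<in> V m" "n \<le> m" and h: "h \<in> X2"
  shows "integrable M (F_integrand av \<pi> \<Psi> n f h)"
proof -
  have "snd (fst h) \<in> \<Gamma>" "snd (snd h) \<in> \<Gamma>" using h by auto
  then obtain i j where ij: "snd (fst h) \<in> B i" "snd (snd h) \<in> B j" using Gamma_exhaust by metis
  define k where "k = max m (max i j)"
  have k: "m \<le> k" "i \<le> k" "j \<le> k" "n \<le> k" using f(2) by (auto simp: k_def)
  have "snap k h \<in> P k"
    unfolding snap_P[OF h] using B_mono[OF k(2) ij(1)] B_mono[OF k(3) ij(2)] by simp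
  from integral_V[OF F_integrand_V[OF V_mono[OF f(2) k(1) f(1)] k(4) h this] k(4)]
  show ?thesis by blast
qed

lemma F_add:
  assumes f: "f \<in> V m" "n \<le> m" and g: "g \<in> V k" "n \<le> k" and h: "h \<in> X2"
  shows "F (\<lambda>x. f x + g x) h = F f h + F g h"
proof -
  have "F_integrand av \<pi> \<Psi> n (\<lambda>x. f x + g x) h
    = (\<lambda>x. F_integrand av \<pi> \<Psi> n f h x + F_integrand av \<pi> \<Psi> n g h x)"
    by (auto simp: F_integrand_def fun_eq_iff distrib_left split: prod.splits)
  then show ?thesis
    using integrable_F_integrand[OF f h] integrable_F_integrand[OF g h]
    by (simp add: F_op_def distrib_left)
qed

lemma F_scale: "F (\<lambda>x. a * f x) h = a * F f h"
proof -
  have "F_integrand av \<pi> \<Psi> n (\<lambda>x. a * f x) h = (\<lambda>x. a * F_integrand av \<pi> \<Psi> n f h x)"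
    by (auto simp: F_integrand_def fun_eq_iff split: prod.splits)
  then show ?thesis by (simp add: F_op_def)
qed

text \<open>\<open>g\<close> is prescribed on \<open>X2\<close> only, because \<open>F_surj\<close>
  produces preimages up to equality there.\<close>

definition F_graph :: "((('k \<times> 'k set) \<times> ('k \<times> 'k set) \<Rightarrow> complex) \<times> (('k \<times> 'k set) \<times> ('k \<times> 'k set) \<Rightarrow> complex)) set" where
  "F_graph = {(f, g). \<exists>m. n \<le> m \<and> f \<in> V m \<and> (\<forall>x\<in>X2. g x = F f x)}"

lemma F_graphI: "n \<le> m \<Longrightarrow> f \<in> V m \<Longrightarrow> (\<And>x. x \<in> X2 \<Longrightarrow> g x = F f x) \<Longrightarrow> (f, g) \<in> F_graph"
  unfolding F_graph_def by blast

lemma F_graphE: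
  assumes "(f, g) \<in> F_graph"
  obtains m where "n \<le> m" "f \<in> V m" "\<And>x. x \<in> X2 \<Longrightarrow> g x = F f x" "g \<in> V m"
proof -
  obtain m where m: "n \<le> m" "f \<in> V m" "\<forall>x\<in>X2. g x = F f x"
    using assms unfolding F_graph_def by blast
  have eq: "g x = F f x" if "x \<in> X2" for x using bspec[OF m(3) that] .
  show ?thesis by (rule that[OF m(1,2) eq V_cong[OF F_in_V[OF m(2,1)] eq]])
qed

text \<open>Density of the second components reduces to that of the first, since \<open>F\<close>
  maps the functions of each level onto themselves up to values outside \<open>X2\<close>.\<close>

lemma L2_isometric_graph_F: "L2_isometric_graph M F_graph"
proof
  fix f g assume fg: "(f, g) \<in> F_graph"
  obtain m where m: "n \<le> m" "f \<in> V m" "\<And>x. x \<in> X2 \<Longrightarrow> g x = F f x" "g \<in> V m"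
    by (rule F_graphE[OF fg]) (rule that)
  show "f \<in> L2_fun M \<and> g \<in> L2_fun M" using V_L2_fun m by blast
  have "L2_norm M g = L2_norm M (F f)"
    unfolding L2_norm_def by (intro arg_cong[of _ _ sqrt] Bochner_Integration.integral_cong refl) (simp add: m(3))
  then show "L2_norm M g = L2_norm M f" using F_isometric[OF m(2,1)] by simp
  fix f' g' assume fg': "(f', g') \<in> F_graph"
  obtain k where k: "n \<le> k" "f' \<in> V k" "\<And>x. x \<in> X2 \<Longrightarrow> g' x = F f' x"
    by (rule F_graphE[OF fg']) (rule that)
  have "(\<lambda>x. f x + f' x) \<in> V (max m k)"
    by (intro V_add V_mono[OF m(1) _ m(2)] V_mono[OF k(1) _ k(2)]) simp_all
  then show "(\<lambda>x. f x + f' x, \<lambda>x. g x + g' x) \<in> F_graph"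
    by (rule F_graphI[rotated]) (use m k F_add[OF m(2,1) k(2,1)] in simp_all)
next
  fix f g a assume fg: "(f, g) \<in> F_graph"
  obtain m where m: "n \<le> m" "f \<in> V m" "\<And>x. x \<in> X2 \<Longrightarrow> g x = F f x"
    by (rule F_graphE[OF fg]) (rule that)
  show "(\<lambda>x. a * f x, \<lambda>x. a * g x) \<in> F_graph"
    by (rule F_graphI[OF m(1) V_map[OF m(2)]]) (simp_all add: m(3) F_scale)
next
  fix f :: "_ \<Rightarrow> complex" and e :: real assume "f \<in> L2_fun M" "e > 0"
  then obtain d where d: "d \<in> test_space" "L2_norm M (\<lambda>x. f x - d x) < e"
    using test_space_dense by blast
  obtain m where m: "n \<le> m" "d \<in> V m" using test_spaceE[OF d(1)] .
  show "\<exists>(d, d')\<in>F_graph. L2_norm M (\<lambda>x. f x - d x) < e"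
    using d(2) by (intro bexI[OF _ F_graphI[OF m refl]]) simp
  obtain b where b: "b \<in> V m" "\<And>x. x \<in> X2 \<Longrightarrow> F b x = d x"
    by (rule F_surj[OF m(2,1)]) (rule that)
  show "\<exists>(d, d')\<in>F_graph. L2_norm M (\<lambda>x. f x - d' x) < e"
    using d(2) by (intro bexI[OF _ F_graphI[OF m(1) b(1) b(2)[symmetric]]]) simp_all
qed

lemma F_extends_to_unitary:
  "\<exists>T. L2_unitary M T \<and> (\<forall>f\<in>test_functions (XX_topology av \<pi> n).
     L2_class M f \<in> L2 M \<and> T (L2_class M f) = L2_class M (F f))"
proof -
  interpret G: L2_isometric_graph M F_graph by (rule L2_isometric_graph_F)
  show ?thesis
  proof (intro exI conjI ballI)
    show "L2_unitary M G.ext" by (rule G.L2_unitary_ext)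
    fix f assume "f \<in> test_functions (XX_topology av \<pi> n)"
    then obtain m where m: "n \<le> m" "f \<in> V m" by (rule test_function_in_V)
    show "L2_class M f \<in> L2 M" unfolding L2_def by (rule imageI[OF V_L2_fun[OF m(2,1)]])
    show "G.ext (L2_class M f) = L2_class M (F f)"
      by (rule G.ext_class[OF G.Rel_graph[OF F_graphI[OF m refl]]])
  qed
qed

end

theorem theorem3p4:
  fixes av :: "'k::{field, metric_space} \<Rightarrow> real"
    and \<pi> :: 'k
    and \<Psi> :: "'k \<Rightarrow> complex"
    and \<mu> :: "'k measure"
    and n :: nat
  assumes "nonarch_local_field av \<pi>"
    and "CHAR('k) \<noteq> 2"
    and "\<not> is_extension_of_Qp 2 TYPE('k)"
    and "unramified_character av \<pi> \<Psi>"
    and "normalized_Haar av \<mu>"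
    and "n \<ge> 1"
  shows "(\<forall>f\<in>test_functions (XX_topology av \<pi> n). \<forall>h\<in>topspace (XX_topology av \<pi> n).
            integrable (XX_measure av \<pi> \<mu> n) (F_integrand av \<pi> \<Psi> n f h)) \<and>
         (\<exists>T. L2_unitary (XX_measure av \<pi> \<mu> n) T \<and>
            (\<forall>f\<in>test_functions (XX_topology av \<pi> n).
               L2_class (XX_measure av \<pi> \<mu> n) f \<in> L2 (XX_measure av \<pi> \<mu> n) \<and>
               T (L2_class (XX_measure av \<pi> \<mu> n) f) =
                 L2_class (XX_measure av \<pi> \<mu> n) (F_op av \<pi> \<Psi> \<mu> n f)))"
proof -
  interpret nonarch_local_field av \<pi> by (rule assms(1))
  interpret unitary_setting av \<pi> \<Psi> \<mu> n
    by unfold_locales (rule assms(4) assms(5) assms(6) av_2_eq_1[OF assms(2,3)])+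
  show ?thesis
  proof (intro conjI ballI)
    fix f h assume f: "f \<in> test_functions (XX_topology av \<pi> n)" and h: "h \<in> topspace (XX_topology av \<pi> n)"
    obtain m where m: "n \<le> m" "f \<in> V m" using test_function_in_V[OF f] .
    show "integrable (XX_measure av \<pi> \<mu> n) (F_integrand av \<pi> \<Psi> n f h)"
      by (rule integrable_F_integrand[OF m(2,1) h[unfolded topspace_XX]])
  qed (rule F_extends_to_unitary)
qed

end
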